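(* There exists a Polish monothetic group which is not a Lévy group but which admits a whirly action on a standard Lebesgue space.
   Context: A topological group is monothetic if it has a dense cyclic subgroup. A standard Lebesgue space $(X,\mathcal{X},\mu)$ here is a (nonatomic) standard probability space, isomorphic to $[0,1]$ with Lebesgue measure; sets are identified modulo null sets. $\mathrm{Aut}(X,\mathcal{X},\mu)$ is the Polish group of equivalence classes (mod null sets) of invertible measure preserving transformations, with the topology whose neighborhoods of the identity are generated by the sets $\{T:\mu(A\triangle TA)<\varepsilon\}$, $A\in\mathcal{X}$, $\varepsilon>0$. An action (near-action, boolean action) of a Polish group $G$ on $(X,\mathcal{X},\mu)$ is a continuous homomorphism $G\to\mathrm{Aut}(X,\mathcal{X},\mu)$. It is whirly if for all $A,B\in\mathcal{X}$ of positive measure, every neighborhood of $e$ in $G$ contains some $g$ with $\mu(A\cap gB)>0$. A sequence $(X_n,d_n,\mu_n)$ of metric spaces with probability measures is a Lévy family if, whenever $A_n\subset X_n$ are (measurable) subsets with $\liminf\mu_n(A_n)>0$, then for every $\varepsilon>0$, $\lim\mu_n(B_\varepsilon(A_n))=1$, where $B_\varepsilon(A)$ is the $\varepsilon$-neighborhood of $A$. A Polish group $G$ is a Lévy group if there are compact subgroups $K_n\subset K_{n+1}$, $n\in\mathbb{N}$, of $G$ with $\bigcup_nK_n$ dense in $G$ such that $(K_n,d,m_n)$ is a Lévy family, where $m_n$ is normalized Haar measure on $K_n$ and $d$ is a right-invariant compatible metric on $G$. *)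

theory Defs
  imports
    "HOL-Analysis.Analysis"
    "HOL-Probability.Probability_Measure"
    "HOL-Algebra.Coset"
    "HOL-Algebra.Generated_Groups"
begin

section \<open>Polish groups\<close>

definition topological_group :: "('a, 'm) monoid_scheme \<Rightarrow> 'a topology \<Rightarrow> bool" where
  "topological_group G T \<longleftrightarrow>
     group G \<and> topspace T = carrier G \<and>
     continuous_map (prod_topology T T) T (\<lambda>(x, y). x \<otimes>\<^bsub>G\<^esub> y) \<and>
     continuous_map T T (\<lambda>x. inv\<^bsub>G\<^esub> x)"

definition polish_group :: "('a, 'm) monoid_scheme \<Rightarrow> 'a topology \<Rightarrow> bool" where
  "polish_group G T \<longleftrightarrow>
     topological_group G T \<and> completely_metrizable_space T \<and> separable_space T"

definition monothetic :: "('a, 'm) monoid_scheme \<Rightarrow> 'a topology \<Rightarrow> bool" where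
  "monothetic G T \<longleftrightarrow> (\<exists>g \<in> carrier G. T closure_of (generate G {g}) = topspace T)"


section \<open>Levy families and Levy groups\<close>

definition set_nbhd :: "'a set \<Rightarrow> ('a \<Rightarrow> 'a \<Rightarrow> real) \<Rightarrow> 'a set \<Rightarrow> real \<Rightarrow> 'a set" where
  "set_nbhd X d A \<epsilon> = {x \<in> X. \<exists>a \<in> A. d a x < \<epsilon>}"

definition borel_sets_of :: "'a topology \<Rightarrow> 'a set set" where
  "borel_sets_of T = sigma_sets (topspace T) {U. openin T U}"

definition levy_family ::
    "(nat \<Rightarrow> 'a set) \<Rightarrow> (nat \<Rightarrow> 'a \<Rightarrow> 'a \<Rightarrow> real) \<Rightarrow> (nat \<Rightarrow> 'a measure) \<Rightarrow> bool" where
  "levy_family X d \<mu> \<longleftrightarrow>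
     (\<forall>n. Metric_space (X n) (d n) \<and> prob_space (\<mu> n) \<and> space (\<mu> n) = X n \<and>
          sets (\<mu> n) = borel_sets_of (Metric_space.mtopology (X n) (d n))) \<and>
     (\<forall>A. (\<forall>n. A n \<in> sets (\<mu> n)) \<longrightarrow> liminf (\<lambda>n. emeasure (\<mu> n) (A n)) > 0 \<longrightarrow>
        (\<forall>\<epsilon>>0. (\<lambda>n. measure (\<mu> n) (set_nbhd (X n) (d n) (A n) \<epsilon>)) \<longlonglongrightarrow> 1))"

definition normalized_haar ::
    "('a, 'm) monoid_scheme \<Rightarrow> 'a topology \<Rightarrow> 'a set \<Rightarrow> 'a measure \<Rightarrow> bool" where
  "normalized_haar G T K m \<longleftrightarrow>
     prob_space m \<and> space m = K \<and> sets m = borel_sets_of (subtopology T K) \<and>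
     (\<forall>k \<in> K. \<forall>A \<in> sets m. emeasure m (k <#\<^bsub>G\<^esub> A) = emeasure m A)"

definition right_invariant_compatible_metric ::
    "('a, 'm) monoid_scheme \<Rightarrow> 'a topology \<Rightarrow> ('a \<Rightarrow> 'a \<Rightarrow> real) \<Rightarrow> bool" where
  "right_invariant_compatible_metric G T d \<longleftrightarrow>
     Metric_space (carrier G) d \<and> Metric_space.mtopology (carrier G) d = T \<and>
     (\<forall>x \<in> carrier G. \<forall>y \<in> carrier G. \<forall>g \<in> carrier G.
        d (x \<otimes>\<^bsub>G\<^esub> g) (y \<otimes>\<^bsub>G\<^esub> g) = d x y)"

definition levy_group :: "('a, 'm) monoid_scheme \<Rightarrow> 'a topology \<Rightarrow> bool" where
  "levy_group G T \<longleftrightarrow>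
     polish_group G T \<and>
     (\<exists>K m d. (\<forall>n. subgroup (K n) G \<and> compactin T (K n) \<and> K n \<subseteq> K (Suc n)) \<and>
        T closure_of (\<Union>n. K n) = topspace T \<and>
        (\<forall>n. normalized_haar G T (K n) (m n)) \<and>
        right_invariant_compatible_metric G T d \<and>
        levy_family K (\<lambda>_. d) m)"


section \<open>Standard Lebesgue spaces and their automorphism groups\<close>

text \<open>Isomorphism is meant up to null sets: \<open>f\<close> and \<open>g\<close> are measure preserving and mutually
  inverse almost everywhere.\<close>

definition standard_lebesgue_space :: "'b measure \<Rightarrow> bool" where
  "standard_lebesgue_space M \<longleftrightarrow>
     prob_space M \<and>
     (let L = lebesgue_on {0..1::real} in
       \<exists>f \<in> measurable M L. \<exists>g \<in> measurable L M.
         distr M L f = L \<and> distr L M g = M \<and>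
         (AE x in M. g (f x) = x) \<and> (AE y in L. f (g y) = y))"

definition mp_transf :: "'b measure \<Rightarrow> ('b \<Rightarrow> 'b) set" where
  "mp_transf M =
     {f \<in> measurable M M. bij_betw f (space M) (space M) \<and>
        the_inv_into (space M) f \<in> measurable M M \<and> distr M M f = M}"

definition ae_rel :: "'b measure \<Rightarrow> (('b \<Rightarrow> 'b) \<times> ('b \<Rightarrow> 'b)) set" where
  "ae_rel M = {(f, g). f \<in> mp_transf M \<and> g \<in> mp_transf M \<and> (AE x in M. f x = g x)}"

definition aut_group :: "'b measure \<Rightarrow> ('b \<Rightarrow> 'b) set monoid" where
  "aut_group M =
     \<lparr>carrier = mp_transf M // ae_rel M,
      mult = (\<lambda>a b. \<Union>f \<in> a. \<Union>g \<in> b. ae_rel M `` {f \<circ> g}),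
      one = ae_rel M `` {id}\<rparr>"

text \<open>Since representatives are genuine bijections, \<open>f ` A\<close> is measurable and independent of the
  representative \<open>f\<close> of a class up to a null set; see \<open>ae_rel_image\<close> below.\<close>

definition aut_nbhd :: "'b measure \<Rightarrow> 'b set \<Rightarrow> real \<Rightarrow> ('b \<Rightarrow> 'b) set set" where
  "aut_nbhd M A \<epsilon> =
     {a \<in> carrier (aut_group M). \<exists>f \<in> a. measure M (sym_diff A (f ` A)) < \<epsilon>}"

text \<open>The subbase consists of all left translates of the prescribed neighbourhoods of the identity.\<close>

definition aut_topology :: "'b measure \<Rightarrow> ('b \<Rightarrow> 'b) set topology" where
  "aut_topology M =
     topology_generated_by
       {a <#\<^bsub>aut_group M\<^esub> aut_nbhd M A \<epsilon> | a A \<epsilon>.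
          a \<in> carrier (aut_group M) \<and> A \<in> sets M \<and> \<epsilon> > 0}"


section \<open>Boolean actions\<close>

definition boolean_action ::
    "('a, 'm) monoid_scheme \<Rightarrow> 'a topology \<Rightarrow> 'b measure \<Rightarrow> ('a \<Rightarrow> ('b \<Rightarrow> 'b) set) \<Rightarrow> bool" where
  "boolean_action G T M \<phi> \<longleftrightarrow>
     \<phi> \<in> hom G (aut_group M) \<and> continuous_map T (aut_topology M) \<phi>"

definition whirly ::
    "('a, 'm) monoid_scheme \<Rightarrow> 'a topology \<Rightarrow> 'b measure \<Rightarrow> ('a \<Rightarrow> ('b \<Rightarrow> 'b) set) \<Rightarrow> bool" where
  "whirly G T M \<phi> \<longleftrightarrow>
     (\<forall>A \<in> sets M. \<forall>B \<in> sets M. measure M A > 0 \<longrightarrow> measure M B > 0 \<longrightarrow>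
        (\<forall>U. openin T U \<longrightarrow> \<one>\<^bsub>G\<^esub> \<in> U \<longrightarrow>
           (\<exists>g \<in> U. \<exists>f \<in> \<phi> g. measure M (A \<inter> f ` B) > 0)))"


section \<open>Well-definedness\<close>

lemma mp_transf_image_eq:
  assumes "f \<in> mp_transf M" "A \<in> sets M"
  shows "f ` A = the_inv_into (space M) f -` A \<inter> space M"
proof -
  have b: "bij_betw f (space M) (space M)" using assms by (simp add: mp_transf_def)
  have A: "A \<subseteq> space M" using assms(2) by (rule sets.sets_into_space)
  have i: "inj_on f (space M)" using b by (simp add: bij_betw_def)
  show ?thesis
  proof (rule equalityI; rule subsetI)
    fix y assume "y \<in> f ` A"
    then obtain x where x: "x \<in> A" "y = f x" by blast
    then have "x \<in> space M" using A by blast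
    then show "y \<in> the_inv_into (space M) f -` A \<inter> space M"
      using x b the_inv_into_f_f[OF i] by (simp add: bij_betw_apply)
  next
    fix y assume y: "y \<in> the_inv_into (space M) f -` A \<inter> space M"
    then have "f (the_inv_into (space M) f y) = y"
      using f_the_inv_into_f_bij_betw[OF b] by auto
    with y show "y \<in> f ` A" by (metis IntD1 imageI vimageD)
  qed
qed

lemma mp_transf_image_sets:
  assumes "f \<in> mp_transf M" "A \<in> sets M"
  shows "f ` A \<in> sets M"
  unfolding mp_transf_image_eq[OF assms]
  using assms by (auto simp: mp_transf_def intro: measurable_sets)

lemma mp_transf_image_emeasure:
  assumes "f \<in> mp_transf M" "A \<in> sets M"
  shows "emeasure M (f ` A) = emeasure M A"
proof -
  have f: "f \<in> measurable M M" "bij_betw f (space M) (space M)" "distr M M f = M"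
    using assms by (auto simp: mp_transf_def)
  have "emeasure M (f ` A) = emeasure (distr M M f) (f ` A)" using f by simp
  also have "\<dots> = emeasure M (f -` (f ` A) \<inter> space M)"
    by (rule emeasure_distr[OF f(1) mp_transf_image_sets[OF assms]])
  also have "f -` (f ` A) \<inter> space M = A"
    using f(2) sets.sets_into_space[OF assms(2)] by (auto simp: bij_betw_def inj_on_def)
  finally show ?thesis .
qed

lemma ae_rel_image:
  assumes "(f, g) \<in> ae_rel M" "A \<in> sets M"
  shows "sym_diff (f ` A) (g ` A) \<in> null_sets M"
proof -
  have f: "f \<in> mp_transf M" and g: "g \<in> mp_transf M" and ae: "AE x in M. f x = g x"
    using assms by (auto simp: ae_rel_def)
  from ae obtain N where N: "{x \<in> space M. f x \<noteq> g x} \<subseteq> N" "emeasure M N = 0" "N \<in> sets M"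
    by (auto elim: AE_E)
  have "f ` N \<union> g ` N \<in> null_sets M"
    using N f g
    by (intro null_sets.Un) (auto simp: null_sets_def mp_transf_image_sets mp_transf_image_emeasure)
  moreover have "sym_diff (f ` A) (g ` A) \<subseteq> f ` N \<union> g ` N"
  proof -
    have A: "A \<subseteq> space M" using assms(2) by (rule sets.sets_into_space)
    have "f x = g x \<or> x \<in> N" if "x \<in> A" for x using that A N(1) by blast
    then have "f ` A \<subseteq> g ` A \<union> f ` N" "g ` A \<subseteq> f ` A \<union> g ` N"
      by (metis UnCI image_eqI image_subsetI)+
    then show ?thesis by blast
  qed
  moreover have "sym_diff (f ` A) (g ` A) \<in> sets M"
    using f g assms(2) by (intro sets.Un sets.Diff mp_transf_image_sets)
  ultimately show ?thesis using null_sets_subset by blast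
qed

end

(*
  Idea.  Let q_0 = 2, q_1, q_2, ... be pairwise coprime and let G be the l^1-sum of the cyclic groups
  Z/q_j for suitable norms nu_j (modulus and coord_norm below).  G is Polish; by the Chinese remainder theorem (1,1,1,...) generates
  a dense subgroup.  {c. c_0 = 0} is an open subgroup of index 2, so any increasing sequence of
  compact subgroups with dense union eventually meets it in a set of measure 1/2 that is its own
  epsilon-neighbourhood: G is not a Levy group.

  G acts on X = prod_j Z/q_j as follows.  On the first J coordinates conjugate the translation by c
  with the triangular bijection x_i |-> x_i - sum_{i<k<J} b_k(x_k), where b_k : Z/q_k -> Z
  (offset) is constant on blocks of length m_k (block).  For almost every x the result does not depend on J for large J,
  because nu_k(c_k) bounds the probability that b_k(x_k + c_k) differs from b_k(x_k) and
  Borel-Cantelli applies.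

  The values of b_k on consecutive blocks are triangular numbers, so their differences 0, 1, 2, ...
  are equidistributed modulo q_0 ... q_{k-1}.  Hence a shift of coordinate k by t < m_k, an element
  of norm about 2t/m_k, moves the first k coordinates with probability about t/m_k, and then to a
  uniformly distributed place.  With t/m_k fixed and k large these transformations tend weakly to
  (1 - t/m_k) Id + (t/m_k) E, where E is integration, and so no two sets of positive measure can be
  separated by a neighbourhood of the identity.
*)
theory Submission
  imports Defs "HOL-Number_Theory.Cong"
begin

section \<open>Mixed radix digits and the approximating flows\<close>

text \<open>Translations alone are never whirly: an element of small norm fixes the first
  coordinates, so it keeps disjoint cylinders apart. Conjugation by one fixed automorphism would not
  help. Hence the triangular bijections are built so that they do not converge as J grows, while
  their effect on each single translation does: the sums of the b_k(x_k) get no limit, and only the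
  differences b_k(x_k + c_k) - b_k(x_k), almost surely 0 for large k, have to be controlled. Blocks
  allow both: a step seldom crosses a block end, but a crossing can change b_k by any residue modulo
  q_0 ... q_{k-1}.

  The constants: let h_j = q_0 ... q_{j-1} (\<open>height\<close>) and m_j = 2^j h_j
  (\<open>block\<close>). Then q_j = m_j^2 + 1 leaves room for m_j blocks of length m_j and one
  extra point, which makes q_j coprime to h_j. Having m_j blocks, each jump residue modulo h_j
  occurs about 2^j times, so the loss at the end of the range is harmless. The factor 2^j also makes
  the norm of 1 in Z/q_j summable over j, so that (1,1,1,...) lies in G.\<close>

primrec height :: "nat \<Rightarrow> int" where
  "height 0 = 1"
| "height (Suc j) = height j * ((2 ^ j * height j)\<^sup>2 + 1)"

definition block :: "nat \<Rightarrow> int" where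
  "block j = 2 ^ j * height j"

definition modulus :: "nat \<Rightarrow> int" where
  "modulus j = (block j)\<^sup>2 + 1"

text \<open>With steps in triangular numbers, the jumps of \<open>offset j\<close> between consecutive blocks run
  through \<open>0, 1, 2, \<dots>\<close>, hence uniformly through the residues modulo \<open>height j\<close>.\<close>

definition triangular :: "int \<Rightarrow> int" where
  "triangular i = i * (i - 1) div 2"

definition offset :: "nat \<Rightarrow> int \<Rightarrow> int" where
  "offset j y = triangular ((y mod modulus j) div block j)"

lemma height_Suc: "height (Suc j) = height j * modulus j"
  by (simp add: modulus_def block_def)

declare height.simps(2) [simp del]

lemma height_pos: "height j > 0"
  by (induction j) (auto simp: height_Suc modulus_def intro!: mult_pos_pos add_nonneg_pos)

lemma block_pos: "block j > 0"
  by (simp add: block_def height_pos)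

lemma modulus_ge2: "modulus j \<ge> 2"
proof -
  have "1 \<le> block j" using block_pos[of j] by linarith
  then have "1 \<le> (block j)\<^sup>2" by (simp add: one_le_power)
  then show ?thesis by (simp add: modulus_def)
qed

lemma modulus_pos [simp]: "modulus j > 0" "modulus j \<noteq> 0" "0 \<le> modulus j"
  using modulus_ge2[of j] by auto

lemma modulus_0: "modulus 0 = 2"
  by (simp add: modulus_def block_def)

lemma triangular_Suc: "triangular (i + 1) - triangular i = i"
proof -
  have "i * (i - 1) + 2 * i = (i + 1) * i" by (simp add: algebra_simps)
  then have "triangular (i + 1) = (i * (i - 1) + 2 * i) div 2" by (simp add: triangular_def)
  also have "\<dots> = triangular i + i" by (simp add: triangular_def)
  finally show ?thesis by simp
qed

lemma modulus_dvd_height: "i < j \<Longrightarrow> modulus i dvd height j"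
proof (induction j)
  case (Suc j)
  then show ?case
    by (cases "i = j") (auto simp: height_Suc less_Suc_eq)
qed auto

text \<open>The square in \<open>modulus j\<close> is divisible by \<open>height j\<close>, so the
  summand 1 makes the two coprime.\<close>

lemma coprime_modulus_height: "coprime (height j) (modulus j)"
proof -
  have e: "modulus j - height j * (2 ^ j * 2 ^ j * height j) = 1"
    by (simp add: modulus_def block_def power2_eq_square)
  show ?thesis
  proof (rule coprimeI)
    fix c assume c: "c dvd height j" "c dvd modulus j"
    then have "c dvd modulus j - height j * (2 ^ j * 2 ^ j * height j)"
      by (intro dvd_diff dvd_mult2)
    then show "is_unit c" using e by simp
  qed
qed

text \<open>As \<open>height j\<close> is the product of the earlier moduli, the theorem for two
  moduli and induction suffice. It serves twice: for the density of the cyclic subgroup, and in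
  \<open>measure_flow_spike\<close> to encode a displacement of the first \<open>j\<close>
  coordinates by one integer.\<close>

lemma crt_modulus: "\<exists>n. \<forall>i<j. n mod modulus i = a i mod modulus i"
proof (induction j)
  case (Suc j)
  then obtain n where n: "\<forall>i<j. n mod modulus i = a i mod modulus i" by blast
  obtain x where x: "[x = n] (mod height j)" "[x = a j] (mod modulus j)"
    using binary_chinese_remainder_int[OF coprime_modulus_height] by blast
  have "x mod modulus i = a i mod modulus i" if "i < Suc j" for i
  proof (cases "i = j")
    case False
    with that have i: "i < j" by auto
    have "[x = n] (mod modulus i)"
      using x(1) modulus_dvd_height[OF i] cong_dvd_modulus by blast
    then show ?thesis using n i by (simp add: cong_def)
  qed (use x in \<open>simp add: cong_def\<close>)
  then show ?case by blast
qed auto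

section \<open>Triangular conjugation of translations and the limiting flow\<close>

definition Seqs :: "(nat \<Rightarrow> int) set" where
  "Seqs = {x. \<forall>i. 0 \<le> x i \<and> x i < modulus i}"

text \<open>\<open>c\<close> ranges over all integer sequences and only its residues matter
  (\<open>flow_cong\<close>), so inverses and differences are taken pointwise, without
  reduction.\<close>

definition translate :: "(nat \<Rightarrow> int) \<Rightarrow> (nat \<Rightarrow> int) \<Rightarrow> nat \<Rightarrow> int" where
  "translate c x = (\<lambda>i. (x i + c i) mod modulus i)"

definition shear :: "nat \<Rightarrow> (nat \<Rightarrow> int) \<Rightarrow> nat \<Rightarrow> int" where
  "shear j x = (\<lambda>i. if i < j then (x i - offset j (x j)) mod modulus i else x i)"

definition unshear :: "nat \<Rightarrow> (nat \<Rightarrow> int) \<Rightarrow> nat \<Rightarrow> int" where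
  "unshear j x = (\<lambda>i. if i < j then (x i + offset j (x j)) mod modulus i else x i)"

primrec straighten :: "nat \<Rightarrow> (nat \<Rightarrow> int) \<Rightarrow> nat \<Rightarrow> int" where
  "straighten 0 x = x"
| "straighten (Suc J) x = shear J (straighten J x)"

primrec unstraighten :: "nat \<Rightarrow> (nat \<Rightarrow> int) \<Rightarrow> nat \<Rightarrow> int" where
  "unstraighten 0 x = x"
| "unstraighten (Suc J) x = unstraighten J (unshear J x)"

definition fin_flow :: "nat \<Rightarrow> (nat \<Rightarrow> int) \<Rightarrow> (nat \<Rightarrow> int) \<Rightarrow> nat \<Rightarrow> int" where
  "fin_flow J c x = unstraighten J (translate c (straighten J x))"

text \<open>On \<open>settled c J\<close> the approximations \<open>fin_flow J' c\<close> agree for all \<open>J' \<ge> J\<close>. Off the union of these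
  sets, a null set, \<open>flow c\<close> is the plain translation; this makes it a genuine bijection with inverse
  \<open>flow (- c)\<close>, so no modification on null sets is needed.\<close>

definition settled :: "(nat \<Rightarrow> int) \<Rightarrow> nat \<Rightarrow> (nat \<Rightarrow> int) set" where
  "settled c J = {x \<in> Seqs. \<forall>k\<ge>J. offset k (x k + c k) = offset k (x k)}"

definition flow :: "(nat \<Rightarrow> int) \<Rightarrow> (nat \<Rightarrow> int) \<Rightarrow> nat \<Rightarrow> int" where
  "flow c x = (if \<exists>J. x \<in> settled c J then fin_flow (LEAST J. x \<in> settled c J) c x else translate c x)"

lemma SeqsD: "x \<in> Seqs \<Longrightarrow> x i mod modulus i = x i" "x \<in> Seqs \<Longrightarrow> 0 \<le> x i" "x \<in> Seqs \<Longrightarrow> x i < modulus i"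
  by (auto simp: Seqs_def)

lemma translate_Seqs [simp]: "translate c x \<in> Seqs"
  by (simp add: translate_def Seqs_def)

lemma shear_Seqs [simp]: "x \<in> Seqs \<Longrightarrow> shear j x \<in> Seqs"
  by (simp add: shear_def Seqs_def)

lemma unshear_Seqs [simp]: "x \<in> Seqs \<Longrightarrow> unshear j x \<in> Seqs"
  by (simp add: unshear_def Seqs_def)

lemma straighten_Seqs [simp]: "x \<in> Seqs \<Longrightarrow> straighten j x \<in> Seqs"
  by (induction j) auto

lemma unstraighten_Seqs [simp]: "x \<in> Seqs \<Longrightarrow> unstraighten j x \<in> Seqs"
  by (induction j arbitrary: x) auto

lemma unshear_shear: "x \<in> Seqs \<Longrightarrow> unshear j (shear j x) = x"
  by (auto simp: unshear_def shear_def SeqsD mod_simps)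

lemma shear_unshear: "x \<in> Seqs \<Longrightarrow> shear j (unshear j x) = x"
  by (auto simp: unshear_def shear_def SeqsD mod_simps)

lemma unstraighten_straighten: "x \<in> Seqs \<Longrightarrow> unstraighten j (straighten j x) = x"
  by (induction j) (auto simp: unshear_shear)

lemma straighten_unstraighten: "x \<in> Seqs \<Longrightarrow> straighten j (unstraighten j x) = x"
  by (induction j arbitrary: x) (auto simp: shear_unshear)

lemma translate_trans: "translate d (translate c x) = translate (\<lambda>i. c i + d i) x"
  by (rule ext) (simp add: translate_def mod_add_left_eq add.assoc)

lemma translate_0: "x \<in> Seqs \<Longrightarrow> translate (\<lambda>i. 0) x = x"
  by (auto simp: translate_def SeqsD)

lemma fin_flow_Seqs [simp]: "x \<in> Seqs \<Longrightarrow> fin_flow J c x \<in> Seqs"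
  by (simp add: fin_flow_def)

lemma fin_flow_fin_flow: "x \<in> Seqs \<Longrightarrow> fin_flow J d (fin_flow J c x) = fin_flow J (\<lambda>i. c i + d i) x"
  by (simp add: fin_flow_def straighten_unstraighten translate_trans)

lemma fin_flow_0: "x \<in> Seqs \<Longrightarrow> fin_flow J (\<lambda>i. 0) x = x"
  by (simp add: fin_flow_def translate_0 unstraighten_straighten)

text \<open>\<open>shear j\<close> reads coordinate \<open>j\<close> and alters only smaller ones,
  and the shears act in increasing order, so each reads an unaltered coordinate. The largest
  coordinate read, \<open>J - 1\<close>, is altered by none of the first \<open>J\<close>
  shears.\<close>

lemma straighten_ge: "i \<ge> J - 1 \<Longrightarrow> straighten J x i = x i"
  by (induction J) (auto simp: shear_def)

lemma unstraighten_ge: "i \<ge> J - 1 \<Longrightarrow> unstraighten J x i = x i"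
  by (induction J arbitrary: x) (auto simp: unshear_def)

lemma fin_flow_ge: "i \<ge> J - 1 \<Longrightarrow> fin_flow J c x i = (x i + c i) mod modulus i"
  by (simp add: fin_flow_def straighten_ge unstraighten_ge translate_def)

lemma offset_mod: "offset k (y mod modulus k) = offset k y"
  by (simp add: offset_def)

lemma offset_mod_add: "offset k (y mod modulus k + z) = offset k (y + z)"
  by (simp add: offset_def mod_simps)

text \<open>Subtracting an offset from the lower coordinates commutes with translating them.
  Conjugation by \<open>shear J\<close> therefore only adds to them the difference of the offsets at
  \<open>x J + c J\<close> and \<open>x J\<close>, which is 0 here.\<close>

lemma fin_flow_Suc_eq:
  assumes x: "x \<in> Seqs" and g: "offset J (x J + c J) = offset J (x J)"
  shows "fin_flow (Suc J) c x = fin_flow J c x"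
proof -
  let ?z = "straighten J x"
  have z: "?z \<in> Seqs" using x by simp
  have zJ: "?z J = x J" by (simp add: straighten_ge)
  have "unshear J (translate c (shear J ?z)) i = translate c ?z i" for i
  proof (cases "i < J")
    case True
    have "(((?z i - offset J (x J)) mod modulus i + c i) mod modulus i + offset J (x J)) mod modulus i
        = (?z i + c i) mod modulus i"
      by (simp add: mod_simps)
    then show ?thesis using True g zJ by (simp add: unshear_def shear_def translate_def offset_mod)
  qed (simp add: unshear_def shear_def translate_def)
  then have "unshear J (translate c (shear J ?z)) = translate c ?z" by blast
  then show ?thesis by (simp add: fin_flow_def)
qed

lemma settled_mono: "x \<in> settled c J \<Longrightarrow> J \<le> J' \<Longrightarrow> x \<in> settled c J'"
  by (auto simp: settled_def)

lemma fin_flow_stable: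
  assumes "x \<in> settled c J" "J \<le> J'"
  shows "fin_flow J' c x = fin_flow J c x"
  using assms(2)
proof (induction rule: dec_induct)
  case (step n)
  have "fin_flow (Suc n) c x = fin_flow n c x"
    using assms(1) step(1) unfolding settled_def by (intro fin_flow_Suc_eq) blast+
  then show ?case using step by simp
qed auto

lemma flow_settled: "x \<in> settled c J \<Longrightarrow> flow c x = fin_flow J c x"
proof -
  assume x: "x \<in> settled c J"
  define K where "K = (LEAST J. x \<in> settled c J)"
  have "x \<in> settled c K" unfolding K_def using x by (rule LeastI)
  moreover have "K \<le> J" unfolding K_def using x by (rule Least_le)
  ultimately have "fin_flow J c x = fin_flow K c x" by (rule fin_flow_stable)
  moreover have "flow c x = fin_flow K c x" unfolding flow_def K_def using x by auto
  ultimately show ?thesis by simp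
qed

lemma flow_jumping: "\<not> (\<exists>J. x \<in> settled c J) \<Longrightarrow> flow c x = translate c x"
  by (auto simp: flow_def)

lemma flow_Seqs [simp]: "x \<in> Seqs \<Longrightarrow> flow c x \<in> Seqs"
  by (simp add: flow_def)

text \<open>Coordinates from \<open>J\<close> on are merely translated; if neither
  \<open>c k\<close> nor \<open>c k + d k\<close> changes the offset at \<open>x k\<close>, then
  \<open>d k\<close> does not change it at the image.\<close>

lemma settled_fin_flow:
  assumes "x \<in> settled c J" "x \<in> settled (\<lambda>i. c i + d i) J"
  shows "fin_flow J c x \<in> settled d J"
proof -
  have "offset k (fin_flow J c x k + d k) = offset k (fin_flow J c x k)" if "k \<ge> J" for k
  proof -
    have e: "fin_flow J c x k = (x k + c k) mod modulus k" using that by (simp add: fin_flow_ge)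
    have "offset k (x k + (c k + d k)) = offset k (x k)" "offset k (x k + c k) = offset k (x k)"
      using assms that unfolding settled_def by blast+
    then show ?thesis unfolding e offset_mod_add offset_mod add.assoc by simp
  qed
  then show ?thesis using assms by (simp add: settled_def)
qed

lemma flow_flow:
  assumes "x \<in> settled c J" "x \<in> settled (\<lambda>i. c i + d i) J"
  shows "flow d (flow c x) = flow (\<lambda>i. c i + d i) x"
proof -
  have "x \<in> Seqs" using assms by (auto simp: settled_def)
  then show ?thesis
    using flow_settled[OF assms(1)] flow_settled[OF assms(2)] flow_settled[OF settled_fin_flow[OF assms]]
    by (simp add: fin_flow_fin_flow)
qed

lemma settled_0: "x \<in> Seqs \<Longrightarrow> x \<in> settled (\<lambda>i. 0) J"
  by (auto simp: settled_def)

lemma flow_inverse: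
  assumes x: "x \<in> Seqs"
  shows "flow (\<lambda>i. - c i) (flow c x) = x"
proof (cases "\<exists>J. x \<in> settled c J")
  case True
  then obtain J where J: "x \<in> settled c J" by blast
  have "flow (\<lambda>i. - c i) (flow c x) = flow (\<lambda>i. c i + - c i) x"
    using x settled_0[OF x] by (intro flow_flow[OF J]) simp
  also have "\<dots> = x" using flow_settled[OF settled_0[OF x], of 0] fin_flow_0[OF x, of 0] by simp
  finally show ?thesis .
next
  case False
  then have "flow c x = translate c x" by (rule flow_jumping)
  \<comment> \<open>A point is unsettled for \<open>c\<close> exactly if its translate is unsettled
    for \<open>- c\<close>, so the default branch of \<open>flow\<close> is inverted by the default
    branch.\<close>
  moreover have "\<not> (\<exists>J. translate c x \<in> settled (\<lambda>i. - c i) J)"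
  proof
    assume "\<exists>J. translate c x \<in> settled (\<lambda>i. - c i) J"
    then obtain J where J: "translate c x \<in> settled (\<lambda>i. - c i) J" by blast
    have "offset k (x k + c k) = offset k (x k)" if "k \<ge> J" for k
    proof -
      have "offset k (translate c x k + - c k) = offset k (translate c x k)" using J that by (simp add: settled_def)
      then show ?thesis unfolding translate_def offset_mod_add offset_mod by simp
    qed
    then have "x \<in> settled c J" using x by (simp add: settled_def)
    with False show False by blast
  qed
  ultimately show ?thesis using x by (simp add: flow_jumping translate_trans translate_0)
qed

lemma flow_bij: "bij_betw (flow c) Seqs Seqs"
  by (rule bij_betw_byWitness[where f' = "flow (\<lambda>i. - c i)"])
     (use flow_inverse[of _ "\<lambda>i. - c i"] in \<open>auto simp: flow_inverse\<close>)

section \<open>Dependence on initial segments of coordinates\<close>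

definition agree :: "nat \<Rightarrow> (nat \<Rightarrow> int) \<Rightarrow> (nat \<Rightarrow> int) \<Rightarrow> bool" where
  "agree K x y \<longleftrightarrow> (\<forall>i<K. x i = y i)"

lemma agree_trans: "agree K x y \<Longrightarrow> agree K (translate c x) (translate c y)"
  by (simp add: agree_def translate_def)

lemma agree_shear: "j < K \<Longrightarrow> agree K x y \<Longrightarrow> agree K (shear j x) (shear j y)"
  by (simp add: agree_def shear_def)

lemma agree_unshear: "j < K \<Longrightarrow> agree K x y \<Longrightarrow> agree K (unshear j x) (unshear j y)"
  by (simp add: agree_def unshear_def)

lemma agree_straighten: "J \<le> K \<Longrightarrow> agree K x y \<Longrightarrow> agree K (straighten J x) (straighten J y)"
  by (induction J) (auto simp: agree_shear)

lemma agree_unstraighten: "J \<le> K \<Longrightarrow> agree K x y \<Longrightarrow> agree K (unstraighten J x) (unstraighten J y)"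
  by (induction J arbitrary: x y) (auto simp: agree_unshear)

lemma agree_fin_flow: "J \<le> K \<Longrightarrow> agree K x y \<Longrightarrow> agree K (fin_flow J c x) (fin_flow J c y)"
  by (simp add: fin_flow_def agree_trans agree_straighten agree_unstraighten)

lemma agree_fin_flow_iff:
  assumes "x \<in> Seqs" "y \<in> Seqs" "J \<le> K"
  shows "agree K (fin_flow J c x) (fin_flow J c y) \<longleftrightarrow> agree K x y"
proof
  assume "agree K (fin_flow J c x) (fin_flow J c y)"
  then have "agree K (fin_flow J (\<lambda>i. - c i) (fin_flow J c x)) (fin_flow J (\<lambda>i. - c i) (fin_flow J c y))"
    by (rule agree_fin_flow[OF assms(3)])
  moreover have "fin_flow J (\<lambda>i. - c i) (fin_flow J c z) = z" if "z \<in> Seqs" for z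
    using fin_flow_fin_flow[OF that, of J "\<lambda>i. - c i" c] fin_flow_0[OF that] by simp
  ultimately show "agree K x y" using assms by simp
qed (use assms agree_fin_flow in auto)

section \<open>Norms on the cyclic factors\<close>

definition jumps :: "nat \<Rightarrow> int \<Rightarrow> int set" where
  "jumps j c = {y \<in> {0..<modulus j}. offset j (y + c) \<noteq> offset j y}"

text \<open>The first summand controls the action; the second one only separates points.\<close>

definition coord_norm :: "nat \<Rightarrow> int \<Rightarrow> real" where
  "coord_norm j c = card (jumps j c) / modulus j + (if c mod modulus j = 0 then 0 else (1/2) ^ j)"

lemma finite_int_range_Collect [simp]: "finite {y \<in> {0..<q::int}. P y}"
  by (rule finite_subset[of _ "{0..<q}"]) auto

lemma finite_jumps [simp]: "finite (jumps j c)"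
  unfolding jumps_def by (rule finite_int_range_Collect)

lemma offset_add_mod: "offset j (y + c mod modulus j) = offset j (y + c)"
  by (simp add: offset_def mod_simps)

lemma card_shift_mod:
  fixes q :: int
  assumes "q > 0"
  shows "card {y \<in> {0..<q}. P ((y + c) mod q)} = card {y \<in> {0..<q}. P y}"
proof (rule bij_betw_same_card)
  show "bij_betw (\<lambda>y. (y + c) mod q) {y \<in> {0..<q}. P ((y + c) mod q)} {y \<in> {0..<q}. P y}"
    by (rule bij_betw_byWitness[where f' = "\<lambda>y. (y - c) mod q"])
      (use assms in \<open>auto simp: mod_simps\<close>)
qed

text \<open>If the offset changes over \<open>c + d\<close>, it changes over \<open>c\<close> or
  over the subsequent \<open>d\<close>; rotating the residues does not affect the count for the
  latter.\<close>

lemma card_jumps_add: "card (jumps j (c + d)) \<le> card (jumps j c) + card (jumps j d)"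
proof -
  let ?S = "{y \<in> {0..<modulus j}. offset j ((y + c) mod modulus j + d) \<noteq> offset j ((y + c) mod modulus j)}"
  have "jumps j (c + d) \<subseteq> jumps j c \<union> ?S"
    unfolding jumps_def offset_mod_add offset_mod by (auto simp: add.assoc)
  then have "card (jumps j (c + d)) \<le> card (jumps j c \<union> ?S)"
    by (intro card_mono finite_UnI finite_jumps finite_int_range_Collect)
  also have "\<dots> \<le> card (jumps j c) + card ?S" by (rule card_Un_le)
  also have "card ?S = card (jumps j d)"
    unfolding jumps_def by (rule card_shift_mod) simp
  finally show ?thesis .
qed

lemma card_jumps_minus: "card (jumps j (- c)) = card (jumps j c)"
proof -
  have "card (jumps j (- c)) =
      card {y \<in> {0..<modulus j}. offset j ((y + c) mod modulus j + - c) \<noteq> offset j ((y + c) mod modulus j)}"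
    unfolding jumps_def by (rule card_shift_mod[symmetric]) simp
  also have "\<dots> = card (jumps j c)"
    unfolding jumps_def offset_mod_add offset_mod by (intro arg_cong[where f = card]) auto
  finally show ?thesis .
qed

lemma coord_norm_nonneg: "coord_norm j c \<ge> 0"
  by (simp add: coord_norm_def)

lemma coord_norm_0 [simp]: "coord_norm j 0 = 0"
  by (simp add: coord_norm_def jumps_def)

lemma coord_norm_mod: "coord_norm j (c mod modulus j) = coord_norm j c"
  by (simp add: coord_norm_def jumps_def offset_add_mod)

lemma coord_norm_cong: "c mod modulus j = d mod modulus j \<Longrightarrow> coord_norm j c = coord_norm j d"
  by (metis coord_norm_mod)

lemma coord_norm_ge: "c mod modulus j \<noteq> 0 \<Longrightarrow> (1/2) ^ j \<le> coord_norm j c"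
  by (simp add: coord_norm_def)

lemma card_jumps_le_coord_norm: "card (jumps j c) / modulus j \<le> coord_norm j c"
  by (simp add: coord_norm_def)

lemma coord_norm_add: "coord_norm j (c + d) \<le> coord_norm j c + coord_norm j d"
proof -
  have "real (card (jumps j (c + d))) / modulus j \<le> card (jumps j c) / modulus j + card (jumps j d) / modulus j"
    unfolding add_divide_distrib[symmetric]
    using card_jumps_add[of j c d] by (intro divide_right_mono) auto
  moreover have "(c + d) mod modulus j = 0" if "c mod modulus j = 0" "d mod modulus j = 0"
    using that by (metis add_0 mod_0 mod_add_eq)
  moreover have "(0::real) \<le> (1/2) ^ j" by simp
  ultimately show ?thesis unfolding coord_norm_def by (smt (verit))
qed

lemma coord_norm_minus: "coord_norm j (- c) = coord_norm j c"
proof -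
  have "(- c) mod modulus j = 0 \<longleftrightarrow> c mod modulus j = 0"
    by (simp add: mod_eq_0_iff_dvd)
  then show ?thesis by (simp add: coord_norm_def card_jumps_minus)
qed

lemma div_add1_dvd:
  fixes m y :: int
  assumes "m > 0" "(y + 1) div m \<noteq> y div m"
  shows "m dvd y + 1"
proof (rule ccontr)
  assume "\<not> m dvd y + 1"
  then have r: "0 < (y + 1) mod m" using assms(1) by (smt (verit) dvd_eq_mod_eq_0 pos_mod_sign)
  have "y = m * ((y + 1) div m) + ((y + 1) mod m - 1)" by (simp add: algebra_simps)
  moreover have "(y + 1) mod m < m" using assms(1) by simp
  ultimately have "y div m = (y + 1) div m"
    using r by (intro int_div_pos_eq[where r = "(y + 1) mod m - 1"]) linarith+
  with assms(2) show False by simp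
qed

text \<open>The residues form \<open>block j\<close> full blocks and a last block with a single
  point. Under a unit step the offset can change only at the end of a full block or at the
  wrap-around.\<close>

lemma card_jumps_1: "card (jumps j 1) \<le> block j + 1"
proof -
  let ?m = "block j"
  have m: "?m > 0" by (rule block_pos)
  have "jumps j 1 \<subseteq> (\<lambda>k. k * ?m - 1) ` {1..?m} \<union> {modulus j - 1}"
  proof
    fix y assume y: "y \<in> jumps j 1"
    show "y \<in> (\<lambda>k. k * ?m - 1) ` {1..?m} \<union> {modulus j - 1}"
    proof (cases "y = modulus j - 1")
      case False
      with y have y': "0 \<le> y" "y + 1 < modulus j" by (auto simp: jumps_def)
      then have "(y + 1) div ?m \<noteq> y div ?m"
        using y by (auto simp: jumps_def offset_def)
      then have "?m dvd y + 1"
        using m by (meson div_add1_dvd)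
      then obtain k where k: "y + 1 = k * ?m" by (metis dvdE mult.commute)
      have "k \<ge> 1" using k y' m by (smt (verit) mult_nonpos_nonneg)
      moreover have "k \<le> ?m"
      proof (rule ccontr)
        assume "\<not> k \<le> ?m"
        then have "(?m + 1) * ?m \<le> k * ?m" using m by (intro mult_right_mono) auto
        then show False using k y' m by (simp add: modulus_def power2_eq_square algebra_simps)
      qed
      moreover have "y = k * ?m - 1" using k by simp
      ultimately show ?thesis by auto
    qed simp
  qed
  then have "card (jumps j 1) \<le> card ((\<lambda>k. k * ?m - 1) ` {1..?m} \<union> {modulus j - 1})"
    by (intro card_mono) auto
  also have "\<dots> \<le> card ((\<lambda>k. k * ?m - 1) ` {1..?m}) + card {modulus j - 1}" by (rule card_Un_le)
  also have "\<dots> \<le> card {1..?m} + 1"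
    using card_image_le[of "{1..?m}" "\<lambda>k. k * ?m - 1"] by simp
  finally show ?thesis using m by simp
qed

lemma card_jumps_nat: "card (jumps j (int n)) \<le> n * card (jumps j 1)"
proof (induction n)
  case (Suc n)
  have "card (jumps j (int (Suc n))) \<le> card (jumps j (int n)) + card (jumps j 1)"
    using card_jumps_add[of j "int n" 1] by (simp add: add.commute)
  with Suc show ?case by simp
qed (simp add: jumps_def)

text \<open>A unit step changes the offset at no more than \<open>block j + 1\<close> of the
  \<open>modulus j\<close> points, a fraction of at most \<open>2 / block j\<close>; subadditivity
  makes this linear in \<open>t\<close>.\<close>

lemma coord_norm_le:
  assumes "0 \<le> t"
  shows "coord_norm j t \<le> 2 * t / block j + (1/2) ^ j"
proof -
  obtain n where n: "t = int n" using assms nonneg_int_cases by blast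
  define m where "m = real_of_int (block j)"
  have m: "m > 0" "real_of_int (modulus j) = m\<^sup>2 + 1" by (simp_all add: m_def block_pos modulus_def)
  have "m \<ge> 1" using block_pos[of j] by (simp add: m_def)
  have "real (card (jumps j 1)) \<le> m + 1"
    unfolding m_def using card_jumps_1[of j] by linarith
  also have "\<dots> \<le> 2 * (m\<^sup>2 + 1) / m"
  proof -
    have "1 * m \<le> m * m" using \<open>m \<ge> 1\<close> by (intro mult_right_mono) auto
    then have "m \<le> m * m + 2" by linarith
    then show ?thesis using \<open>m \<ge> 1\<close> by (simp add: field_simps power2_eq_square)
  qed
  finally have "real (card (jumps j 1)) \<le> 2 * (m\<^sup>2 + 1) / m" .
  then have "real n * card (jumps j 1) \<le> real n * (2 * (m\<^sup>2 + 1) / m)"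
    by (intro mult_left_mono) auto
  moreover have "real (card (jumps j t)) \<le> real n * card (jumps j 1)"
    unfolding n of_nat_mult[symmetric] of_nat_le_iff by (rule card_jumps_nat)
  ultimately have "card (jumps j t) / modulus j \<le> (real n * (2 * (m\<^sup>2 + 1) / m)) / (m\<^sup>2 + 1)"
    unfolding m by (intro divide_right_mono) auto
  also have "\<dots> = 2 * t / m"
    using m n by (simp add: field_simps add_pos_nonneg add_nonneg_eq_0_iff)
  finally have "card (jumps j t) / modulus j \<le> 2 * t / block j" by (simp add: m_def)
  moreover have "(if t mod modulus j = 0 then 0 else (1/2) ^ j) \<le> (1/2 :: real) ^ j" by simp
  ultimately show ?thesis unfolding coord_norm_def by (intro add_mono) auto
qed

text \<open>The points exhibited are the last \<open>t\<close> ones of blocks whose index is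
  congruent to \<open>n\<close> modulo \<open>height j\<close>: since
  \<open>t \<le> block j\<close>, the shift carries them just into the next block, and by
  \<open>triangular_Suc\<close> the jump equals the block index.\<close>

lemma card_uniform_jumps:
  assumes t: "0 \<le> t" "t \<le> block j"
  shows "t * (2 ^ j - 1) \<le> card {y \<in> {0..<modulus j}. (offset j (y + t) - offset j y) mod height j = n mod height j}"
proof -
  let ?m = "block j" and ?h = "height j"
  define r where "r = n mod ?h"
  have m: "?m > 0" and h: "?h > 0" by (rule block_pos height_pos)+
  have r: "0 \<le> r" "r < ?h" using h by (auto simp: r_def)
  \<comment> \<open>\<open>k\<close> counts runs of \<open>height j\<close> consecutive block
    indices. Of the \<open>2 ^ j\<close> runs the last is dropped, so that the following block is
    again a full one and nothing wraps around.\<close>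
  define f where "f = (\<lambda>(k, s). (r + k * ?h) * ?m + (?m - t + s))"
  let ?D = "{0..<2 ^ j - 1 :: int} \<times> {0..<t}"
  let ?S = "{y \<in> {0..<modulus j}. (offset j (y + t) - offset j y) mod ?h = n mod ?h}"
  have div: "f (k, s) div ?m = r + k * ?h" if "(k, s) \<in> ?D" for k s
    using that t m by (auto simp: f_def div_pos_pos_trivial)
  have "inj_on f ?D"
  proof (rule inj_onI)
    fix a b assume a: "a \<in> ?D" and b: "b \<in> ?D" and e: "f a = f b"
    obtain k s k' s' where ab: "a = (k, s)" "b = (k', s')" by (cases a, cases b)
    have "r + k * ?h = r + k' * ?h"
      using div[of k s] div[of k' s'] a b e unfolding ab by metis
    then have "k = k'" using h by auto
    with e show "a = b" by (simp add: ab f_def)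
  qed
  moreover have "f ` ?D \<subseteq> ?S"
  proof (rule image_subsetI)
    fix p assume "p \<in> ?D"
    then obtain k s where p: "p = (k, s)" and k: "k \<in> {0..<2 ^ j - 1 :: int}" and s: "s \<in> {0..<t}"
      by blast
    let ?i = "r + k * ?h"
    have "k * ?h \<le> (2 ^ j - 2) * ?h" using k h by (intro mult_right_mono) auto
    then have i: "0 \<le> ?i" "?i + 2 \<le> ?m"
      using r k h by (auto simp: block_def algebra_simps)
    have "(?i + 2) * ?m \<le> ?m * ?m" using i m by (intro mult_right_mono) auto
    then have lt: "f (k, s) + t < modulus j" using s t
      by (simp add: f_def modulus_def power2_eq_square algebra_simps)
    have ge: "0 \<le> f (k, s)" using i m t s by (simp add: f_def)
    have e: "f (k, s) + t = (?i + 1) * ?m + s" by (simp add: f_def algebra_simps)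
    have "(f (k, s) + t) div ?m = ?i + 1"
      unfolding e using s t m by (simp add: div_pos_pos_trivial)
    moreover have "f (k, s) div ?m = ?i" using k s by (intro div) auto
    ultimately have "offset j (f (k, s) + t) - offset j (f (k, s)) = ?i"
      using lt ge t triangular_Suc[of ?i] by (simp add: offset_def)
    then show "f p \<in> ?S" unfolding p using lt ge t by (simp add: r_def)
  qed
  ultimately have "card ?D \<le> card ?S"
    by (intro card_inj_on_le[of f] finite_int_range_Collect)
  moreover have "int (card ?D) = t * (2 ^ j - 1)"
    using t by (simp add: card_cartesian_product)
  ultimately show ?thesis by linarith
qed

section \<open>The l1 norm of an integer sequence\<close>

definition l1_norm :: "(nat \<Rightarrow> int) \<Rightarrow> real" where
  "l1_norm c = (\<Sum>i. coord_norm i (c i))"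

definition l1_finite :: "(nat \<Rightarrow> int) \<Rightarrow> bool" where
  "l1_finite c \<longleftrightarrow> summable (\<lambda>i. coord_norm i (c i))"

lemma l1_finite_add: "l1_finite c \<Longrightarrow> l1_finite d \<Longrightarrow> l1_finite (\<lambda>i. c i + d i)"
  unfolding l1_finite_def
  by (rule summable_comparison_test'[where g = "\<lambda>i. coord_norm i (c i) + coord_norm i (d i)"])
    (auto intro: summable_add simp: coord_norm_nonneg coord_norm_add)

lemma l1_finite_minus: "l1_finite (\<lambda>i. - c i) \<longleftrightarrow> l1_finite c"
  by (simp add: l1_finite_def coord_norm_minus)

lemma l1_finite_diff: "l1_finite c \<Longrightarrow> l1_finite d \<Longrightarrow> l1_finite (\<lambda>i. c i - d i)"
  using l1_finite_add[of c "\<lambda>i. - d i"] by (simp add: l1_finite_minus)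

lemma l1_finite_0 [simp]: "l1_finite (\<lambda>i. 0)"
  by (simp add: l1_finite_def)

lemma l1_finite_cong: "(\<And>i. c i mod modulus i = d i mod modulus i) \<Longrightarrow> l1_finite c = l1_finite d"
  unfolding l1_finite_def by (intro arg_cong[where f = summable] ext coord_norm_cong)

lemma l1_norm_cong: "(\<And>i. c i mod modulus i = d i mod modulus i) \<Longrightarrow> l1_norm c = l1_norm d"
  unfolding l1_norm_def by (intro arg_cong[where f = suminf] ext coord_norm_cong)

lemma l1_norm_nonneg: "l1_finite c \<Longrightarrow> 0 \<le> l1_norm c"
  by (simp add: l1_norm_def l1_finite_def suminf_nonneg coord_norm_nonneg)

lemma l1_norm_0 [simp]: "l1_norm (\<lambda>i. 0) = 0"
  by (simp add: l1_norm_def)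

lemma l1_norm_minus: "l1_norm (\<lambda>i. - c i) = l1_norm c"
  by (simp add: l1_norm_def coord_norm_minus)

lemma l1_norm_add:
  assumes "l1_finite c" "l1_finite d"
  shows "l1_norm (\<lambda>i. c i + d i) \<le> l1_norm c + l1_norm d"
proof -
  have "l1_norm (\<lambda>i. c i + d i) \<le> (\<Sum>i. coord_norm i (c i) + coord_norm i (d i))"
    unfolding l1_norm_def using assms l1_finite_add[OF assms]
    by (intro suminf_le summable_add coord_norm_add) (auto simp: l1_finite_def)
  also have "\<dots> = l1_norm c + l1_norm d"
    unfolding l1_norm_def using assms by (intro suminf_add[symmetric]) (auto simp: l1_finite_def)
  finally show ?thesis .
qed

lemma coord_norm_le_l1_norm: "l1_finite c \<Longrightarrow> coord_norm i (c i) \<le> l1_norm c"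
  unfolding l1_norm_def l1_finite_def
  using sum_le_suminf[of "\<lambda>i. coord_norm i (c i)" "{i}"] by (simp add: coord_norm_nonneg)

text \<open>Single coordinates are discrete because of the summand \<open>(1/2) ^ j\<close> in
  \<open>coord_norm\<close>. Completeness, the open subgroup of index 2 and the continuity of the
  action all rest on this.\<close>

lemma l1_norm_small:
  assumes "l1_finite c" "l1_norm c < (1/2) ^ i" "k \<le> i"
  shows "c k mod modulus k = 0"
proof (rule ccontr)
  assume "c k mod modulus k \<noteq> 0"
  then have "(1/2) ^ k \<le> l1_norm c" using coord_norm_le_l1_norm[OF assms(1), of k] by (meson coord_norm_ge order_trans)
  moreover have "(1/2::real) ^ i \<le> (1/2) ^ k" using assms(3) by (intro power_decreasing) auto
  ultimately show False using assms(2) by simp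
qed

lemma l1_norm_eq_0: "l1_finite c \<Longrightarrow> l1_norm c = 0 \<longleftrightarrow> (\<forall>i. c i mod modulus i = 0)"
proof
  assume c: "l1_finite c" "l1_norm c = 0"
  show "\<forall>i. c i mod modulus i = 0"
  proof
    show "c i mod modulus i = 0" for i
      by (rule l1_norm_small[OF c(1) _ order_refl]) (simp add: c(2))
  qed
next
  assume "\<forall>i. c i mod modulus i = 0"
  then show "l1_norm c = 0" using l1_norm_cong[of c "\<lambda>i. 0"] by simp
qed

section \<open>The Polish group\<close>

lemma not_levy_group_if_open_index_2:
  assumes H: "subgroup H G" "openin T H" "H \<noteq> carrier G"
    and index: "\<And>x y. x \<in> carrier G - H \<Longrightarrow> y \<in> carrier G - H \<Longrightarrow> inv\<^bsub>G\<^esub> x \<otimes>\<^bsub>G\<^esub> y \<in> H"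
  shows "\<not> levy_group G T"
proof
  assume "levy_group G T"
  then obtain K m d where pg: "polish_group G T"
    and K: "\<And>n. subgroup (K n) G" "\<And>n. K n \<subseteq> K (Suc n)"
    and dense: "T closure_of (\<Union>n. K n) = topspace T"
    and haar: "\<And>n. normalized_haar G T (K n) (m n)"
    and d: "right_invariant_compatible_metric G T d"
    and levy: "levy_family K (\<lambda>_. d) m"
    unfolding levy_group_def by blast
  interpret G: group G using pg by (simp add: polish_group_def topological_group_def)
  have top: "topspace T = carrier G" using pg by (simp add: polish_group_def topological_group_def)
  interpret Metric_space "carrier G" d using d by (simp add: right_invariant_compatible_metric_def)
  have mt: "mtopology = T" using d by (simp add: right_invariant_compatible_metric_def)
  have HG: "H \<subseteq> carrier G" using H(1) by (rule subgroup.subset)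
  have one: "\<one>\<^bsub>G\<^esub> \<in> H" using H(1) by (rule subgroup.one_closed)
  have "openin mtopology H" using H(2) by (simp only: mt)
  then obtain \<epsilon> where \<epsilon>: "\<epsilon> > 0" "mball \<one>\<^bsub>G\<^esub> \<epsilon> \<subseteq> H"
    unfolding openin_mtopology using one by blast
  \<comment> \<open>An open subgroup is also closed, so a dense union contained in \<open>H\<close>
    would give \<open>H = carrier G\<close>.\<close>
  have "\<exists>n. K n - H \<noteq> {}"
  proof (rule ccontr)
    assume "\<not> (\<exists>n. K n - H \<noteq> {})"
    then have U: "(\<Union>n. K n) \<subseteq> H" by blast
    obtain g where g: "g \<in> carrier G" "g \<notin> H" using H(3) HG by blast
    have "g \<in> mtopology closure_of (\<Union>n. K n)" using g(1) dense top mt by simp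
    then obtain y where y: "y \<in> (\<Union>n. K n)" "y \<in> mball g \<epsilon>"
      unfolding metric_closure_of using \<epsilon>(1) by blast
    have yH: "y \<in> H" "y \<in> carrier G" using y U by auto
    have "d (y \<otimes>\<^bsub>G\<^esub> inv\<^bsub>G\<^esub> y) (g \<otimes>\<^bsub>G\<^esub> inv\<^bsub>G\<^esub> y) = d y g"
      using d g yH unfolding right_invariant_compatible_metric_def by blast
    then have "g \<otimes>\<^bsub>G\<^esub> inv\<^bsub>G\<^esub> y \<in> mball \<one>\<^bsub>G\<^esub> \<epsilon>"
      using y g yH by (simp add: commute)
    then have "g \<otimes>\<^bsub>G\<^esub> inv\<^bsub>G\<^esub> y \<in> H" using \<epsilon> by blast
    then have "(g \<otimes>\<^bsub>G\<^esub> inv\<^bsub>G\<^esub> y) \<otimes>\<^bsub>G\<^esub> y \<in> H"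
      using yH(1) by (rule subgroup.m_closed[OF H(1)])
    then show False using g yH by (simp add: G.m_assoc)
  qed
  then obtain n0 where n0: "K n0 - H \<noteq> {}" by blast
  have openKH: "K n \<inter> H \<in> sets (m n)" for n
  proof -
    have "openin (subtopology T (K n)) (K n \<inter> H)"
      using H(2) by (metis inf_commute openin_subtopology_Int)
    then show ?thesis
      using haar[of n] unfolding normalized_haar_def borel_sets_of_def by auto
  qed
  have half: "measure (m n) (K n \<inter> H) = 1/2" "emeasure (m n) (K n \<inter> H) = ennreal (1/2)" if n: "n \<ge> n0" for n
  proof -
    interpret prob_space "m n" using haar[of n] by (simp add: normalized_haar_def)
    have sp: "space (m n) = K n" using haar[of n] by (simp add: normalized_haar_def)
    have "K n0 \<subseteq> K n" using n K(2) by (rule lift_Suc_mono_le[rotated])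
    then obtain k where k: "k \<in> K n" "k \<notin> H" using n0 by blast
    have KG: "K n \<subseteq> carrier G" using K(1) by (rule subgroup.subset)
    \<comment> \<open>Left translation by \<open>k\<close> exchanges the two cosets of
      \<open>H\<close> within \<open>K n\<close>; invariance then forces measure 1/2 on
      each.\<close>
    have eq: "k <#\<^bsub>G\<^esub> (K n \<inter> H) = K n - H"
    proof (intro equalityI subsetI)
      fix z assume "z \<in> k <#\<^bsub>G\<^esub> (K n \<inter> H)"
      then obtain h where h: "h \<in> K n" "h \<in> H" "z = k \<otimes>\<^bsub>G\<^esub> h" unfolding l_coset_def by blast
      have "z \<notin> H"
      proof
        assume "z \<in> H"
        then have "z \<otimes>\<^bsub>G\<^esub> inv\<^bsub>G\<^esub> h \<in> H"
          using h subgroup.m_closed[OF H(1)] subgroup.m_inv_closed[OF H(1)] by blast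
        then show False using h k KG by (simp add: G.m_assoc subset_iff)
      qed
      then show "z \<in> K n - H" using h k subgroup.m_closed[OF K(1)] by blast
    next
      fix z assume z: "z \<in> K n - H"
      let ?h = "inv\<^bsub>G\<^esub> k \<otimes>\<^bsub>G\<^esub> z"
      have "?h \<in> K n" using z k subgroup.m_closed[OF K(1)] subgroup.m_inv_closed[OF K(1)] by blast
      moreover have "?h \<in> H" using z k KG by (intro index) auto
      moreover have "z = k \<otimes>\<^bsub>G\<^esub> ?h"
      proof -
        have "k \<in> carrier G" "z \<in> carrier G" using z k KG by auto
        then show ?thesis by (simp add: G.m_assoc[symmetric])
      qed
      ultimately show "z \<in> k <#\<^bsub>G\<^esub> (K n \<inter> H)" unfolding l_coset_def by blast
    qed
    have "emeasure (m n) (K n - H) = emeasure (m n) (K n \<inter> H)"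
      using haar[of n] k(1) openKH[of n] unfolding normalized_haar_def eq[symmetric] by blast
    then have "prob (K n - H) = prob (K n \<inter> H)" by (simp add: measure_def)
    moreover have "prob (K n - (K n \<inter> H)) = 1 - prob (K n \<inter> H)"
      using prob_compl[OF openKH[of n]] unfolding sp .
    moreover have "K n - (K n \<inter> H) = K n - H" by blast
    ultimately have "prob (K n \<inter> H) = 1/2" by simp
    then show "prob (K n \<inter> H) = 1/2" "emeasure (m n) (K n \<inter> H) = ennreal (1/2)"
      unfolding emeasure_eq_measure by (simp, simp only:)
  qed
  have "liminf (\<lambda>n. emeasure (m n) (K n \<inter> H)) = liminf (\<lambda>n. ennreal (1/2))"
    by (rule Liminf_eq, rule eventually_sequentiallyI[of n0]) (use half in blast)
  also have "\<dots> = ennreal (1/2)" by (intro Liminf_const) simp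
  finally have "liminf (\<lambda>n. emeasure (m n) (K n \<inter> H)) = ennreal (1/2)" .
  moreover have "ennreal (1/2) > 0" by (subst ennreal_less_zero_iff) simp
  ultimately have "liminf (\<lambda>n. emeasure (m n) (K n \<inter> H)) > 0" by (simp only:)
  then have lim: "(\<lambda>n. measure (m n) (set_nbhd (K n) d (K n \<inter> H) \<epsilon>)) \<longlonglongrightarrow> 1"
    using levy[unfolded levy_family_def, THEN conjunct2, rule_format, of "\<lambda>n. K n \<inter> H" \<epsilon>]
      openKH \<epsilon>(1) by simp
  have "measure (m n) (set_nbhd (K n) d (K n \<inter> H) \<epsilon>) = 1/2" if n: "n \<ge> n0" for n
  proof -
    have KG: "K n \<subseteq> carrier G" using K(1) by (rule subgroup.subset)
    \<comment> \<open>By right invariance, two points at distance below \<open>\<epsilon>\<close>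
      differ by an element of the ball around the identity, hence by an element of
      \<open>H\<close>.\<close>
    have "set_nbhd (K n) d (K n \<inter> H) \<epsilon> = K n \<inter> H"
    proof (intro equalityI subsetI)
      fix x assume "x \<in> set_nbhd (K n) d (K n \<inter> H) \<epsilon>"
      then obtain a where a: "x \<in> K n" "a \<in> K n" "a \<in> H" "d a x < \<epsilon>" unfolding set_nbhd_def by blast
      have c: "x \<in> carrier G" "a \<in> carrier G" using a KG by auto
      have "d (a \<otimes>\<^bsub>G\<^esub> inv\<^bsub>G\<^esub> a) (x \<otimes>\<^bsub>G\<^esub> inv\<^bsub>G\<^esub> a) = d a x"
        using d c unfolding right_invariant_compatible_metric_def by blast
      then have "x \<otimes>\<^bsub>G\<^esub> inv\<^bsub>G\<^esub> a \<in> mball \<one>\<^bsub>G\<^esub> \<epsilon>" using a c by simp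
      then have "(x \<otimes>\<^bsub>G\<^esub> inv\<^bsub>G\<^esub> a) \<otimes>\<^bsub>G\<^esub> a \<in> H"
        using \<epsilon>(2) a(3) subgroup.m_closed[OF H(1)] by blast
      then show "x \<in> K n \<inter> H" using a c by (simp add: G.m_assoc)
    next
      fix x assume x: "x \<in> K n \<inter> H"
      then show "x \<in> set_nbhd (K n) d (K n \<inter> H) \<epsilon>"
        unfolding set_nbhd_def using \<epsilon>(1) KG by (auto intro!: bexI[of _ x])
    qed
    then show ?thesis using half[OF n] by simp
  qed
  then have "(\<lambda>n. measure (m n) (set_nbhd (K n) d (K n \<inter> H) \<epsilon>)) \<longlonglongrightarrow> 1/2"
    by (intro tendsto_eventually eventually_sequentiallyI[of n0])
  with lim have "(1::real) = 1/2" by (rule LIMSEQ_unique)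
  then show False by simp
qed

text \<open>The group has to live on \<open>nat \<Rightarrow> real\<close>; integer sequences are
  embedded there, and \<open>floor_seq\<close> undoes the embedding.\<close>

definition real_seq :: "(nat \<Rightarrow> int) \<Rightarrow> nat \<Rightarrow> real" where
  "real_seq c = (\<lambda>i. real_of_int (c i))"

definition floor_seq :: "(nat \<Rightarrow> real) \<Rightarrow> nat \<Rightarrow> int" where
  "floor_seq x = (\<lambda>i. \<lfloor>x i\<rfloor>)"

lemma floor_seq_real_seq [simp]: "floor_seq (real_seq c) = c"
  by (simp add: floor_seq_def real_seq_def)

definition l1_carrier :: "(nat \<Rightarrow> real) set" where
  "l1_carrier = real_seq ` {c \<in> Seqs. l1_finite c}"

definition l1_group :: "(nat \<Rightarrow> real) monoid" where
  "l1_group = \<lparr>carrier = l1_carrier, mult = (\<lambda>x y. real_seq (translate (floor_seq y) (floor_seq x))), one = real_seq (\<lambda>i. 0)\<rparr>"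

text \<open>The absolute value matters only outside the carrier, where the series need not converge.\<close>

definition l1_dist :: "(nat \<Rightarrow> real) \<Rightarrow> (nat \<Rightarrow> real) \<Rightarrow> real" where
  "l1_dist x y = \<bar>l1_norm (\<lambda>i. floor_seq x i - floor_seq y i)\<bar>"

definition l1_topology :: "(nat \<Rightarrow> real) topology" where
  "l1_topology = Metric_space.mtopology l1_carrier l1_dist"

lemma l1_group_simps [simp]: "carrier l1_group = l1_carrier" "x \<otimes>\<^bsub>l1_group\<^esub> y = real_seq (translate (floor_seq y) (floor_seq x))" "\<one>\<^bsub>l1_group\<^esub> = real_seq (\<lambda>i. 0)"
  by (simp_all add: l1_group_def)

lemma l1_carrier_E:
  assumes "x \<in> l1_carrier"
  obtains c where "x = real_seq c" "c \<in> Seqs" "l1_finite c" "floor_seq x = c"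
  using assms by (auto simp: l1_carrier_def)

lemma real_seq_in_l1_carrier [simp]: "real_seq c \<in> l1_carrier \<longleftrightarrow> c \<in> Seqs \<and> l1_finite c"
  by (metis (mono_tags, lifting) l1_carrier_def floor_seq_real_seq image_iff mem_Collect_eq)

lemma zero_Seqs [simp]: "(\<lambda>i. 0) \<in> Seqs"
  by (simp add: Seqs_def)

lemma l1_finite_trans: "l1_finite (translate c x) \<longleftrightarrow> l1_finite (\<lambda>i. x i + c i)"
  by (rule l1_finite_cong) (simp add: translate_def)

lemma group_l1_group: "group l1_group"
proof (rule groupI)
  fix x y assume "x \<in> carrier l1_group" "y \<in> carrier l1_group"
  then show "x \<otimes>\<^bsub>l1_group\<^esub> y \<in> carrier l1_group"
    by (auto elim!: l1_carrier_E simp: l1_finite_trans l1_finite_add)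
next
  fix x y z assume "x \<in> carrier l1_group" "y \<in> carrier l1_group" "z \<in> carrier l1_group"
  then show "x \<otimes>\<^bsub>l1_group\<^esub> y \<otimes>\<^bsub>l1_group\<^esub> z = x \<otimes>\<^bsub>l1_group\<^esub> (y \<otimes>\<^bsub>l1_group\<^esub> z)"
    by (auto elim!: l1_carrier_E simp: translate_def mod_simps add.assoc)
next
  fix x assume "x \<in> carrier l1_group"
  then obtain c where c: "x = real_seq c" "c \<in> Seqs" "l1_finite c" "floor_seq x = c" by (auto elim!: l1_carrier_E)
  show "\<one>\<^bsub>l1_group\<^esub> \<otimes>\<^bsub>l1_group\<^esub> x = x" using c by (simp add: translate_def SeqsD)
  have "real_seq (translate (\<lambda>i. - c i) (\<lambda>i. 0)) \<in> carrier l1_group"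
    using c by (simp add: l1_finite_trans l1_finite_minus)
  moreover have "real_seq (translate (\<lambda>i. - c i) (\<lambda>i. 0)) \<otimes>\<^bsub>l1_group\<^esub> x = \<one>\<^bsub>l1_group\<^esub>"
    using c by (simp add: translate_trans) (simp add: translate_def)
  ultimately show "\<exists>y\<in>carrier l1_group. y \<otimes>\<^bsub>l1_group\<^esub> x = \<one>\<^bsub>l1_group\<^esub>" by blast
qed simp

interpretation l1_group: group l1_group by (rule group_l1_group)

lemma inv_l1_group:
  assumes "x \<in> l1_carrier"
  shows "inv\<^bsub>l1_group\<^esub> x = real_seq (translate (\<lambda>i. - floor_seq x i) (\<lambda>i. 0))"
proof (rule l1_group.inv_equality)
  obtain c where c: "x = real_seq c" "c \<in> Seqs" "l1_finite c" "floor_seq x = c" using assms by (rule l1_carrier_E)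
  then show "real_seq (translate (\<lambda>i. - floor_seq x i) (\<lambda>i. 0)) \<otimes>\<^bsub>l1_group\<^esub> x = \<one>\<^bsub>l1_group\<^esub>"
    by (simp add: translate_trans) (simp add: translate_def)
  show "real_seq (translate (\<lambda>i. - floor_seq x i) (\<lambda>i. 0)) \<in> carrier l1_group"
    using c by (simp add: l1_finite_trans l1_finite_minus)
qed (use assms in simp)

lemma l1_dist_real_seq: "l1_finite c \<Longrightarrow> l1_finite d \<Longrightarrow> l1_dist (real_seq c) (real_seq d) = l1_norm (\<lambda>i. c i - d i)"
  by (simp add: l1_dist_def l1_norm_nonneg l1_finite_diff)

lemma l1_dist_trans:
  assumes "l1_finite (\<lambda>i. x i + c i)" "l1_finite (\<lambda>i. y i + d i)"
  shows "l1_dist (real_seq (translate c x)) (real_seq (translate d y)) = l1_norm (\<lambda>i. (x i + c i) - (y i + d i))"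
proof -
  have "l1_dist (real_seq (translate c x)) (real_seq (translate d y)) = l1_norm (\<lambda>i. translate c x i - translate d y i)"
    using assms by (intro l1_dist_real_seq) (simp_all add: l1_finite_trans)
  also have "\<dots> = l1_norm (\<lambda>i. (x i + c i) - (y i + d i))"
    by (rule l1_norm_cong) (simp add: translate_def mod_diff_eq)
  finally show ?thesis .
qed

interpretation l1_metric: Metric_space l1_carrier l1_dist
proof
  fix x y :: "nat \<Rightarrow> real"
  show "0 \<le> l1_dist x y" by (simp add: l1_dist_def)
  show "l1_dist x y = l1_dist y x"
    using l1_norm_minus[of "\<lambda>i. floor_seq x i - floor_seq y i"] by (simp add: l1_dist_def)
next
  fix x y assume xy: "x \<in> l1_carrier" "y \<in> l1_carrier"
  obtain c where c: "x = real_seq c" "c \<in> Seqs" "l1_finite c" "floor_seq x = c" using xy(1) by (rule l1_carrier_E)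
  obtain d where d: "y = real_seq d" "d \<in> Seqs" "l1_finite d" "floor_seq y = d" using xy(2) by (rule l1_carrier_E)
  have "l1_dist x y = 0 \<longleftrightarrow> (\<forall>i. (c i - d i) mod modulus i = 0)"
    using c d by (simp add: l1_dist_real_seq l1_norm_eq_0 l1_finite_diff)
  also have "\<dots> \<longleftrightarrow> (\<forall>i. c i mod modulus i = d i mod modulus i)"
    by (simp add: mod_eq_dvd_iff mod_eq_0_iff_dvd)
  also have "\<dots> \<longleftrightarrow> c = d" using c d by (auto simp: SeqsD)
  also have "\<dots> \<longleftrightarrow> x = y" using c d by (metis)
  finally show "(l1_dist x y = 0) = (x = y)" .
next
  fix x y z assume "x \<in> l1_carrier" "y \<in> l1_carrier" "z \<in> l1_carrier"
  then show "l1_dist x z \<le> l1_dist x y + l1_dist y z"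
    using l1_norm_add[of "\<lambda>i. floor_seq x i - floor_seq y i" "\<lambda>i. floor_seq y i - floor_seq z i"]
    by (auto elim!: l1_carrier_E simp: l1_dist_real_seq l1_finite_diff)
qed

lemma topspace_l1_topology [simp]: "topspace l1_topology = l1_carrier"
  by (simp add: l1_topology_def)

text \<open>The group is commutative, so the difference of two products is the sum of the
  differences of the factors.\<close>

lemma l1_dist_mult_le:
  assumes "x \<in> l1_carrier" "y \<in> l1_carrier" "x' \<in> l1_carrier" "y' \<in> l1_carrier"
  shows "l1_dist (x \<otimes>\<^bsub>l1_group\<^esub> y) (x' \<otimes>\<^bsub>l1_group\<^esub> y') \<le> l1_dist x x' + l1_dist y y'"
proof -
  obtain a b a' b' where e: "x = real_seq a" "y = real_seq b" "x' = real_seq a'" "y' = real_seq b'"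
    and f: "l1_finite a" "l1_finite b" "l1_finite a'" "l1_finite b'"
    using assms by (metis l1_carrier_E)
  have "l1_dist (x \<otimes>\<^bsub>l1_group\<^esub> y) (x' \<otimes>\<^bsub>l1_group\<^esub> y') = l1_norm (\<lambda>i. (a i - a' i) + (b i - b' i))"
    using f by (simp add: e l1_dist_trans l1_finite_add algebra_simps)
  also have "\<dots> \<le> l1_dist x x' + l1_dist y y'"
    using f l1_norm_add[of "\<lambda>i. a i - a' i" "\<lambda>i. b i - b' i"] by (simp add: e l1_dist_real_seq l1_finite_diff)
  finally show ?thesis .
qed

lemma l1_dist_inv:
  assumes "x \<in> l1_carrier" "y \<in> l1_carrier"
  shows "l1_dist (inv\<^bsub>l1_group\<^esub> x) (inv\<^bsub>l1_group\<^esub> y) = l1_dist x y"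
proof -
  obtain a b where e: "x = real_seq a" "y = real_seq b" and f: "l1_finite a" "l1_finite b"
    using assms by (metis l1_carrier_E)
  have "l1_dist (inv\<^bsub>l1_group\<^esub> x) (inv\<^bsub>l1_group\<^esub> y) = l1_norm (\<lambda>i. - (a i - b i))"
    using f assms by (simp add: inv_l1_group e l1_dist_trans l1_finite_minus)
  then show ?thesis using f by (simp only: l1_norm_minus e l1_dist_real_seq)
qed

lemma topological_group_l1_group: "topological_group l1_group l1_topology"
proof -
  have mult: "x \<otimes>\<^bsub>l1_group\<^esub> y \<in> l1_carrier" if "x \<in> l1_carrier" "y \<in> l1_carrier" for x y
    using l1_group.m_closed[of x y] that by simp
  have "continuous_map (prod_topology l1_topology l1_topology) l1_topology (\<lambda>(x, y). x \<otimes>\<^bsub>l1_group\<^esub> y)"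
    unfolding continuous_map_def
  proof (intro conjI allI impI)
    show "(\<lambda>(x, y). x \<otimes>\<^bsub>l1_group\<^esub> y) \<in> topspace (prod_topology l1_topology l1_topology) \<rightarrow> topspace l1_topology"
      using mult by auto
    fix U assume U: "openin l1_topology U"
    show "openin (prod_topology l1_topology l1_topology)
        {p \<in> topspace (prod_topology l1_topology l1_topology). (case p of (x, y) \<Rightarrow> x \<otimes>\<^bsub>l1_group\<^esub> y) \<in> U}"
      unfolding openin_prod_topology_alt
    proof (intro allI impI)
      fix x y assume "(x, y) \<in> {p \<in> topspace (prod_topology l1_topology l1_topology). (case p of (x, y) \<Rightarrow> x \<otimes>\<^bsub>l1_group\<^esub> y) \<in> U}"
      then have xy: "x \<in> l1_carrier" "y \<in> l1_carrier" "x \<otimes>\<^bsub>l1_group\<^esub> y \<in> U" by (auto simp del: l1_group_simps)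
      then obtain r where r: "r > 0" "l1_metric.mball (x \<otimes>\<^bsub>l1_group\<^esub> y) r \<subseteq> U"
        using U unfolding l1_topology_def l1_metric.openin_mtopology by blast
      have "x' \<otimes>\<^bsub>l1_group\<^esub> y' \<in> U" if "x' \<in> l1_metric.mball x (r/2)" "y' \<in> l1_metric.mball y (r/2)" for x' y'
      proof -
        have "l1_dist (x \<otimes>\<^bsub>l1_group\<^esub> y) (x' \<otimes>\<^bsub>l1_group\<^esub> y') < r"
          using that l1_dist_mult_le[of x y x' y'] by (simp del: l1_group_simps)
        then show ?thesis using that xy mult r(2) by (auto simp del: l1_group_simps)
      qed
      then have "l1_metric.mball x (r/2) \<times> l1_metric.mball y (r/2) \<subseteq>
          {p \<in> topspace (prod_topology l1_topology l1_topology). (case p of (x, y) \<Rightarrow> x \<otimes>\<^bsub>l1_group\<^esub> y) \<in> U}"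
        by (auto simp del: l1_group_simps)
      moreover have "openin l1_topology (l1_metric.mball x (r/2))" "openin l1_topology (l1_metric.mball y (r/2))"
        by (simp_all add: l1_topology_def)
      moreover have "x \<in> l1_metric.mball x (r/2)" "y \<in> l1_metric.mball y (r/2)" using xy r(1) by auto
      ultimately show "\<exists>V W. openin l1_topology V \<and> openin l1_topology W \<and> x \<in> V \<and> y \<in> W \<and>
          V \<times> W \<subseteq> {p \<in> topspace (prod_topology l1_topology l1_topology). (case p of (x, y) \<Rightarrow> x \<otimes>\<^bsub>l1_group\<^esub> y) \<in> U}"
        by blast
    qed
  qed
  moreover have "continuous_map l1_topology l1_topology (\<lambda>x. inv\<^bsub>l1_group\<^esub> x)"
    unfolding continuous_map_def
  proof (intro conjI allI impI)
    show "(\<lambda>x. inv\<^bsub>l1_group\<^esub> x) \<in> topspace l1_topology \<rightarrow> topspace l1_topology"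
      using l1_group.inv_closed by simp
    fix U assume U: "openin l1_topology U"
    show "openin l1_topology {x \<in> topspace l1_topology. inv\<^bsub>l1_group\<^esub> x \<in> U}"
      unfolding l1_topology_def l1_metric.openin_mtopology
    proof (intro conjI allI impI)
      fix x assume x: "x \<in> {x \<in> topspace l1_metric.mtopology. inv\<^bsub>l1_group\<^esub> x \<in> U}"
      then obtain r where r: "r > 0" "l1_metric.mball (inv\<^bsub>l1_group\<^esub> x) r \<subseteq> U"
        using U unfolding l1_topology_def l1_metric.openin_mtopology by blast
      have "l1_metric.mball x r \<subseteq> {x \<in> topspace l1_metric.mtopology. inv\<^bsub>l1_group\<^esub> x \<in> U}"
        using x r(2) l1_dist_inv l1_group.inv_closed by auto
      then show "\<exists>r>0. l1_metric.mball x r \<subseteq> {x \<in> topspace l1_metric.mtopology. inv\<^bsub>l1_group\<^esub> x \<in> U}"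
        using r(1) by blast
    qed auto
  qed
  ultimately show ?thesis using group_l1_group by (simp add: topological_group_def)
qed

lemma mcomplete_l1_carrier: "l1_metric.mcomplete"
  unfolding l1_metric.mcomplete_def
proof (intro allI impI)
  fix \<sigma> assume C: "l1_metric.MCauchy \<sigma>"
  define s where "s = (\<lambda>n. floor_seq (\<sigma> n))"
  have s: "\<sigma> n = real_seq (s n)" "s n \<in> Seqs" "l1_finite (s n)" for n
    using C unfolding l1_metric.MCauchy_def s_def by (metis l1_carrier_E rangeI subsetD)+
  have cau: "\<exists>N. \<forall>n n'. N \<le> n \<longrightarrow> N \<le> n' \<longrightarrow> l1_norm (\<lambda>i. s n i - s n' i) < e" if "e > 0" for e
    using C that unfolding l1_metric.MCauchy_def by (simp add: s l1_dist_real_seq)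
  \<comment> \<open>Coordinate \<open>i\<close> cannot change at scale \<open>(1/2) ^ i\<close>, so
    it becomes constant along a Cauchy sequence; the limit is read off coordinatewise.\<close>
  have "\<exists>N. \<forall>n\<ge>N. s n i = s N i" for i
  proof -
    obtain N where N: "\<And>n n'. N \<le> n \<Longrightarrow> N \<le> n' \<Longrightarrow> l1_norm (\<lambda>i. s n i - s n' i) < (1/2) ^ i"
      using cau[of "(1/2) ^ i"] by auto
    have "s n i = s N i" if "n \<ge> N" for n
    proof -
      have "(s n i - s N i) mod modulus i = 0"
        using N[OF that order_refl] s by (intro l1_norm_small[of "\<lambda>i. s n i - s N i"]) (auto simp: l1_finite_diff)
      then have "s n i mod modulus i = s N i mod modulus i"
        by (simp add: mod_eq_dvd_iff mod_eq_0_iff_dvd)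
      then show ?thesis using s by (simp add: SeqsD)
    qed
    then show ?thesis by blast
  qed
  then have "\<exists>N. \<forall>i. \<forall>n\<ge>N i. s n i = s (N i) i" by (intro choice allI)
  then obtain N where N: "\<And>i n. n \<ge> N i \<Longrightarrow> s n i = s (N i) i" by blast
  define c where "c = (\<lambda>i. s (N i) i)"
  have cS: "c \<in> Seqs" using s(2) by (auto simp: c_def Seqs_def)
  have key: "l1_finite (\<lambda>i. s n i - c i) \<and> l1_norm (\<lambda>i. s n i - c i) \<le> e"
    if e: "\<And>n n'. M \<le> n \<Longrightarrow> M \<le> n' \<Longrightarrow> l1_norm (\<lambda>i. s n i - s n' i) < e" and n: "n \<ge> M" for M e n
  proof -
    \<comment> \<open>A partial sum sees finitely many coordinates, on which the limit coincides
      with a late term \<open>s n'\<close>; the bound \<open>e\<close> does not depend on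
      \<open>I\<close>.\<close>
    have part: "(\<Sum>i<I. coord_norm i (s n i - c i)) \<le> e" for I
    proof -
      define n' where "n' = Max (insert M (N ` {..<I}))"
      have "N i \<le> n'" if "i < I" for i unfolding n'_def using that by (intro Max_ge) auto
      then have "c i = s n' i" if "i < I" for i unfolding c_def using that by (metis N)
      then have "(\<Sum>i<I. coord_norm i (s n i - c i)) = (\<Sum>i<I. coord_norm i (s n i - s n' i))"
        by (intro sum.cong) auto
      also have "\<dots> \<le> l1_norm (\<lambda>i. s n i - s n' i)"
        unfolding l1_norm_def using l1_finite_diff[OF s(3) s(3), of n n']
        by (intro sum_le_suminf) (auto simp: l1_finite_def coord_norm_nonneg)
      finally have *: "(\<Sum>i<I. coord_norm i (s n i - c i)) \<le> l1_norm (\<lambda>i. s n i - s n' i)" .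
      have "M \<le> n'" unfolding n'_def by (intro Max_ge) auto
      then have "l1_norm (\<lambda>i. s n i - s n' i) < e" by (rule e[OF n])
      with * show ?thesis by simp
    qed
    then have "summable (\<lambda>i. coord_norm i (s n i - c i))"
      by (intro summableI_nonneg_bounded[where x = e] coord_norm_nonneg)
    then show ?thesis using part by (auto simp: l1_finite_def l1_norm_def intro: suminf_le_const)
  qed
  have fc: "l1_finite c"
  proof -
    obtain M where "\<And>n n'. M \<le> n \<Longrightarrow> M \<le> n' \<Longrightarrow> l1_norm (\<lambda>i. s n i - s n' i) < 1"
      using cau[of 1] by auto
    then have "l1_finite (\<lambda>i. s M i - c i)" using key by blast
    from l1_finite_diff[OF s(3) this, of M] show ?thesis by simp
  qed
  have "limitin l1_metric.mtopology \<sigma> (real_seq c) sequentially"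
    unfolding l1_metric.limit_metric_sequentially
  proof (intro conjI allI impI)
    show "real_seq c \<in> l1_carrier" using cS fc by simp
    fix e :: real assume e: "e > 0"
    then obtain M where "\<And>n n'. M \<le> n \<Longrightarrow> M \<le> n' \<Longrightarrow> l1_norm (\<lambda>i. s n i - s n' i) < e/2"
      using cau[of "e/2"] by auto
    then have "l1_norm (\<lambda>i. s n i - c i) \<le> e/2" if "n \<ge> M" for n using key that by blast
    then have "\<sigma> n \<in> l1_carrier \<and> l1_dist (\<sigma> n) (real_seq c) < e" if "n \<ge> M" for n
      using that e s fc by (fastforce simp: l1_dist_real_seq)
    then show "\<exists>M. \<forall>n\<ge>M. \<sigma> n \<in> l1_carrier \<and> l1_dist (\<sigma> n) (real_seq c) < e" by blast
  qed
  then show "\<exists>x. limitin l1_metric.mtopology \<sigma> x sequentially" by blast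
qed

section \<open>Density of the cyclic subgroup\<close>

lemma coord_norm_le_geometric:
  assumes "0 \<le> n" "n \<le> height i"
  shows "coord_norm i n \<le> 3 * (1/2) ^ i"
proof -
  have "2 * real_of_int n / block i \<le> 2 * real_of_int (height i) / block i"
    using assms block_pos[of i] by (intro divide_right_mono) auto
  also have "\<dots> = 2 * (1/2) ^ i"
    using height_pos[of i] by (simp add: block_def field_simps)
  finally show ?thesis using coord_norm_le[OF assms(1), of i] by simp
qed

lemma height_mono: "i \<le> j \<Longrightarrow> height i \<le> height j"
proof (induction rule: dec_induct)
  case (step n)
  have "height n * 1 \<le> height n * modulus n"
    using height_pos[of n] modulus_ge2[of n] by (intro mult_left_mono) auto
  with step show ?case by (simp add: height_Suc)
qed simp

definition gen_power :: "nat \<Rightarrow> nat \<Rightarrow> real" where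
  "gen_power n = real_seq (translate (\<lambda>i. int n) (\<lambda>i. 0))"

lemma l1_finite_const: "l1_finite (\<lambda>i. int n)"
proof -
  have "l1_finite (\<lambda>i. 1)" unfolding l1_finite_def
  proof (rule summable_comparison_test')
    show "summable (\<lambda>i. 3 * (1/2::real) ^ i)" by (intro summable_mult summable_geometric) auto
    show "norm (coord_norm i 1) \<le> 3 * (1/2) ^ i" for i
      using coord_norm_le_geometric[of 1 i] height_pos[of i] by (simp add: coord_norm_nonneg)
  qed
  then show ?thesis
    by (induction n) (auto dest: l1_finite_add)
qed

lemma gen_power_l1_carrier [simp]: "gen_power n \<in> l1_carrier"
  by (simp add: gen_power_def l1_finite_trans l1_finite_const)

lemma gen_power_generate: "gen_power n \<in> generate l1_group {gen_power 1}"
proof (induction n)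
  case 0
  have "gen_power 0 = \<one>\<^bsub>l1_group\<^esub>" by (simp add: gen_power_def translate_def)
  then show ?case by (simp only: generate.one)
next
  case (Suc n)
  have "gen_power (Suc n) = gen_power n \<otimes>\<^bsub>l1_group\<^esub> gen_power 1"
    by (simp add: gen_power_def) (simp add: translate_def mod_simps add.commute)
  then show ?case using generate.eng[OF Suc generate.incl[of "gen_power 1"]] by (simp only: singletonI)
qed

text \<open>The Chinese remainder theorem matches the first \<open>j\<close> coordinates but says
  nothing about the tail. Reducing the solution modulo \<open>height j\<close> keeps its residues
  and makes it at most \<open>height i\<close> for every \<open>i \<ge> j\<close>, so the tail is
  dominated by a series that does not depend on \<open>n\<close>; thus \<open>j\<close> can be
  chosen before \<open>n\<close>.\<close>

lemma gen_power_dense: "l1_topology closure_of range gen_power = l1_carrier"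
proof -
  have "\<exists>y\<in>range gen_power. y \<in> l1_metric.mball x r" if x: "x \<in> l1_carrier" and r: "r > 0" for x r
  proof -
    obtain c where c: "x = real_seq c" "c \<in> Seqs" "l1_finite c" using x by (rule l1_carrier_E)
    let ?g = "\<lambda>i. coord_norm i (c i) + 3 * (1/2) ^ i"
    have sg: "summable ?g" using c(3) unfolding l1_finite_def
      by (intro summable_add summable_mult summable_geometric) auto
    obtain j where j: "norm (\<Sum>i. ?g (i + j)) < r"
      using suminf_exist_split[OF r sg] by blast
    obtain n' where n': "\<And>i. i < j \<Longrightarrow> n' mod modulus i = c i mod modulus i" using crt_modulus by metis
    define n where "n = nat (n' mod height j)"
    have n: "0 \<le> int n" "int n < height j" "int n = n' mod height j"
      using height_pos[of j] by (auto simp: n_def)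
    define e where "e = (\<lambda>i. c i - int n)"
    have low: "coord_norm i (e i) = 0" if "i < j" for i
    proof -
      have "int n mod modulus i = c i mod modulus i"
        using n'[OF that] modulus_dvd_height[OF that] by (simp add: n(3) mod_mod_cancel)
      then have "(c i - int n) mod modulus i = 0 mod modulus i" by (metis cancel_comm_monoid_add_class.diff_cancel mod_0 mod_diff_cong)
      then show ?thesis using coord_norm_cong[of "c i - int n" i 0] by (simp add: e_def)
    qed
    have high: "coord_norm (i + j) (e (i + j)) \<le> ?g (i + j)" for i
    proof -
      have "int n \<le> height (i + j)" using n(2) height_mono[of j "i + j"] by simp
      then have "coord_norm (i + j) (int n) \<le> 3 * (1/2) ^ (i + j)" by (intro coord_norm_le_geometric) auto
      moreover have "coord_norm (i + j) (e (i + j)) \<le> coord_norm (i + j) (c (i + j)) + coord_norm (i + j) (int n)"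
        using coord_norm_add[of "i + j" "c (i + j)" "- int n"] by (simp add: e_def coord_norm_minus)
      ultimately show ?thesis by simp
    qed
    have fe: "l1_finite e" unfolding e_def by (intro l1_finite_diff c(3) l1_finite_const)
    have "l1_norm e = (\<Sum>i. coord_norm (i + j) (e (i + j)))"
      using suminf_split_initial_segment[of "\<lambda>i. coord_norm i (e i)" j] fe low
      by (simp add: l1_norm_def l1_finite_def)
    also have "\<dots> \<le> (\<Sum>i. ?g (i + j))"
      using fe sg by (intro suminf_le high summable_ignore_initial_segment) (auto simp: l1_finite_def)
    also have "\<dots> < r" using j by simp
    finally have "l1_norm e < r" .
    moreover have "l1_dist x (gen_power n) = l1_norm e"
      using l1_dist_trans[of c "\<lambda>i. 0" "\<lambda>i. 0" "\<lambda>i. int n"] c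
      by (simp add: gen_power_def translate_0 l1_finite_const e_def)
    ultimately show ?thesis using x by (intro bexI[of _ "gen_power n"]) auto
  qed
  then show ?thesis unfolding l1_topology_def l1_metric.metric_closure_of by blast
qed

lemma polish_group_l1_group: "polish_group l1_group l1_topology"
proof -
  have "completely_metrizable_space l1_topology"
    unfolding completely_metrizable_space_def l1_topology_def
    using l1_metric.Metric_space_axioms mcomplete_l1_carrier by blast
  moreover have "separable_space l1_topology"
    unfolding separable_space_def
  proof (intro exI conjI)
    show "countable (range gen_power)" by simp
    show "range gen_power \<subseteq> topspace l1_topology" by auto
    show "l1_topology closure_of range gen_power = topspace l1_topology" using gen_power_dense by simp
  qed
  ultimately show ?thesis using topological_group_l1_group by (simp add: polish_group_def)
qed

lemma monothetic_l1_group: "monothetic l1_group l1_topology"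
  unfolding monothetic_def
proof (intro bexI)
  have "range gen_power \<subseteq> generate l1_group {gen_power 1}" using gen_power_generate by auto
  then have "l1_carrier \<subseteq> l1_topology closure_of generate l1_group {gen_power 1}"
    using closure_of_mono gen_power_dense by metis
  then show "l1_topology closure_of generate l1_group {gen_power 1} = topspace l1_topology"
    using closure_of_subset_topspace[of l1_topology] by auto
qed simp

lemma not_levy_group_l1_group: "\<not> levy_group l1_group l1_topology"
proof (rule not_levy_group_if_open_index_2)
  define H where "H = {x \<in> l1_carrier. floor_seq x 0 = 0}"
  show "subgroup H l1_group"
  proof (rule l1_group.subgroupI)
    show "H \<noteq> {}" using l1_group.one_closed by (auto simp: H_def intro!: exI[of _ "real_seq (\<lambda>i. 0)"])
    fix a assume a: "a \<in> H"
    then show "inv\<^bsub>l1_group\<^esub> a \<in> H"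
      using l1_group.inv_closed[of a] by (auto simp: H_def inv_l1_group translate_def)
    fix b assume b: "b \<in> H"
    show "a \<otimes>\<^bsub>l1_group\<^esub> b \<in> H"
      using a b l1_group.m_closed[of a b] by (auto simp: H_def translate_def)
  qed (auto simp: H_def)
  have mod2: "c 0 = 0 \<or> c 0 = 1" if "c \<in> Seqs" for c
    using SeqsD(2,3)[OF that, of 0] by (auto simp: modulus_0)
  show "openin l1_topology H"
    unfolding l1_topology_def l1_metric.openin_mtopology
  proof (intro conjI allI impI)
    fix x assume x: "x \<in> H"
    \<comment> \<open>The radius is \<open>(1/2) ^ 0\<close>, the threshold at which
      \<open>l1_norm_small\<close> fixes coordinate 0.\<close>
    have "l1_metric.mball x 1 \<subseteq> H"
    proof
      fix y assume y: "y \<in> l1_metric.mball x 1"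
      obtain c where c: "x = real_seq c" "c \<in> Seqs" "l1_finite c" using x by (auto simp: H_def elim: l1_carrier_E)
      obtain d where d: "y = real_seq d" "d \<in> Seqs" "l1_finite d" using y by (auto elim: l1_carrier_E)
      have "(c 0 - d 0) mod modulus 0 = 0"
        using y c d by (intro l1_norm_small[of "\<lambda>i. c i - d i" 0]) (auto simp: l1_dist_real_seq l1_finite_diff)
      then have "d 0 = 0" using x c mod2[OF d(2)] by (auto simp: H_def modulus_0)
      then show "y \<in> H" using y d by (auto simp: H_def)
    qed
    then show "\<exists>r>0. l1_metric.mball x r \<subseteq> H" by (intro exI[of _ 1]) simp
  qed (auto simp: H_def)
  have "gen_power 1 \<notin> H" by (simp add: H_def gen_power_def translate_def modulus_0)
  then show "H \<noteq> carrier l1_group" using gen_power_l1_carrier[of 1] by auto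
  fix x y assume "x \<in> carrier l1_group - H" "y \<in> carrier l1_group - H"
  then have xy: "x \<in> l1_carrier" "y \<in> l1_carrier" "floor_seq x 0 = 1" "floor_seq y 0 = 1"
    using mod2 by (auto simp: H_def elim!: l1_carrier_E)
  have "inv\<^bsub>l1_group\<^esub> x \<otimes>\<^bsub>l1_group\<^esub> y \<in> l1_carrier" using xy l1_group.m_closed l1_group.inv_closed by (metis l1_group_simps(1))
  moreover have "floor_seq (inv\<^bsub>l1_group\<^esub> x \<otimes>\<^bsub>l1_group\<^esub> y) 0 = 0"
    using xy by (simp add: inv_l1_group) (simp add: translate_def modulus_0)
  ultimately show "inv\<^bsub>l1_group\<^esub> x \<otimes>\<^bsub>l1_group\<^esub> y \<in> H" by (simp add: H_def)
qed

section \<open>The invariant measure\<close>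

text \<open>\<open>w\<close> may have digits out of range, so the empty set is a cylinder as well;
  \<open>Int_stable_cylinder\<close> uses this.\<close>

definition cylinder :: "nat \<Rightarrow> (nat \<Rightarrow> int) \<Rightarrow> (nat \<Rightarrow> int) set" where
  "cylinder K w = {x \<in> Seqs. agree K w x}"

definition cyl_algebra :: "(nat \<Rightarrow> int) measure" where
  "cyl_algebra = sigma Seqs {cylinder K w | K w. True}"

text \<open>The mixed radix expansion (Cantor series) of \<open>t\<close> with bases
  \<open>modulus 0\<close>, \<open>modulus 1\<close> and so on.\<close>

definition digits :: "real \<Rightarrow> nat \<Rightarrow> int" where
  "digits t = (\<lambda>i. \<lfloor>t * height (Suc i)\<rfloor> mod modulus i)"

abbreviation unit_lebesgue :: "real measure" where
  "unit_lebesgue \<equiv> lebesgue_on {0..1}"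

text \<open>By \<open>emeasure_cylinder\<close> this is the product of the uniform measures. Its
  definition as an image of Lebesgue measure supplies one half of the isomorphism with the unit
  interval.\<close>

definition seq_measure :: "(nat \<Rightarrow> int) measure" where
  "seq_measure = distr unit_lebesgue cyl_algebra digits"

text \<open>Horner scheme: the integer with mixed radix digits \<open>w 0\<close>, ...,
  \<open>w (K - 1)\<close>, most significant first.\<close>

primrec prefix_code :: "nat \<Rightarrow> (nat \<Rightarrow> int) \<Rightarrow> int" where
  "prefix_code 0 w = 0"
| "prefix_code (Suc K) w = prefix_code K w * modulus K + w K"

lemma digits_Seqs [simp]: "digits t \<in> Seqs"
  by (simp add: digits_def Seqs_def)

lemma cylinder_subset: "cylinder K w \<subseteq> Seqs"
  by (auto simp: cylinder_def)

lemma cylinder_Pow: "{cylinder K w | K w. True} \<subseteq> Pow Seqs"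
  using cylinder_subset by blast

lemma space_cyl_algebra [simp]: "space cyl_algebra = Seqs"
  unfolding cyl_algebra_def using cylinder_Pow by (rule space_measure_of)

lemma sets_cyl_algebra: "sets cyl_algebra = sigma_sets Seqs {cylinder K w | K w. True}"
  unfolding cyl_algebra_def using cylinder_Pow by (rule sets_measure_of)

lemma cylinder_cyl_algebra [simp]: "cylinder K w \<in> sets cyl_algebra"
  unfolding sets_cyl_algebra by (rule sigma_sets.Basic) blast

lemma measurable_cyl_algebra_I:
  assumes "\<And>x. x \<in> space M \<Longrightarrow> f x \<in> Seqs" "\<And>K w. f -` cylinder K w \<inter> space M \<in> sets M"
  shows "f \<in> measurable M cyl_algebra"
  unfolding cyl_algebra_def using assms cylinder_Pow by (intro measurable_measure_of) auto

lemma measurable_digit_borel: "(\<lambda>t. digits t i) \<in> measurable borel (count_space UNIV)"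
proof -
  have "(\<lambda>t::real. t * height (Suc i)) \<in> borel_measurable borel" by simp
  then have "(\<lambda>t::real. \<lfloor>t * height (Suc i)\<rfloor>) \<in> measurable borel (count_space UNIV)" by simp
  then show ?thesis unfolding digits_def by (rule measurable_compose) simp
qed

lemma measurable_digit: "(\<lambda>t. digits t i) \<in> measurable unit_lebesgue (count_space UNIV)"
proof -
  have "(\<lambda>t. digits t i) \<in> measurable lebesgue (count_space UNIV)"
    using measurable_digit_borel by (intro measurable_completion) simp
  then show ?thesis by (rule measurable_restrict_space1)
qed

lemma measurable_digits: "digits \<in> measurable unit_lebesgue cyl_algebra"
proof (rule measurable_cyl_algebra_I)
  fix K w
  have "digits -` cylinder K w \<inter> space unit_lebesgue = {t \<in> space unit_lebesgue. \<forall>i<K. w i = digits t i}"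
    by (auto simp: cylinder_def agree_def)
  also have "\<dots> = (\<Inter>i<K. (\<lambda>t. digits t i) -` {w i} \<inter> space unit_lebesgue) \<inter> space unit_lebesgue" by auto
  also have "\<dots> \<in> sets unit_lebesgue"
  proof (cases "K = 0")
    case False
    then show ?thesis
      by (intro sets.Int sets.finite_INT measurable_sets[OF measurable_digit]) auto
  qed simp
  finally show "digits -` cylinder K w \<inter> space unit_lebesgue \<in> sets unit_lebesgue" .
qed simp

lemma space_seq_measure [simp]: "space seq_measure = Seqs"
  by (simp add: seq_measure_def)

lemma sets_seq_measure [simp]: "sets seq_measure = sets cyl_algebra"
  by (simp add: seq_measure_def)

lemma prob_space_unit_lebesgue: "prob_space unit_lebesgue"
  by (rule prob_spaceI) (simp add: emeasure_restrict_space)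

interpretation seq_measure: prob_space seq_measure
  unfolding seq_measure_def by (rule prob_space.prob_space_distr[OF prob_space_unit_lebesgue measurable_digits])

lemma digit_eq:
  fixes t :: real
  shows "\<lfloor>t * height (Suc K)\<rfloor> = \<lfloor>t * height K\<rfloor> * modulus K + digits t K"
proof -
  have "\<lfloor>t * height K\<rfloor> = \<lfloor>(t * height (Suc K)) / modulus K\<rfloor>" by (simp add: height_Suc)
  also have "\<dots> = \<lfloor>t * height (Suc K)\<rfloor> div modulus K" by (rule floor_divide_real_eq_div) simp
  finally show ?thesis by (simp add: digits_def)
qed

lemma prefix_code_bounds: "w \<in> Seqs \<Longrightarrow> 0 \<le> prefix_code K w \<and> prefix_code K w < height K"
proof (induction K)
  case (Suc K)
  then have "(prefix_code K w + 1) * modulus K \<le> height K * modulus K" by (intro mult_right_mono) auto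
  then show ?case using Suc SeqsD(2,3)[of w K] by (simp add: height_Suc algebra_simps)
qed simp

text \<open>Uniqueness of division with remainder: by \<open>digit_eq\<close> the floor and the code
  are extended by one digit in the same way. \<open>t < 1\<close> starts the induction, where the
  floor of \<open>t\<close> has to be 0.\<close>

lemma agree_digits_iff:
  assumes "w \<in> Seqs" "0 \<le> t" "t < 1"
  shows "agree K w (digits t) \<longleftrightarrow> \<lfloor>t * height K\<rfloor> = prefix_code K w"
proof (induction K)
  case 0
  then show ?case using assms by (simp add: agree_def floor_eq_iff)
next
  case (Suc K)
  have *: "a * modulus K + r = b * modulus K + s \<longleftrightarrow> a = b \<and> r = s"
    if "0 \<le> r" "r < modulus K" "0 \<le> s" "s < modulus K" for a b r s :: int
    using that modulus_pos(2)[of K]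
    by (metis add.commute add_right_cancel mod_mult_self1 mod_pos_pos_trivial mult_cancel_right)
  have "agree (Suc K) w (digits t) \<longleftrightarrow> agree K w (digits t) \<and> w K = digits t K"
    by (auto simp: agree_def less_Suc_eq)
  also have "\<dots> \<longleftrightarrow> \<lfloor>t * height K\<rfloor> * modulus K + digits t K = prefix_code K w * modulus K + w K"
    using Suc assms(1) by (subst *) (auto simp: SeqsD)
  also have "\<dots> \<longleftrightarrow> \<lfloor>t * height (Suc K)\<rfloor> = prefix_code (Suc K) w"
    by (simp only: digit_eq prefix_code.simps)
  finally show ?case .
qed

lemma emeasure_cylinder:
  assumes "w \<in> Seqs"
  shows "emeasure seq_measure (cylinder K w) = ennreal (1 / height K)"
proof -
  let ?h = "real_of_int (height K)" and ?k = "real_of_int (prefix_code K w)"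
  let ?I = "{?k / ?h ..< (?k + 1) / ?h}"
  have h: "?h > 0" by (simp add: height_pos)
  have k: "0 \<le> ?k" "?k + 1 \<le> ?h" using prefix_code_bounds[OF assms, of K] by linarith+
  have I: "?I \<subseteq> {0..<1}" using k h by (auto simp: field_simps)
  have "emeasure seq_measure (cylinder K w) = emeasure unit_lebesgue (digits -` cylinder K w \<inter> space unit_lebesgue)"
    unfolding seq_measure_def by (rule emeasure_distr[OF measurable_digits cylinder_cyl_algebra])
  also have "\<dots> = emeasure unit_lebesgue ?I"
  proof (rule emeasure_eq_AE)
    \<comment> \<open>The endpoint 1 has the same digits as 0 and lies outside the range of
      \<open>agree_digits_iff\<close>.\<close>
    have "{1} \<in> null_sets unit_lebesgue" by (simp add: null_sets_restrict_space)
    then have "AE t in unit_lebesgue. t \<notin> {1}" by (rule AE_not_in)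
    then show "AE t in unit_lebesgue. t \<in> digits -` cylinder K w \<inter> space unit_lebesgue \<longleftrightarrow> t \<in> ?I"
    proof (rule AE_mp, intro AE_I2 impI)
      fix t assume t: "t \<in> space unit_lebesgue" "t \<notin> {1}"
      then have t': "0 \<le> t" "t < 1" by auto
      have "t \<in> digits -` cylinder K w \<inter> space unit_lebesgue \<longleftrightarrow> \<lfloor>t * ?h\<rfloor> = prefix_code K w"
        using t by (simp add: cylinder_def agree_digits_iff[OF assms t'])
      also have "\<dots> \<longleftrightarrow> t \<in> ?I"
        using h by (auto simp: floor_eq_iff field_simps)
      finally show "t \<in> digits -` cylinder K w \<inter> space unit_lebesgue \<longleftrightarrow> t \<in> ?I" .
    qed
    show "digits -` cylinder K w \<inter> space unit_lebesgue \<in> sets unit_lebesgue" by (rule measurable_sets[OF measurable_digits cylinder_cyl_algebra])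
    show "?I \<in> sets unit_lebesgue" using I by (auto simp: sets_restrict_space_iff)
  qed
  also have "\<dots> = emeasure lborel ?I"
    using I by (subst emeasure_restrict_space) auto
  also have "\<dots> = ennreal ((?k + 1) / ?h - ?k / ?h)"
    using h by (intro emeasure_lborel_Ico divide_right_mono) auto
  also have "(?k + 1) / ?h - ?k / ?h = 1 / ?h" by (simp add: diff_divide_distrib[symmetric])
  finally show ?thesis .
qed

section \<open>Finite-level sets and counting\<close>

definition reps :: "nat \<Rightarrow> (nat \<Rightarrow> int) set" where
  "reps K = {x \<in> Seqs. \<forall>i\<ge>K. x i = 0}"

definition truncate :: "nat \<Rightarrow> (nat \<Rightarrow> int) \<Rightarrow> nat \<Rightarrow> int" where
  "truncate K x = (\<lambda>i. if i < K then x i else 0)"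

text \<open>These are the unions of cylinders of level \<open>K\<close>. Their measure is a count
  over \<open>reps K\<close>, which turns the later estimates into finite combinatorics.\<close>

definition determined :: "nat \<Rightarrow> (nat \<Rightarrow> int) set \<Rightarrow> bool" where
  "determined K A \<longleftrightarrow> A \<subseteq> Seqs \<and> (\<forall>x\<in>Seqs. \<forall>y\<in>Seqs. agree K x y \<longrightarrow> x \<in> A \<longrightarrow> y \<in> A)"

lemma agree_sym: "agree K x y \<longleftrightarrow> agree K y x"
  unfolding agree_def by metis

lemma agree_tr: "agree K x y \<Longrightarrow> agree K y z \<Longrightarrow> agree K x z"
  by (simp add: agree_def)

lemma agree_mono: "agree K' x y \<Longrightarrow> K \<le> K' \<Longrightarrow> agree K x y"
  by (simp add: agree_def)

lemma detD: "determined K A \<Longrightarrow> x \<in> Seqs \<Longrightarrow> y \<in> Seqs \<Longrightarrow> agree K x y \<Longrightarrow> x \<in> A \<longleftrightarrow> y \<in> A"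
  unfolding determined_def using agree_sym by blast

lemma determined_subset: "determined K A \<Longrightarrow> A \<subseteq> Seqs"
  by (simp add: determined_def)

lemma determined_mono: "determined K A \<Longrightarrow> K \<le> K' \<Longrightarrow> determined K' A"
  unfolding determined_def using agree_mono by blast

lemma determined_cylinder: "determined K (cylinder K w)"
  unfolding determined_def cylinder_def using agree_tr by blast

lemma determined_Un: "determined K A \<Longrightarrow> determined K B \<Longrightarrow> determined K (A \<union> B)"
  unfolding determined_def by blast

lemma determined_Diff: "determined K A \<Longrightarrow> determined K (Seqs - A)"
  unfolding determined_def using agree_sym by blast

lemma determined_vimage:
  assumes "determined K A" "\<And>x. x \<in> Seqs \<Longrightarrow> F x \<in> Seqs"
    "\<And>x y. x \<in> Seqs \<Longrightarrow> y \<in> Seqs \<Longrightarrow> agree K x y \<Longrightarrow> agree K (F x) (F y)"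
  shows "determined K (F -` A \<inter> Seqs)"
  using assms unfolding determined_def by blast

lemma bij_reps_Suc:
  "bij_betw (\<lambda>(r, y). r(K := y)) (reps K \<times> {0..<modulus K}) (reps (Suc K))"
proof (rule bij_betw_byWitness[where f' = "\<lambda>x. (x(K := 0), x K)"])
  show "\<forall>a\<in>reps K \<times> {0..<modulus K}. ((case a of (r, y) \<Rightarrow> r(K := y))(K := 0), (case a of (r, y) \<Rightarrow> r(K := y)) K) = a"
    by (auto simp: reps_def fun_eq_iff)
  show "(\<lambda>(r, y). r(K := y)) ` (reps K \<times> {0..<modulus K}) \<subseteq> reps (Suc K)"
    by (auto simp: reps_def Seqs_def)
  show "(\<lambda>x. (x(K := 0), x K)) ` reps (Suc K) \<subseteq> reps K \<times> {0..<modulus K}"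
    by (auto simp: reps_def Seqs_def le_Suc_eq)
qed auto

lemma reps_0: "reps 0 = {\<lambda>i. 0}"
  by (auto simp: reps_def)

lemma finite_reps [simp]: "finite (reps K)"
proof (induction K)
  case (Suc K)
  then show ?case using bij_betw_finite[OF bij_reps_Suc[of K]] by simp
qed (simp add: reps_0)

text \<open>Fubini for counting, with the last coordinate as the inner variable.\<close>

lemma card_reps_Suc:
  "card {x \<in> reps (Suc K). P x} = (\<Sum>r\<in>reps K. card {y \<in> {0..<modulus K}. P (r(K := y))})"
proof -
  have "card {x \<in> reps (Suc K). P x} = card {p \<in> reps K \<times> {0..<modulus K}. P (case p of (r, y) \<Rightarrow> r(K := y))}"
  proof (rule bij_betw_same_card[symmetric])
    show "bij_betw (\<lambda>(r, y). r(K := y)) {p \<in> reps K \<times> {0..<modulus K}. P (case p of (r, y) \<Rightarrow> r(K := y))}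
        {x \<in> reps (Suc K). P x}"
      by (rule bij_betw_Collect[OF bij_reps_Suc]) simp
  qed
  also have "{p \<in> reps K \<times> {0..<modulus K}. P (case p of (r, y) \<Rightarrow> r(K := y))}
      = (SIGMA r:reps K. {y \<in> {0..<modulus K}. P (r(K := y))})" by auto
  also have "card \<dots> = (\<Sum>r\<in>reps K. card {y \<in> {0..<modulus K}. P (r(K := y))})"
    by (intro card_SigmaI ballI finite_int_range_Collect finite_reps)
  finally show ?thesis .
qed

lemma card_reps: "int (card (reps K)) = height K"
proof (induction K)
  case (Suc K)
  have "card (reps (Suc K)) = card {x \<in> reps (Suc K). True}" by simp
  also have "\<dots> = card (reps K) * card {y \<in> {0..<modulus K}. True}"
    by (subst card_reps_Suc) simp
  also have "{y \<in> {0..<modulus K}. True} = {0..<modulus K}" by blast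
  finally show ?case using Suc by (simp add: height_Suc)
qed (simp add: reps_0)

lemma truncate_reps [simp]: "x \<in> Seqs \<Longrightarrow> truncate K x \<in> reps K"
  by (auto simp: truncate_def reps_def Seqs_def)

lemma truncate_Seqs [simp]: "x \<in> Seqs \<Longrightarrow> truncate K x \<in> Seqs"
  by (auto simp: truncate_def Seqs_def)

lemma reps_Seqs: "x \<in> reps K \<Longrightarrow> x \<in> Seqs"
  by (simp add: reps_def)

lemma agree_truncate [simp]: "agree K x (truncate K x)" "agree K (truncate K x) x"
  by (auto simp: truncate_def agree_def)

lemma reps_agree_eq: "x \<in> reps K \<Longrightarrow> y \<in> reps K \<Longrightarrow> agree K x y \<Longrightarrow> x = y"
  by (rule ext) (metis (mono_tags, lifting) agree_def leI mem_Collect_eq reps_def)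

lemma determined_eq_UN:
  assumes "determined K A"
  shows "A = (\<Union>r\<in>{r \<in> reps K. r \<in> A}. cylinder K r)"
proof (intro equalityI subsetI)
  fix x assume x: "x \<in> A"
  then have "x \<in> Seqs" using determined_subset[OF assms] by blast
  then have "truncate K x \<in> reps K" "truncate K x \<in> A" "x \<in> cylinder K (truncate K x)"
    using x detD[OF assms, of x "truncate K x"] reps_Seqs by (auto simp: cylinder_def)
  then show "x \<in> (\<Union>r\<in>{r \<in> reps K. r \<in> A}. cylinder K r)" by blast
next
  fix x assume "x \<in> (\<Union>r\<in>{r \<in> reps K. r \<in> A}. cylinder K r)"
  then obtain r where r: "r \<in> reps K" "r \<in> A" "x \<in> Seqs" "agree K r x" by (auto simp: cylinder_def)
  then show "x \<in> A" using detD[OF assms] reps_Seqs by blast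
qed

lemma determined_sets: "determined K A \<Longrightarrow> A \<in> sets cyl_algebra"
  by (subst determined_eq_UN, assumption, intro sets.finite_UN) auto

lemma emeasure_determined:
  assumes "determined K A"
  shows "emeasure seq_measure A = ennreal (card {r \<in> reps K. r \<in> A} / height K)"
proof -
  have "emeasure seq_measure A = emeasure seq_measure (\<Union>r\<in>{r \<in> reps K. r \<in> A}. cylinder K r)"
    using determined_eq_UN[OF assms] by (rule arg_cong)
  also have "\<dots> = (\<Sum>r\<in>{r \<in> reps K. r \<in> A}. emeasure seq_measure (cylinder K r))"
  proof (rule sum_emeasure[symmetric])
    show "disjoint_family_on (cylinder K) {r \<in> reps K. r \<in> A}"
    proof (unfold disjoint_family_on_def, intro ballI impI equals0I)
      fix r s x assume "r \<in> {r \<in> reps K. r \<in> A}" "s \<in> {r \<in> reps K. r \<in> A}" "r \<noteq> s"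
        "x \<in> cylinder K r \<inter> cylinder K s"
      then show False using reps_agree_eq[of r K s] agree_tr[of K r x s] agree_sym
        by (auto simp: cylinder_def)
    qed
  qed auto
  also have "\<dots> = (\<Sum>r\<in>{r \<in> reps K. r \<in> A}. ennreal (1 / height K))"
    by (intro sum.cong emeasure_cylinder) (auto simp: reps_Seqs)
  also have "\<dots> = ennreal (card {r \<in> reps K. r \<in> A} / height K)"
    using height_pos[of K] by (simp add: ennreal_of_nat_eq_real_of_nat ennreal_mult[symmetric])
  finally show ?thesis .
qed

lemma measure_determined: "determined K A \<Longrightarrow> measure seq_measure A = card {r \<in> reps K. r \<in> A} / height K"
  using height_pos[of K] by (simp add: measure_def emeasure_determined)

lemma measure_vimage_determined:
  assumes A: "determined K A" and F: "\<And>x. x \<in> Seqs \<Longrightarrow> F x \<in> Seqs"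
    and loc: "\<And>x y. x \<in> Seqs \<Longrightarrow> y \<in> Seqs \<Longrightarrow> agree K (F x) (F y) \<longleftrightarrow> agree K x y"
  shows "measure seq_measure (F -` A \<inter> Seqs) = measure seq_measure A"
proof -
  \<comment> \<open>\<open>F\<close> descends to a map of the finitely many prefixes of length
    \<open>K\<close>; by \<open>loc\<close> it is injective, hence a permutation.\<close>
  define G where "G = (\<lambda>r. truncate K (F r))"
  have G: "G ` reps K \<subseteq> reps K" using F by (auto simp: G_def reps_Seqs)
  have GF: "G r \<in> A \<longleftrightarrow> F r \<in> A" if "r \<in> reps K" for r
    unfolding G_def using F[OF reps_Seqs[OF that]] by (intro detD[OF A]) auto
  have inj: "inj_on G (reps K)"
  proof (rule inj_onI)
    fix r s assume rs: "r \<in> reps K" "s \<in> reps K" "G r = G s"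
    then have "agree K (F r) (F s)" unfolding G_def by (metis agree_truncate agree_tr)
    then show "r = s" using rs loc reps_Seqs reps_agree_eq by blast
  qed
  then have im: "G ` reps K = reps K" using G by (intro endo_inj_surj) auto
  have "bij_betw G {r \<in> reps K. r \<in> F -` A \<inter> Seqs} {r \<in> reps K. r \<in> A}"
    unfolding bij_betw_def
  proof
    show "inj_on G {r \<in> reps K. r \<in> F -` A \<inter> Seqs}" using inj by (rule inj_on_subset) auto
    show "G ` {r \<in> reps K. r \<in> F -` A \<inter> Seqs} = {r \<in> reps K. r \<in> A}"
    proof (intro equalityI subsetI)
      fix s assume s: "s \<in> {r \<in> reps K. r \<in> A}"
      then obtain r where "r \<in> reps K" "s = G r" using im by blast
      then show "s \<in> G ` {r \<in> reps K. r \<in> F -` A \<inter> Seqs}" using s GF reps_Seqs by auto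
    qed (use G GF in auto)
  qed
  then have "card {r \<in> reps K. r \<in> F -` A \<inter> Seqs} = card {r \<in> reps K. r \<in> A}"
    by (rule bij_betw_same_card)
  moreover have "determined K (F -` A \<inter> Seqs)" using A F loc by (intro determined_vimage) auto
  ultimately show ?thesis using A by (simp add: measure_determined)
qed

section \<open>Almost every point settles\<close>

definition jumping :: "(nat \<Rightarrow> int) \<Rightarrow> nat \<Rightarrow> (nat \<Rightarrow> int) set" where
  "jumping c k = {x \<in> Seqs. offset k (x k + c k) \<noteq> offset k (x k)}"

lemma determined_jumping: "determined (Suc k) (jumping c k)"
  by (auto simp: determined_def jumping_def agree_def)

text \<open>Only coordinate \<open>k\<close> matters and it is uniformly distributed, so the measure
  is exactly the first summand of \<open>coord_norm\<close>.\<close>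

lemma measure_jumping: "measure seq_measure (jumping c k) \<le> coord_norm k (c k)"
proof -
  have "card {r \<in> reps (Suc k). r \<in> jumping c k}
      = (\<Sum>r\<in>reps k. card {y \<in> {0..<modulus k}. r(k := y) \<in> jumping c k})"
    by (rule card_reps_Suc)
  also have "\<dots> = (\<Sum>r\<in>reps k. card (jumps k (c k)))"
  proof (rule sum.cong[OF refl])
    fix r assume "r \<in> reps k"
    then have "{y \<in> {0..<modulus k}. r(k := y) \<in> jumping c k} = jumps k (c k)"
      by (auto simp: jumping_def reps_def Seqs_def jumps_def)
    then show "card {y \<in> {0..<modulus k}. r(k := y) \<in> jumping c k} = card (jumps k (c k))"
      by (rule arg_cong)
  qed
  finally have c: "real (card {r \<in> reps (Suc k). r \<in> jumping c k}) = height k * card (jumps k (c k))"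
    by (simp add: card_reps[symmetric])
  have "measure seq_measure (jumping c k) = card (jumps k (c k)) / modulus k"
    unfolding measure_determined[OF determined_jumping] c height_Suc using height_pos[of k] by simp
  then show ?thesis using card_jumps_le_coord_norm by simp
qed

lemma settled_eq: "settled c J = Seqs - (\<Union>k. jumping c (k + J))"
proof -
  have "(\<forall>k\<ge>J. P k) \<longleftrightarrow> (\<forall>k. P (k + J))" for P :: "nat \<Rightarrow> bool"
    by (metis le_add2 le_add_diff_inverse2)
  then show ?thesis by (auto simp: settled_def jumping_def)
qed

lemma jumping_sets [simp]: "jumping c k \<in> sets cyl_algebra"
  using determined_jumping by (rule determined_sets)

lemma settled_sets [simp]: "settled c J \<in> sets cyl_algebra"
proof -
  have "(\<Union>k. jumping c (k + J)) \<in> sets cyl_algebra" by (intro sets.countable_UN) auto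
  then show ?thesis unfolding settled_eq using sets.compl_sets[of _ cyl_algebra] by (simp add: sets.Diff)
qed

text \<open>The union bound over all later jumps. Besides the Borel-Cantelli argument it gives the
  quantitative estimate behind \<open>flow_continuous\<close>.\<close>

lemma measure_not_settled:
  assumes "l1_finite c"
  shows "measure seq_measure (Seqs - settled c J) \<le> (\<Sum>k. coord_norm (k + J) (c (k + J)))"
proof -
  have s: "summable (\<lambda>k. coord_norm (k + J) (c (k + J)))"
    using assms summable_ignore_initial_segment[of "\<lambda>k. coord_norm k (c k)" J] by (simp add: l1_finite_def)
  have s': "summable (\<lambda>k. measure seq_measure (jumping c (k + J)))"
    by (rule summable_comparison_test'[OF s]) (simp add: measure_jumping)
  have "Seqs - settled c J = (\<Union>k. jumping c (k + J))"
    unfolding settled_eq using determined_subset[OF determined_jumping] by blast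
  then have "measure seq_measure (Seqs - settled c J) \<le> (\<Sum>k. measure seq_measure (jumping c (k + J)))"
    using s' by (simp add: seq_measure.finite_measure_subadditive_countably image_subset_iff)
  also have "\<dots> \<le> (\<Sum>k. coord_norm (k + J) (c (k + J)))"
    by (intro suminf_le measure_jumping s s')
  finally show ?thesis .
qed

lemma measure_not_settled_tendsto:
  assumes "l1_finite c"
  shows "(\<lambda>J. measure seq_measure (Seqs - settled c J)) \<longlonglongrightarrow> 0"
proof (rule tendsto_sandwich[OF _ _ tendsto_const])
  show "(\<lambda>J. \<Sum>k. coord_norm (k + J) (c (k + J))) \<longlonglongrightarrow> 0"
    using suminf_exist_split2[of "\<lambda>k. coord_norm k (c k)"] assms by (simp add: l1_finite_def)
qed (use measure_not_settled[OF assms] in auto)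

lemma AE_settled:
  assumes "l1_finite c"
  shows "AE x in seq_measure. \<exists>J. x \<in> settled c J"
proof -
  let ?B = "Seqs - (\<Union>J. settled c J)"
  have B: "?B \<in> sets cyl_algebra" using sets.Diff[OF sets.top[of cyl_algebra], of "\<Union>J. settled c J"] by (simp add: sets.countable_UN image_subset_iff)
  have "measure seq_measure ?B \<le> measure seq_measure (Seqs - settled c J)" for J
    using B by (intro seq_measure.finite_measure_mono) (auto intro!: sets.Diff sets.top[of cyl_algebra, simplified])
  then have "measure seq_measure ?B \<le> 0"
    using measure_not_settled_tendsto[OF assms] by (intro LIMSEQ_le_const[where a = "measure seq_measure ?B"]) auto
  then have "measure seq_measure ?B = 0" by (simp add: measure_le_0_iff)
  then have "?B \<in> null_sets seq_measure"
    using B by (intro null_setsI) (auto simp: seq_measure.emeasure_eq_measure)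
  then show ?thesis by (rule AE_I') auto
qed

lemma determined_fin_flow:
  assumes "determined K A"
  shows "determined (max J K) (fin_flow J c -` A \<inter> Seqs)"
  using determined_mono[OF assms, of "max J K"] by (intro determined_vimage) (auto intro: agree_fin_flow)

lemma measurable_flow: "flow c \<in> measurable seq_measure seq_measure"
proof -
  have "flow c \<in> measurable cyl_algebra cyl_algebra"
  proof (rule measurable_cyl_algebra_I)
    fix K w
    let ?C = "cylinder K w"
    have "flow c -` ?C \<inter> Seqs = (\<Union>J. settled c J \<inter> (fin_flow J c -` ?C \<inter> Seqs))
        \<union> ((Seqs - (\<Union>J. settled c J)) \<inter> (translate c -` ?C \<inter> Seqs))" (is "_ = ?R")
    proof (rule Set.set_eqI)
      fix x
      show "x \<in> flow c -` ?C \<inter> Seqs \<longleftrightarrow> x \<in> ?R"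
      proof (cases "\<exists>J. x \<in> settled c J")
        case True
        then obtain J where "x \<in> settled c J" by blast
        moreover have "flow c x = fin_flow J' c x" if "x \<in> settled c J'" for J'
          using that by (rule flow_settled)
        ultimately show ?thesis by (auto simp: settled_def)
      next
        case False
        then show ?thesis using flow_jumping[OF False] by auto
      qed
    qed
    also have "\<dots> \<in> sets cyl_algebra"
      by (intro sets.Un sets.Int sets.countable_UN sets.Diff image_subsetI determined_sets[OF determined_fin_flow[OF determined_cylinder]]
          settled_sets sets.top[of cyl_algebra, simplified] determined_sets[OF determined_vimage[OF determined_cylinder]])
        (auto intro: agree_trans)
    finally show "flow c -` ?C \<inter> space cyl_algebra \<in> sets cyl_algebra" by simp
  qed simp
  then show ?thesis by (simp cong: measurable_cong_sets)
qed

section \<open>Invariance of the measure\<close>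

lemma Int_stable_cylinder: "Int_stable {cylinder K w | K w. True}"
proof (rule Int_stableI)
  have *: "\<exists>L u. cylinder K w \<inter> cylinder K' w' = cylinder L u" if "K \<le> K'" for K K' w w'
  proof (cases "agree K w w'")
    case True
    then have "cylinder K w \<inter> cylinder K' w' = cylinder K' w'" using that by (auto simp: cylinder_def agree_def)
    then show ?thesis by blast
  next
    case False
    \<comment> \<open>An empty intersection has to be presented as a cylinder too; an impossible
      digit does it.\<close>
    have "cylinder 1 (\<lambda>i. - 1) = {}"
    proof (rule equals0I)
      fix x assume "x \<in> cylinder 1 (\<lambda>i. - 1)"
      then have "x \<in> Seqs" "x 0 = - 1" by (simp_all add: cylinder_def agree_def)
      then show False using SeqsD(2)[of x 0] by simp
    qed
    moreover have "cylinder K w \<inter> cylinder K' w' = {}" using False that by (force simp: cylinder_def agree_def)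
    ultimately show ?thesis by metis
  qed
  fix a b assume "a \<in> {cylinder K w | K w. True}" "b \<in> {cylinder K w | K w. True}"
  then obtain K w K' w' where "a = cylinder K w" "b = cylinder K' w'" by blast
  then show "a \<inter> b \<in> {cylinder K w | K w. True}"
    using *[of K K' w w'] *[of K' K w' w] by (metis (mono_tags, lifting) inf_commute linear mem_Collect_eq)
qed

lemma measure_fin_flow_vimage:
  assumes "determined K A"
  shows "measure seq_measure (fin_flow J c -` A \<inter> Seqs) = measure seq_measure A"
  using determined_mono[OF assms, of "max J K"] by (intro measure_vimage_determined) (auto simp: agree_fin_flow_iff)

lemma distr_flow:
  assumes "l1_finite c"
  shows "distr seq_measure seq_measure (flow c) = seq_measure"
proof (rule measure_eqI_generator_eq[OF Int_stable_cylinder cylinder_Pow])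
  show "sets (distr seq_measure seq_measure (flow c)) = sigma_sets Seqs {cylinder K w | K w. True}" by (simp add: sets_cyl_algebra)
  show "sets seq_measure = sigma_sets Seqs {cylinder K w | K w. True}" by (simp add: sets_cyl_algebra)
  show "range (\<lambda>i::nat. cylinder 0 (\<lambda>i. 0)) \<subseteq> {cylinder K w | K w. True}" by blast
  show "(\<Union>i::nat. cylinder 0 (\<lambda>i. 0)) = Seqs" by (simp add: cylinder_def agree_def)
  interpret D: prob_space "distr seq_measure seq_measure (flow c)" by (rule seq_measure.prob_space_distr[OF measurable_flow])
  show "emeasure (distr seq_measure seq_measure (flow c)) (cylinder 0 (\<lambda>i. 0)) \<noteq> \<infinity>" by (simp add: D.emeasure_eq_measure)
  fix C assume "C \<in> {cylinder K w | K w. True}"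
  then obtain K w where C: "C = cylinder K w" by blast
  let ?F = "flow c -` C \<inter> Seqs"
  have F: "?F \<in> sets cyl_algebra" using measurable_sets[OF measurable_flow, of C c] C by simp
  have G: "Seqs - settled c J \<in> sets cyl_algebra" for J by (intro sets.Diff settled_sets sets.top[of cyl_algebra, simplified])
  \<comment> \<open>\<open>fin_flow J c\<close> permutes prefixes and so preserves the measure of
    \<open>C\<close>; it differs from \<open>flow c\<close> only off \<open>settled c J\<close>,
    whose complement shrinks to measure 0.\<close>
  have "\<bar>measure seq_measure ?F - measure seq_measure C\<bar> \<le> measure seq_measure (Seqs - settled c J)" for J
  proof -
    let ?A = "fin_flow J c -` C \<inter> Seqs"
    have A: "?A \<in> sets cyl_algebra" unfolding C by (rule determined_sets[OF determined_fin_flow[OF determined_cylinder]])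
    have mA: "measure seq_measure ?A = measure seq_measure C" unfolding C by (rule measure_fin_flow_vimage[OF determined_cylinder])
    have e: "x \<in> ?F \<longleftrightarrow> x \<in> ?A" if "x \<in> settled c J" for x using flow_settled[OF that] by auto
    have "measure seq_measure ?F \<le> measure seq_measure (?A \<union> (Seqs - settled c J))"
      using e A G by (intro seq_measure.finite_measure_mono) auto
    also have "\<dots> \<le> measure seq_measure ?A + measure seq_measure (Seqs - settled c J)"
      using A G by (intro measure_Un_le) auto
    finally have 1: "measure seq_measure ?F \<le> measure seq_measure C + measure seq_measure (Seqs - settled c J)" using mA by simp
    have "measure seq_measure ?A \<le> measure seq_measure (?F \<union> (Seqs - settled c J))"
      using e F G by (intro seq_measure.finite_measure_mono) auto
    also have "\<dots> \<le> measure seq_measure ?F + measure seq_measure (Seqs - settled c J)"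
      using F G by (intro measure_Un_le) auto
    finally show ?thesis using 1 mA by simp
  qed
  then have "\<bar>measure seq_measure ?F - measure seq_measure C\<bar> \<le> 0"
    using measure_not_settled_tendsto[OF assms] by (intro LIMSEQ_le_const) auto
  then have "measure seq_measure ?F = measure seq_measure C" by simp
  then show "emeasure (distr seq_measure seq_measure (flow c)) C = emeasure seq_measure C"
    using C by (simp add: emeasure_distr[OF measurable_flow] seq_measure.emeasure_eq_measure)
qed

section \<open>Boolean actions from pointwise maps\<close>

lemma mp_transfI:
  assumes "f \<in> measurable M M" "g \<in> measurable M M" "distr M M f = M"
    "\<And>x. x \<in> space M \<Longrightarrow> g (f x) = x" "\<And>x. x \<in> space M \<Longrightarrow> f (g x) = x"
  shows "f \<in> mp_transf M"
proof -
  have sp: "f ` space M \<subseteq> space M" "g ` space M \<subseteq> space M"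
    using assms(1,2)[THEN measurable_space] by auto
  then have b: "bij_betw f (space M) (space M)"
    using assms by (intro bij_betw_byWitness[where f' = g]) auto
  have "the_inv_into (space M) f x = g x" if "x \<in> space M" for x
    using that sp assms(5) b by (intro the_inv_into_f_eq) (auto simp: bij_betw_def)
  then have "the_inv_into (space M) f \<in> measurable M M"
    using assms(2) by (simp cong: measurable_cong)
  then show ?thesis using assms b by (simp add: mp_transf_def)
qed

lemma mp_transfE:
  assumes "f \<in> mp_transf M"
  obtains g where "f \<in> measurable M M" "g \<in> measurable M M" "distr M M f = M"
    "\<And>x. x \<in> space M \<Longrightarrow> g (f x) = x" "\<And>x. x \<in> space M \<Longrightarrow> f (g x) = x"
proof (rule that[of "the_inv_into (space M) f"])
  have b: "bij_betw f (space M) (space M)" using assms by (simp add: mp_transf_def)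
  show "the_inv_into (space M) f (f x) = x" if "x \<in> space M" for x
    using b that by (simp add: bij_betw_def the_inv_into_f_f)
  show "f (the_inv_into (space M) f x) = x" if "x \<in> space M" for x
    using b that by (rule f_the_inv_into_f_bij_betw) 
qed (use assms in \<open>auto simp: mp_transf_def\<close>)

lemma mp_transf_comp:
  assumes "f \<in> mp_transf M" "g \<in> mp_transf M"
  shows "f \<circ> g \<in> mp_transf M"
proof -
  obtain f' where f: "f \<in> measurable M M" "f' \<in> measurable M M" "distr M M f = M"
    "\<And>x. x \<in> space M \<Longrightarrow> f' (f x) = x" "\<And>x. x \<in> space M \<Longrightarrow> f (f' x) = x"
    using assms(1) by (rule mp_transfE) blast
  obtain g' where g: "g \<in> measurable M M" "g' \<in> measurable M M" "distr M M g = M"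
    "\<And>x. x \<in> space M \<Longrightarrow> g' (g x) = x" "\<And>x. x \<in> space M \<Longrightarrow> g (g' x) = x"
    using assms(2) by (rule mp_transfE) blast
  show ?thesis
  proof (rule mp_transfI[where g = "g' \<circ> f'"])
    show "distr M M (f \<circ> g) = M" using distr_distr[OF f(1) g(1)] f(3) g(3) by simp
  qed (use f g measurable_space[OF g(1)] measurable_space[OF f(2)] in \<open>auto intro: measurable_comp\<close>)
qed

lemma id_mp_transf: "id \<in> mp_transf M"
  by (rule mp_transfI[where g = id]) (auto simp: id_def distr_id)

lemma equiv_ae_rel: "equiv (mp_transf M) (ae_rel M)"
proof (rule equivI)
  show "ae_rel M \<subseteq> mp_transf M \<times> mp_transf M" by (auto simp: ae_rel_def)
  show "refl_on (mp_transf M) (ae_rel M)" by (auto simp: ae_rel_def refl_on_def)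
  show "sym (ae_rel M)" by (auto simp: ae_rel_def sym_def)
  show "trans (ae_rel M)"
    unfolding ae_rel_def by (rule transI) auto
qed

definition aut_class :: "'b measure \<Rightarrow> ('b \<Rightarrow> 'b) \<Rightarrow> ('b \<Rightarrow> 'b) set" where
  "aut_class M f = ae_rel M `` {f}"

lemma in_aut_class: "g \<in> aut_class M f \<longleftrightarrow> (f, g) \<in> ae_rel M"
  by (simp add: aut_class_def)

lemma aut_class_self: "f \<in> mp_transf M \<Longrightarrow> f \<in> aut_class M f"
  by (simp add: in_aut_class ae_rel_def)

lemma aut_class_carrier: "f \<in> mp_transf M \<Longrightarrow> aut_class M f \<in> carrier (aut_group M)"
  by (simp add: aut_group_def aut_class_def quotientI)

lemma aut_class_eq: "(f, g) \<in> ae_rel M \<Longrightarrow> aut_class M f = aut_class M g"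
  unfolding aut_class_def using equiv_ae_rel by (rule equiv_class_eq)

lemma carrier_aut_class:
  assumes "a \<in> carrier (aut_group M)" "f \<in> a"
  shows "a = aut_class M f" "f \<in> mp_transf M"
proof -
  have a: "a \<in> mp_transf M // ae_rel M" using assms(1) by (simp add: aut_group_def)
  then obtain h where h: "h \<in> mp_transf M" "a = aut_class M h"
    unfolding aut_class_def by (rule quotientE)
  then have "(h, f) \<in> ae_rel M" using assms(2) by (simp add: in_aut_class)
  then show "a = aut_class M f" "f \<in> mp_transf M"
    using h(2) aut_class_eq by (blast, simp add: ae_rel_def)
qed

lemma ae_rel_comp:
  assumes "(f, f') \<in> ae_rel M" "(g, g') \<in> ae_rel M"
  shows "(f \<circ> g, f' \<circ> g') \<in> ae_rel M"
proof -
  have f: "f \<in> mp_transf M" "f' \<in> mp_transf M" "AE x in M. f x = f' x"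
    and g: "g \<in> mp_transf M" "g' \<in> mp_transf M" "AE x in M. g x = g' x"
    using assms by (auto simp: ae_rel_def)
  have gm: "g \<in> measurable M M" "distr M M g = M" using g by (auto simp: mp_transf_def)
  have "AE x in distr M M g. f x = f' x" unfolding gm(2) by (rule f(3))
  then have "AE x in M. f (g x) = f' (g x)" using gm(1) by (rule AE_distrD[rotated])
  then have "AE x in M. f (g x) = f' (g' x)" using g(3) by eventually_elim simp
  then show ?thesis using f g by (simp add: ae_rel_def mp_transf_comp)
qed

lemma aut_class_mult:
  assumes f: "f \<in> mp_transf M" and g: "g \<in> mp_transf M"
  shows "aut_class M f \<otimes>\<^bsub>aut_group M\<^esub> aut_class M g = aut_class M (f \<circ> g)"
proof -
  have "aut_class M f \<otimes>\<^bsub>aut_group M\<^esub> aut_class M g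
      = (\<Union>f'\<in>aut_class M f. \<Union>g'\<in>aut_class M g. aut_class M (f' \<circ> g'))"
    by (simp add: aut_group_def aut_class_def)
  also have "\<dots> = (\<Union>f'\<in>aut_class M f. \<Union>g'\<in>aut_class M g. aut_class M (f \<circ> g))"
  proof (intro SUP_cong refl)
    fix f' g' assume "f' \<in> aut_class M f" "g' \<in> aut_class M g"
    then show "aut_class M (f' \<circ> g') = aut_class M (f \<circ> g)"
      unfolding in_aut_class by (intro aut_class_eq[symmetric] ae_rel_comp)
  qed
  also have "\<dots> = aut_class M (f \<circ> g)"
    using aut_class_self[OF f] aut_class_self[OF g] by blast
  finally show ?thesis .
qed

lemma measure_sym_diff_triangle:
  assumes "finite_measure M" "A \<in> sets M" "B \<in> sets M" "C \<in> sets M"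
  shows "measure M (sym_diff A C) \<le> measure M (sym_diff A B) + measure M (sym_diff B C)"
proof -
  interpret finite_measure M by fact
  have "measure M (sym_diff A C) \<le> measure M (sym_diff A B \<union> sym_diff B C)"
    using assms by (intro finite_measure_mono) auto
  also have "\<dots> \<le> measure M (sym_diff A B) + measure M (sym_diff B C)"
    using assms by (intro measure_Un_le) auto
  finally show ?thesis .
qed

lemma mp_transf_image_measure:
  "f \<in> mp_transf M \<Longrightarrow> A \<in> sets M \<Longrightarrow> measure M (f ` A) = measure M A"
  by (simp add: measure_def mp_transf_image_emeasure)

lemma mp_transf_image_sym_diff:
  assumes "f \<in> mp_transf M" "A \<in> sets M" "B \<in> sets M"
  shows "measure M (sym_diff (f ` A) (f ` B)) = measure M (sym_diff A B)"
proof -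
  have "inj_on f (space M)" using assms(1) by (simp add: mp_transf_def bij_betw_def)
  then have "sym_diff (f ` A) (f ` B) = f ` sym_diff A B"
    using assms(2,3)[THEN sets.sets_into_space] by (auto simp: inj_on_def)
  then show ?thesis using assms by (simp add: mp_transf_image_measure)
qed

text \<open>Continuity at the identity is enough, although the subbase contains all left translates:
  near \<open>g\<close>, write \<open>h\<close> as \<open>g\<close> times a small \<open>k\<close>,
  and use that automorphisms preserve the measure of symmetric differences.\<close>

lemma boolean_actionI:
  assumes TG: "topological_group G T" and M: "finite_measure M"
    and F: "\<And>g. g \<in> carrier G \<Longrightarrow> F g \<in> mp_transf M"
    and mult: "\<And>g h. g \<in> carrier G \<Longrightarrow> h \<in> carrier G \<Longrightarrow> AE x in M. F (g \<otimes>\<^bsub>G\<^esub> h) x = F g (F h x)"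
    and cont: "\<And>A \<epsilon>. A \<in> sets M \<Longrightarrow> \<epsilon> > 0 \<Longrightarrow>
      \<exists>U. openin T U \<and> \<one>\<^bsub>G\<^esub> \<in> U \<and> (\<forall>g\<in>U. measure M (sym_diff A (F g ` A)) < \<epsilon>)"
  shows "boolean_action G T M (\<lambda>g. aut_class M (F g))"
proof -
  interpret G: group G using TG by (simp add: topological_group_def)
  have top: "topspace T = carrier G" using TG by (simp add: topological_group_def)
  have comp: "aut_class M (F (g \<otimes>\<^bsub>G\<^esub> h)) = aut_class M (F g \<circ> F h)"
    if "g \<in> carrier G" "h \<in> carrier G" for g h
    using that F mult by (intro aut_class_eq) (simp add: ae_rel_def mp_transf_comp)
  have "(\<lambda>g. aut_class M (F g)) \<in> hom G (aut_group M)"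
  proof (rule homI)
    show "aut_class M (F (g \<otimes>\<^bsub>G\<^esub> h)) = aut_class M (F g) \<otimes>\<^bsub>aut_group M\<^esub> aut_class M (F h)"
      if "g \<in> carrier G" "h \<in> carrier G" for g h
      using that comp F by (simp add: aut_class_mult)
  qed (use F aut_class_carrier in auto)
  moreover have "continuous_map T (aut_topology M) (\<lambda>g. aut_class M (F g))"
    unfolding aut_topology_def
  proof (rule continuous_on_generated_topo)
    let ?S = "{a <#\<^bsub>aut_group M\<^esub> aut_nbhd M A \<epsilon> | a A \<epsilon>. a \<in> carrier (aut_group M) \<and> A \<in> sets M \<and> \<epsilon> > 0}"
    show "(\<lambda>g. aut_class M (F g)) ` topspace T \<subseteq> \<Union> ?S"
    proof
      fix a assume "a \<in> (\<lambda>g. aut_class M (F g)) ` topspace T"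
      then obtain g where g: "g \<in> carrier G" "a = aut_class M (F g)" using top by auto
      \<comment> \<open>The empty set is fixed by every automorphism, so the left translates of this
        one neighbourhood already cover the group.\<close>
      have "aut_class M id \<in> aut_nbhd M {} 1"
        unfolding aut_nbhd_def using aut_class_carrier[OF id_mp_transf] aut_class_self[OF id_mp_transf] by auto
      then have "a \<in> a <#\<^bsub>aut_group M\<^esub> aut_nbhd M {} 1"
        unfolding l_coset_def using aut_class_mult[OF F[OF g(1)] id_mp_transf] g(2) by auto
      moreover have "a \<in> carrier (aut_group M)" unfolding g(2) by (rule aut_class_carrier[OF F[OF g(1)]])
      then have "a <#\<^bsub>aut_group M\<^esub> aut_nbhd M {} 1 \<in> ?S"
        by (intro CollectI exI[of _ a] exI[of _ "{}"] exI[of _ 1] conjI refl) auto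
      ultimately show "a \<in> \<Union> ?S" by (rule UnionI[rotated])
    qed
    fix S assume "S \<in> ?S"
    then obtain a A \<epsilon> where S: "S = a <#\<^bsub>aut_group M\<^esub> aut_nbhd M A \<epsilon>"
      and a: "a \<in> carrier (aut_group M)" and A: "A \<in> sets M" "\<epsilon> > 0" by blast
    show "openin T ((\<lambda>g. aut_class M (F g)) -` S \<inter> topspace T)"
    proof (subst openin_subopen, intro ballI)
      fix g assume "g \<in> (\<lambda>g. aut_class M (F g)) -` S \<inter> topspace T"
      then have g: "g \<in> carrier G" "aut_class M (F g) \<in> S" using top by auto
      then obtain b where b: "b \<in> aut_nbhd M A \<epsilon>" "aut_class M (F g) = a \<otimes>\<^bsub>aut_group M\<^esub> b"
        unfolding S l_coset_def by blast
      then obtain f where f: "b \<in> carrier (aut_group M)" "f \<in> b" "measure M (sym_diff A (f ` A)) < \<epsilon>"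
        unfolding aut_nbhd_def by blast
      have bf: "b = aut_class M f" "f \<in> mp_transf M" using carrier_aut_class[OF f(1,2)] by auto
      obtain p where p: "p \<in> mp_transf M" "a = aut_class M p"
        using a unfolding aut_group_def aut_class_def by (auto elim: quotientE)
      \<comment> \<open>The slack left by \<open>f\<close>. The class of \<open>F h\<close> will be
        \<open>a\<close> times that of \<open>f \<circ> F k\<close>, and the extra factor
        \<open>F k\<close> adds no more than the measure by which it moves \<open>A\<close>.\<close>
      define r where "r = \<epsilon> - measure M (sym_diff A (f ` A))"
      then have "r > 0" using f(3) by simp
      then obtain U where U: "openin T U" "\<one>\<^bsub>G\<^esub> \<in> U" "\<And>k. k \<in> U \<Longrightarrow> measure M (sym_diff A (F k ` A)) < r"
        using cont[OF A(1), of r] by blast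
      define V where "V = {h \<in> topspace T. inv\<^bsub>G\<^esub> g \<otimes>\<^bsub>G\<^esub> h \<in> U}"
      have "continuous_map T (prod_topology T T) (\<lambda>h. (inv\<^bsub>G\<^esub> g, h))"
        using g(1) top by (simp add: continuous_map_paired)
      then have "continuous_map T T ((\<lambda>(x, y). x \<otimes>\<^bsub>G\<^esub> y) \<circ> (\<lambda>h. (inv\<^bsub>G\<^esub> g, h)))"
        using TG unfolding topological_group_def by (blast intro: continuous_map_compose)
      then have "continuous_map T T (\<lambda>h. inv\<^bsub>G\<^esub> g \<otimes>\<^bsub>G\<^esub> h)" by (simp add: o_def)
      then have "openin T V" unfolding V_def using U(1) by (rule openin_continuous_map_preimage)
      moreover have "g \<in> V" unfolding V_def using g(1) U(2) top by simp
      moreover have "V \<subseteq> (\<lambda>g. aut_class M (F g)) -` S \<inter> topspace T"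
      proof
        fix h assume "h \<in> V"
        then have h: "h \<in> carrier G" "inv\<^bsub>G\<^esub> g \<otimes>\<^bsub>G\<^esub> h \<in> U" using top by (auto simp: V_def)
        define k where "k = inv\<^bsub>G\<^esub> g \<otimes>\<^bsub>G\<^esub> h"
        have k: "k \<in> carrier G" "h = g \<otimes>\<^bsub>G\<^esub> k" "k \<in> U"
          using h g(1) by (simp_all add: k_def G.m_assoc[symmetric])
        have Fk: "F k \<in> mp_transf M" "F g \<in> mp_transf M" using k g F by auto
        have fk: "f \<circ> F k \<in> mp_transf M" using bf(2) Fk(1) by (rule mp_transf_comp)
        have "aut_class M (F g) = aut_class M (p \<circ> f)"
          using b(2) p bf by (simp add: aut_class_mult)
        then have "p \<circ> f \<in> aut_class M (F g)"
          using aut_class_self[OF mp_transf_comp[OF p(1) bf(2)]] by simp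
        then have "(F g, p \<circ> f) \<in> ae_rel M" by (simp only: in_aut_class)
        moreover have "(F k, F k) \<in> ae_rel M" using Fk by (simp add: ae_rel_def)
        ultimately have "aut_class M (F g \<circ> F k) = aut_class M (p \<circ> f \<circ> F k)"
          by (intro aut_class_eq ae_rel_comp)
        then have "aut_class M (F h) = a \<otimes>\<^bsub>aut_group M\<^esub> aut_class M (f \<circ> F k)"
          using comp[OF g(1) k(1)] k(2) p aut_class_mult[OF p(1) fk] by (simp add: o_assoc)
        moreover have "aut_class M (f \<circ> F k) \<in> aut_nbhd M A \<epsilon>"
        proof -
          have im: "f ` A \<in> sets M" "F k ` A \<in> sets M" "f ` F k ` A \<in> sets M"
            using mp_transf_image_sets bf(2) Fk(1) A(1) by blast+
          have "measure M (sym_diff A (f ` F k ` A))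
              \<le> measure M (sym_diff A (f ` A)) + measure M (sym_diff (f ` A) (f ` F k ` A))"
            using M A(1) im by (intro measure_sym_diff_triangle)
          also have "measure M (sym_diff (f ` A) (f ` F k ` A)) = measure M (sym_diff A (F k ` A))"
            using bf(2) A(1) im by (intro mp_transf_image_sym_diff)
          also have "\<dots> < r" using U(3) k(3) .
          finally have "measure M (sym_diff A ((f \<circ> F k) ` A)) < \<epsilon>"
            by (simp add: r_def image_comp)
          then show ?thesis
            unfolding aut_nbhd_def using aut_class_carrier[OF fk] aut_class_self[OF fk] by blast
        qed
        ultimately have "aut_class M (F h) \<in> S" unfolding S l_coset_def by blast
        then show "h \<in> (\<lambda>g. aut_class M (F g)) -` S \<inter> topspace T" using h top by simp
      qed
      ultimately show "\<exists>V. openin T V \<and> g \<in> V \<and> V \<subseteq> (\<lambda>g. aut_class M (F g)) -` S \<inter> topspace T"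
        by blast
    qed
  qed
  ultimately show ?thesis by (simp add: boolean_action_def)
qed

section \<open>Continuity of the flow\<close>

lemma translation_cong:
  "(\<And>i. c i mod modulus i = d i mod modulus i) \<Longrightarrow> translate c x = translate d x"
  unfolding translate_def by (intro ext) (metis mod_add_right_eq)

lemma flow_cong:
  assumes "\<And>i. c i mod modulus i = d i mod modulus i"
  shows "flow c = flow d"
proof -
  have t: "translate c = translate d" using translation_cong[OF assms] by blast
  have "offset k (x + c k) = offset k (x + d k)" for k x
    using offset_add_mod[of k x "c k"] offset_add_mod[of k x "d k"] assms[of k] by simp
  then have "settled c = settled d" by (simp add: settled_def fun_eq_iff)
  then show ?thesis unfolding flow_def fin_flow_def t by (simp only:)
qed

lemma AE_flow_flow:
  assumes "l1_finite c" "l1_finite d"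
  shows "AE x in seq_measure. flow (\<lambda>i. c i + d i) x = flow d (flow c x)"
  using AE_settled[OF assms(1)] AE_settled[OF l1_finite_add[OF assms]]
proof eventually_elim
  case (elim x)
  then obtain J J' where "x \<in> settled c J" "x \<in> settled (\<lambda>i. c i + d i) J'" by blast
  then have "x \<in> settled c (max J J')" "x \<in> settled (\<lambda>i. c i + d i) (max J J')"
    by (auto intro: settled_mono)
  then show ?case by (rule flow_flow[symmetric])
qed

text \<open>The model \<open>lebesgue_on\<close> carries the Lebesgue sigma-algebra, so null sets
  have to be added for a measurable map into it.\<close>

abbreviation seq_completion :: "(nat \<Rightarrow> int) measure" where
  "seq_completion \<equiv> completion seq_measure"

lemma prob_space_seq_completion: "prob_space seq_completion"
  using seq_measure.emeasure_space_1 sets.top[of seq_measure] by (intro prob_spaceI) simp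

interpretation seq_completion: prob_space seq_completion by (rule prob_space_seq_completion)

text \<open>Measurability for the completion needs preimages of null sets to be null, which
  invariance supplies.\<close>

lemma measurable_distr_completion:
  assumes f: "f \<in> measurable M M" and d: "distr M M f = M"
  shows "f \<in> measurable (completion M) (completion M)" "distr (completion M) (completion M) f = completion M"
proof -
  have f': "f \<in> measurable (completion M) M" using f by (rule measurable_completion)
  have d': "distr (completion M) M f = M" using distr_completion[OF f] d by simp
  show "f \<in> measurable (completion M) (completion M)"
    using f' by (rule completion.measurable_completion2) (simp add: d')
  show "distr (completion M) (completion M) f = completion M"
    using completion.completion_distr_eq[OF f'] d' by simp
qed

lemma flow_mp_transf:
  assumes "l1_finite c"
  shows "flow c \<in> mp_transf seq_completion"
proof (rule mp_transfI[where g = "flow (\<lambda>i. - c i)"])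
  have m: "l1_finite (\<lambda>i. - c i)" using assms by (simp add: l1_finite_minus)
  show "flow c \<in> measurable seq_completion seq_completion" "distr seq_completion seq_completion (flow c) = seq_completion" "flow (\<lambda>i. - c i) \<in> measurable seq_completion seq_completion"
    using measurable_distr_completion measurable_flow distr_flow assms m by blast+
  show "flow (\<lambda>i. - c i) (flow c x) = x" if "x \<in> space seq_completion" for x
    using that flow_inverse by simp
  show "flow c (flow (\<lambda>i. - c i) x) = x" if "x \<in> space seq_completion" for x
    using that flow_inverse[of x "\<lambda>i. - c i"] by simp
qed

section \<open>Approximation by finite-level sets\<close>

definition approximable :: "(nat \<Rightarrow> int) set \<Rightarrow> bool" where
  "approximable A \<longleftrightarrow> (\<forall>e>0. \<exists>K B. determined K B \<and> measure seq_measure (sym_diff A B) < e)"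

text \<open>Finite unions follow from subadditivity; continuity from below brings a countable union
  within \<open>e/2\<close> of a finite one.\<close>

lemma approximable_UN:
  fixes A :: "nat \<Rightarrow> (nat \<Rightarrow> int) set"
  assumes A: "\<And>n. A n \<in> sets cyl_algebra" "\<And>n. approximable (A n)"
  shows "approximable (\<Union>n. A n)"
proof -
  have fin: "approximable (\<Union>i<n. A i)" for n
  proof (induction n)
    case 0
    have "determined 0 {}" by (simp add: determined_def)
    then show ?case unfolding approximable_def by (auto intro!: exI[of _ 0] exI[of _ "{}"])
  next
    case (Suc n)
    show ?case unfolding approximable_def
    proof (intro allI impI)
      fix e :: real assume e: "e > 0"
      obtain K B where B: "determined K B" "measure seq_measure (sym_diff (\<Union>i<n. A i) B) < e/2"
        using Suc e unfolding approximable_def by (meson half_gt_zero)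
      obtain K' B' where B': "determined K' B'" "measure seq_measure (sym_diff (A n) B') < e/2"
        using A(2)[of n] e unfolding approximable_def by (meson half_gt_zero)
      have d: "determined (max K K') (B \<union> B')"
        using determined_mono[OF B(1)] determined_mono[OF B'(1)] by (intro determined_Un) auto
      have s: "(\<Union>i<n. A i) \<in> sets cyl_algebra" "B \<in> sets cyl_algebra" "B' \<in> sets cyl_algebra"
        using A(1) determined_sets[OF B(1)] determined_sets[OF B'(1)] by (auto intro: sets.finite_UN)
      have "measure seq_measure (sym_diff (\<Union>i<Suc n. A i) (B \<union> B'))
          \<le> measure seq_measure (sym_diff (\<Union>i<n. A i) B \<union> sym_diff (A n) B')"
        using s A(1) by (intro seq_measure.finite_measure_mono) (auto simp: less_Suc_eq)
      also have "\<dots> \<le> measure seq_measure (sym_diff (\<Union>i<n. A i) B) + measure seq_measure (sym_diff (A n) B')"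
        using s A(1) by (intro measure_Un_le) auto
      finally have "measure seq_measure (sym_diff (\<Union>i<Suc n. A i) (B \<union> B')) < e"
        using B(2) B'(2) by simp
      with d show "\<exists>K B. determined K B \<and> measure seq_measure (sym_diff (\<Union>i<Suc n. A i) B) < e" by blast
    qed
  qed
  have s: "(\<Union>i<n. A i) \<in> sets cyl_algebra" "(\<Union>n. A n) \<in> sets cyl_algebra" for n
    using A(1) by (auto intro: sets.finite_UN)
  show ?thesis unfolding approximable_def
  proof (intro allI impI)
    fix e :: real assume e: "e > 0"
    have "(\<lambda>n. measure seq_measure (\<Union>i<n. A i)) \<longlonglongrightarrow> measure seq_measure (\<Union>n. \<Union>i<n. A i)"
      using s by (intro seq_measure.finite_Lim_measure_incseq incseq_SucI) (auto simp: less_Suc_eq)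
    moreover have "(\<Union>n. \<Union>i<n. A i) = (\<Union>n. A n)" by blast
    ultimately have "(\<lambda>n. measure seq_measure (\<Union>i<n. A i)) \<longlonglongrightarrow> measure seq_measure (\<Union>n. A n)" by simp
    then have "\<forall>\<^sub>F n in sequentially. measure seq_measure (\<Union>n. A n) - e/2 < measure seq_measure (\<Union>i<n. A i)"
      using e by (intro order_tendstoD) auto
    then obtain n where n: "measure seq_measure (\<Union>n. A n) - e/2 < measure seq_measure (\<Union>i<n. A i)"
      by (auto simp: eventually_sequentially)
    obtain K B where B: "determined K B" "measure seq_measure (sym_diff (\<Union>i<n. A i) B) < e/2"
      using fin[of n] e unfolding approximable_def by (meson half_gt_zero)
    have "sym_diff (\<Union>n. A n) (\<Union>i<n. A i) = (\<Union>n. A n) - (\<Union>i<n. A i)" by blast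
    then have "measure seq_measure (sym_diff (\<Union>n. A n) (\<Union>i<n. A i))
        = measure seq_measure (\<Union>n. A n) - measure seq_measure (\<Union>i<n. A i)"
      using s by (subst seq_measure.finite_measure_Diff[symmetric]) auto
    then have "measure seq_measure (sym_diff (\<Union>n. A n) (\<Union>i<n. A i)) < e/2" using n by simp
    moreover have "measure seq_measure (sym_diff (\<Union>n. A n) B)
        \<le> measure seq_measure (sym_diff (\<Union>n. A n) (\<Union>i<n. A i)) + measure seq_measure (sym_diff (\<Union>i<n. A i) B)"
      using s determined_sets[OF B(1)]
      by (intro measure_sym_diff_triangle) (auto simp: seq_measure.finite_measure_axioms)
    ultimately have "measure seq_measure (sym_diff (\<Union>n. A n) B) < e" using B(2) by simp
    with B(1) show "\<exists>K B. determined K B \<and> measure seq_measure (sym_diff (\<Union>n. A n) B) < e" by blast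
  qed
qed

lemma approximable_cyl_algebra:
  assumes "A \<in> sets cyl_algebra"
  shows "approximable A"
  using assms unfolding sets_cyl_algebra
proof (induction rule: sigma_sets.induct)
  case (Basic a)
  then obtain K w where "a = cylinder K w" by blast
  then show ?case unfolding approximable_def using determined_cylinder[of K w] by (auto intro!: exI[of _ K] exI[of _ a])
next
  case Empty
  have "determined 0 {}" by (simp add: determined_def)
  then show ?case unfolding approximable_def by (auto intro!: exI[of _ 0] exI[of _ "{}"])
next
  case (Compl a)
  have a: "a \<subseteq> Seqs" using Compl.hyps sets.sets_into_space[of a cyl_algebra] by (simp add: sets_cyl_algebra)
  show ?case unfolding approximable_def
  proof (intro allI impI)
    fix e :: real assume "e > 0"
    then obtain K B where B: "determined K B" "measure seq_measure (sym_diff a B) < e"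
      using Compl.IH unfolding approximable_def by blast
    have "sym_diff (Seqs - a) (Seqs - B) = sym_diff a B" using a determined_subset[OF B(1)] by blast
    then show "\<exists>K B. determined K B \<and> measure seq_measure (sym_diff (Seqs - a) B) < e"
      using B determined_Diff[OF B(1)] by metis
  qed
next
  case (Union a)
  then show ?case using approximable_UN[of a] by (simp add: sets_cyl_algebra)
qed

text \<open>A set of the completion differs from one of the cylinder algebra by a subset of a null
  set, so the approximation survives completion.\<close>

lemma fin_flow_seq_completion:
  assumes "A \<in> sets seq_completion" "e > 0"
  obtains K B where "determined K B" "measure seq_completion (sym_diff A B) < e"
proof -
  obtain S N N' where A: "A = S \<union> N" "N \<subseteq> N'" "N' \<in> null_sets seq_measure" "S \<in> sets seq_measure"
    using assms(1) by (auto elim: sets_completionE)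
  obtain K B where B: "determined K B" "measure seq_measure (sym_diff S B) < e"
    using approximable_cyl_algebra[of S] A(4) assms(2) unfolding approximable_def by auto
  have Bs: "B \<in> sets seq_measure" using determined_sets[OF B(1)] by simp
  have N: "N' \<in> null_sets seq_completion" using A(3) by (rule null_sets_completionI)
  have "measure seq_completion (sym_diff A B) \<le> measure seq_completion (sym_diff S B \<union> N')"
    using A assms(1) Bs N by (intro seq_completion.finite_measure_mono) auto
  also have "\<dots> = measure seq_completion (sym_diff S B)"
    using A Bs N by (intro measure_Un_null_set) auto
  also have "\<dots> = measure seq_measure (sym_diff S B)" using A Bs by (intro measure_completion) auto
  also have "\<dots> < e" by (rule B(2))
  finally show ?thesis using B(1) that by blast
qed

lemma flow_continuous:
  assumes A: "A \<in> sets seq_completion" and e: "e > 0"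
  obtains r where "r > 0" "\<And>c. l1_finite c \<Longrightarrow> l1_norm c < r \<Longrightarrow> measure seq_completion (sym_diff A (flow c ` A)) < e"
proof -
  obtain K B where B: "determined K B" "measure seq_completion (sym_diff A B) < e/4"
    using fin_flow_seq_completion[OF A, of "e/4"] e by auto
  have Bs: "B \<in> sets seq_completion" using determined_sets[OF B(1)] by simp
  show ?thesis
  proof (rule that)
    \<comment> \<open>The bound \<open>(1/2) ^ K\<close> makes the first \<open>K\<close> residues
      of \<open>c\<close> vanish, so that on \<open>settled c K\<close> the flow respects
      \<open>B\<close>; the bound \<open>e/4\<close> controls the complement of
      \<open>settled c K\<close>. Two further errors below \<open>e/4\<close> come from replacing
      \<open>A\<close> by \<open>B\<close> before and after the flow.\<close>
    show "min ((1/2) ^ K) (e/4) > 0" using e by simp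
    fix c assume c: "l1_finite c" "l1_norm c < min ((1/2) ^ K) (e/4)"
    have mp: "flow c \<in> mp_transf seq_completion" using c(1) by (rule flow_mp_transf)
    have c0: "c i mod modulus i = 0" if "i < K" for i
      using c that by (intro l1_norm_small[of c K]) auto
    have fixB: "flow c x \<in> B \<longleftrightarrow> x \<in> B" if x: "x \<in> settled c K" for x
    proof -
      have xS: "x \<in> Seqs" using x by (simp add: settled_def)
      have "agree K (translate c (straighten K x)) (straighten K x)"
        unfolding agree_def translate_def
      proof (intro allI impI)
        fix i assume "i < K"
        then have "(straighten K x i + c i) mod modulus i = straighten K x i mod modulus i"
          using c0 mod_add_right_eq[of "straighten K x i" "c i" "modulus i"] by simp
        also have "\<dots> = straighten K x i" using xS by (intro SeqsD(1)) simp
        finally show "(straighten K x i + c i) mod modulus i = straighten K x i" .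
      qed
      then have "agree K (unstraighten K (translate c (straighten K x))) (unstraighten K (straighten K x))"
        by (intro agree_unstraighten) auto
      then have "agree K (flow c x) x"
        using x xS by (simp add: flow_settled fin_flow_def unstraighten_straighten)
      then show ?thesis using B(1) xS by (intro detD) auto
    qed
    let ?G = "Seqs - settled c K"
    have G: "?G \<in> sets seq_completion" using sets.Diff[OF sets.top[of cyl_algebra] settled_sets[of c K]] by simp
    have im: "flow c ` B \<in> sets seq_completion" "flow c ` A \<in> sets seq_completion" "flow c ` ?G \<in> sets seq_completion"
      using mp A Bs G mp_transf_image_sets by blast+
    have "sym_diff B (flow c ` B) \<subseteq> flow c ` ?G"
    proof
      fix y assume y: "y \<in> sym_diff B (flow c ` B)"
      then have "y \<in> Seqs" using determined_subset[OF B(1)] by auto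
      then obtain x where x: "x \<in> Seqs" "y = flow c x"
        using flow_bij[of c] by (metis bij_betw_imp_surj_on imageE)
      have "inj_on (flow c) Seqs" using flow_bij by (rule bij_betw_imp_inj_on)
      then have "flow c x \<in> flow c ` B \<longleftrightarrow> x \<in> B"
        using x(1) determined_subset[OF B(1)] by (meson inj_on_image_mem_iff)
      then have "x \<notin> settled c K" using y fixB[of x] x(2) by auto
      then show "y \<in> flow c ` ?G" using x by blast
    qed
    then have "measure seq_completion (sym_diff B (flow c ` B)) \<le> measure seq_completion (flow c ` ?G)"
      using im by (intro seq_completion.finite_measure_mono) auto
    also have "\<dots> = measure seq_completion ?G" using mp G by (rule mp_transf_image_measure)
    also have "\<dots> = measure seq_measure ?G"
      using sets.Diff[OF sets.top[of cyl_algebra] settled_sets[of c K]] by (intro measure_completion) simp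
    also have "\<dots> \<le> (\<Sum>k. coord_norm (k + K) (c (k + K)))" using c(1) by (rule measure_not_settled)
    also have "\<dots> \<le> l1_norm c"
      using c(1) suminf_split_initial_segment[of "\<lambda>i. coord_norm i (c i)" K]
      by (simp add: l1_norm_def l1_finite_def sum_nonneg coord_norm_nonneg)
    finally have 1: "measure seq_completion (sym_diff B (flow c ` B)) < e/4" using c(2) by simp
    have 2: "measure seq_completion (sym_diff (flow c ` B) (flow c ` A)) < e/4"
      using mp_transf_image_sym_diff[OF mp Bs A] B(2) by (simp add: Un_commute)
    have f: "finite_measure seq_completion" by (rule seq_completion.finite_measure_axioms)
    have "measure seq_completion (sym_diff A (flow c ` A))
        \<le> measure seq_completion (sym_diff A B) + measure seq_completion (sym_diff B (flow c ` A))"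
      using f A Bs im by (intro measure_sym_diff_triangle)
    also have "measure seq_completion (sym_diff B (flow c ` A))
        \<le> measure seq_completion (sym_diff B (flow c ` B)) + measure seq_completion (sym_diff (flow c ` B) (flow c ` A))"
      using f A Bs im by (intro measure_sym_diff_triangle)
    finally show "measure seq_completion (sym_diff A (flow c ` A)) < e" using 1 2 B(2) e by simp
  qed
qed

section \<open>Whirliness\<close>

definition spike :: "nat \<Rightarrow> int \<Rightarrow> nat \<Rightarrow> int" where
  "spike j t = (\<lambda>i. if i = j then t else 0)"

lemma coord_norm_spike_sums: "(\<lambda>i. coord_norm i (spike j t i)) sums coord_norm j t"
proof -
  have "(\<lambda>i. coord_norm i (spike j t i)) = (\<lambda>i. if i = j then coord_norm i t else 0)"
    by (auto simp: spike_def)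
  then show ?thesis using sums_single[of j "\<lambda>i. coord_norm i t"] by simp
qed

lemma l1_finite_spike: "l1_finite (spike j t)"
  unfolding l1_finite_def using coord_norm_spike_sums by (rule sums_summable)

lemma l1_norm_spike: "l1_norm (spike j t) = coord_norm j t"
  unfolding l1_norm_def using coord_norm_spike_sums by (rule sums_unique[symmetric])

text \<open>Beyond \<open>j\<close> a spike changes no offset, so every point is settled at level
  \<open>Suc j\<close> and the counts below have no exceptional set.\<close>

lemma flow_spike: "x \<in> Seqs \<Longrightarrow> flow (spike j t) x = fin_flow (Suc j) (spike j t) x"
  by (rule flow_settled) (simp add: settled_def spike_def)

text \<open>In straightened coordinates the spike adds one and the same integer, the difference of
  the offsets at \<open>y + t\<close> and \<open>y\<close>, to all coordinates below
  \<open>j\<close>. Modulo their moduli it acts like \<open>n\<close>, which carries the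
  straightened \<open>r\<close> to the straightened \<open>s\<close>.\<close>

lemma agree_fin_flow_spike:
  assumes r: "r \<in> Seqs" and s: "s \<in> Seqs" and y: "0 \<le> y" "y < modulus j"
    and n: "\<And>i. i < j \<Longrightarrow> (straighten j r i + n) mod modulus i = straighten j s i mod modulus i"
    and jump: "(offset j (y + t) - offset j y) mod height j = n mod height j"
  shows "agree j (fin_flow (Suc j) (spike j t) (r(j := y))) s"
proof -
  let ?x = "r(j := y)" and ?c = "spike j t"
  let ?z = "straighten j ?x"
  have x: "?x \<in> Seqs" using r y by (auto simp: Seqs_def)
  have z: "?z i = straighten j r i" if "i < j" for i
  proof -
    have "agree j ?x r" by (simp add: agree_def)
    then have "agree j ?z (straighten j r)" by (intro agree_straighten) auto
    then show ?thesis using that by (simp add: agree_def)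
  qed
  have zj: "?z j = y" by (simp add: straighten_ge)
  have "agree j (unshear j (translate ?c (shear j ?z))) (straighten j s)"
    unfolding agree_def
  proof (intro allI impI)
    fix i assume i: "i < j"
    have "unshear j (translate ?c (shear j ?z)) i
        = (((?z i - offset j y) mod modulus i + 0) mod modulus i + offset j ((y + t) mod modulus j)) mod modulus i"
      using i zj by (simp add: unshear_def translate_def shear_def spike_def)
    also have "\<dots> = (straighten j r i + (offset j (y + t) - offset j y)) mod modulus i"
      using z[OF i] by (simp add: offset_mod mod_simps algebra_simps)
    also have "\<dots> = (straighten j r i + n) mod modulus i"
    proof (rule mod_add_cong[OF refl])
      have "modulus i dvd height j" using i by (rule modulus_dvd_height)
      then show "(offset j (y + t) - offset j y) mod modulus i = n mod modulus i"
        using jump by (metis mod_mod_cancel)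
    qed
    also have "\<dots> = straighten j s i" using n[OF i] s by (simp add: SeqsD)
    finally show "unshear j (translate ?c (shear j ?z)) i = straighten j s i" .
  qed
  then have "agree j (unstraighten j (unshear j (translate ?c (shear j ?z)))) (unstraighten j (straighten j s))"
    by (intro agree_unstraighten) auto
  then show ?thesis using s by (simp add: fin_flow_def unstraighten_straighten)
qed

text \<open>A one-sided form of the weak limit that keeps only the averaging part, with the constant
  1/4. One factor 2 pays for \<open>2 ^ j - 1\<close> against \<open>2 ^ j\<close>, whence
  \<open>j \<ge> 1\<close>; the other pays for \<open>(block j)\<^sup>2 + 1\<close> against
  \<open>(block j)\<^sup>2\<close>.\<close>

lemma measure_flow_spike:
  assumes A: "determined j A" and B: "determined j B" and t: "0 \<le> t" "t \<le> block j" and j: "j \<ge> 1"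
  shows "t / (4 * block j) * (measure seq_measure A * measure seq_measure B)
      \<le> measure seq_measure (B \<inter> (flow (spike j t) -` A \<inter> Seqs))"
proof -
  let ?F = "fin_flow (Suc j) (spike j t)"
  let ?S = "B \<inter> (flow (spike j t) -` A \<inter> Seqs)"
  have S: "?S = B \<inter> (?F -` A \<inter> Seqs)" using flow_spike by auto
  have "determined (Suc j) B" "determined (Suc j) (?F -` A \<inter> Seqs)"
    using determined_mono[OF B] determined_fin_flow[OF A, of "Suc j"] by (auto simp: max_def)
  then have dS: "determined (Suc j) ?S" unfolding S determined_def by blast
  define NA NB where "NA = card {r \<in> reps j. r \<in> A}" and "NB = card {r \<in> reps j. r \<in> B}"
  define q where "q = t * (2 ^ j - 1)"
  \<comment> \<open>For a fixed prefix \<open>r\<close> in \<open>B\<close>, each target prefix in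
    \<open>A\<close> is reached from at least \<open>q\<close> values of coordinate
    \<open>j\<close>, and different targets from different values.\<close>
  have col: "int NA * q \<le> card {y \<in> {0..<modulus j}. r(j := y) \<in> ?S}" if r: "r \<in> reps j" "r \<in> B" for r
  proof -
    have rS: "r \<in> Seqs" using r(1) by (rule reps_Seqs)
    let ?Y = "\<lambda>s. {y \<in> {0..<modulus j}. agree j (?F (r(j := y))) s}"
    have q: "q \<le> card (?Y s)" if s: "s \<in> reps j" for s
    proof -
      \<comment> \<open>One integer realises the required displacement in all coordinates below
        \<open>j\<close> simultaneously.\<close>
      obtain n where n: "\<And>i. i < j \<Longrightarrow> n mod modulus i = (straighten j s i - straighten j r i) mod modulus i"
        using crt_modulus[of j "\<lambda>i. straighten j s i - straighten j r i"] by blast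
      have n': "(straighten j r i + n) mod modulus i = straighten j s i mod modulus i" if "i < j" for i
        using mod_add_cong[OF refl n[OF that], of "straighten j r i"] by simp
      have "{y \<in> {0..<modulus j}. (offset j (y + t) - offset j y) mod height j = n mod height j} \<subseteq> ?Y s"
        using agree_fin_flow_spike[OF rS reps_Seqs[OF s] _ _ n'] by auto
      then have "card {y \<in> {0..<modulus j}. (offset j (y + t) - offset j y) mod height j = n mod height j} \<le> card (?Y s)"
        by (intro card_mono finite_int_range_Collect)
      then show ?thesis using card_uniform_jumps[OF t, of n] by (simp add: q_def)
    qed
    have "int NA * q \<le> (\<Sum>s\<in>{s \<in> reps j. s \<in> A}. int (card (?Y s)))"
      unfolding NA_def using q by (intro sum_bounded_below) auto
    also have "\<dots> = int (card (\<Union>s\<in>{s \<in> reps j. s \<in> A}. ?Y s))"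
    proof -
      have "s = s'" if "s \<in> reps j" "s' \<in> reps j" "y \<in> ?Y s" "y \<in> ?Y s'" for s s' y
        using that reps_agree_eq[of s j s'] agree_tr[of j s "?F (r(j := y))" s']
        by (auto simp: agree_sym[of j _ s])
      then have "\<forall>s\<in>{s \<in> reps j. s \<in> A}. \<forall>s'\<in>{s \<in> reps j. s \<in> A}. s \<noteq> s' \<longrightarrow> ?Y s \<inter> ?Y s' = {}"
        by blast
      then show ?thesis
        unfolding of_nat_sum[symmetric]
        by (subst card_UN_disjoint) (simp_all only: finite_int_range_Collect finite_Collect_conjI finite_reps
          Collect_mem_eq disj_commute simp_thms ball_simps)
    qed
    also have "\<dots> \<le> int (card {y \<in> {0..<modulus j}. r(j := y) \<in> ?S})"
    proof -
      have "(\<Union>s\<in>{s \<in> reps j. s \<in> A}. ?Y s) \<subseteq> {y \<in> {0..<modulus j}. r(j := y) \<in> ?S}"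
      proof
        fix y assume "y \<in> (\<Union>s\<in>{s \<in> reps j. s \<in> A}. ?Y s)"
        then obtain s where s: "s \<in> reps j" "s \<in> A" "0 \<le> y" "y < modulus j" "agree j (?F (r(j := y))) s"
          by auto
        have x: "r(j := y) \<in> Seqs" using rS s by (auto simp: Seqs_def)
        have "r(j := y) \<in> B" using detD[OF B x rS] r(2) by (simp add: agree_def)
        moreover have "?F (r(j := y)) \<in> A"
          using detD[OF A fin_flow_Seqs[OF x] reps_Seqs[OF s(1)] s(5)] s(2) by blast
        ultimately show "y \<in> {y \<in> {0..<modulus j}. r(j := y) \<in> ?S}" unfolding S using x s by simp
      qed
      then show ?thesis unfolding of_nat_le_iff by (rule card_mono[OF finite_int_range_Collect])
    qed
    finally show ?thesis .
  qed
  have "int NB * (int NA * q) \<le> (\<Sum>r\<in>{r \<in> reps j. r \<in> B}. int (card {y \<in> {0..<modulus j}. r(j := y) \<in> ?S}))"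
    unfolding NB_def using col by (intro sum_bounded_below) auto
  also have "\<dots> \<le> (\<Sum>r\<in>reps j. int (card {y \<in> {0..<modulus j}. r(j := y) \<in> ?S}))"
    by (intro sum_mono2) auto
  also have "\<dots> = int (card {x \<in> reps (Suc j). x \<in> ?S})" by (subst card_reps_Suc) simp
  finally have "real_of_int (int NB * (int NA * q)) \<le> real_of_int (int (card {x \<in> reps (Suc j). x \<in> ?S}))"
    by (rule of_int_le_iff[THEN iffD2])
  then have count: "real NB * (real NA * real_of_int q) \<le> card {x \<in> reps (Suc j). x \<in> ?S}" by simp
  define h m where "h = real_of_int (height j)" and "m = real_of_int (block j)"
  have h: "h > 0" by (simp add: h_def height_pos)
  have m: "m \<ge> 1" "m = 2 ^ j * h"
  proof -
    show "m \<ge> 1" using block_pos[of j] unfolding m_def by linarith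
    show "m = 2 ^ j * h" by (simp add: m_def h_def block_def)
  qed
  have p: "(2::real) ^ j \<ge> 2" using j power_increasing[of 1 j "2::real"] by simp
  have "t / (4 * m) * (h * (m\<^sup>2 + 1)) \<le> h * (t * m / 2)"
  proof -
    have "m * m \<ge> 1 * 1" using m by (intro mult_mono) auto
    then have "m\<^sup>2 + 1 \<le> 2 * m * m" by (simp add: power2_eq_square)
    then have "t * (m\<^sup>2 + 1) \<le> t * (2 * m * m)" using t by (intro mult_left_mono) auto
    then have "t * (m\<^sup>2 + 1) / (4 * m) \<le> t * m / 2" using m by (simp add: field_simps)
    then have "h * (t * (m\<^sup>2 + 1) / (4 * m)) \<le> h * (t * m / 2)" using h by (intro mult_left_mono) auto
    then show ?thesis by (simp add: mult_ac)
  qed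
  also have "\<dots> \<le> h * (h * (t * (2 ^ j - 1)))"
  proof -
    have "h * (2 ^ j / 2) \<le> h * (2 ^ j - 1)" using p h by (intro mult_left_mono) auto
    moreover have "m / 2 = h * (2 ^ j / 2)" using m(2) by simp
    ultimately have "m / 2 \<le> h * (2 ^ j - 1)" by (simp only:)
    then have "t * (m / 2) \<le> t * (h * (2 ^ j - 1))" using t by (intro mult_left_mono) auto
    then show ?thesis using h by (simp add: mult_ac)
  qed
  finally have key: "t / (4 * m) * (h * (m\<^sup>2 + 1)) \<le> h * (h * real_of_int q)" by (simp add: q_def)
  have hS: "real_of_int (height (Suc j)) = h * (m\<^sup>2 + 1)" by (simp add: h_def m_def height_Suc modulus_def)
  have pos: "h * (m\<^sup>2 + 1) > 0" using h by (intro mult_pos_pos) (auto simp: add_nonneg_pos)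
  have mA: "measure seq_measure A = NA / h" "measure seq_measure B = NB / h"
    using measure_determined[OF A] measure_determined[OF B] by (simp_all add: NA_def NB_def h_def)
  have "t / (4 * m) * (measure seq_measure A * measure seq_measure B) * (h * (m\<^sup>2 + 1))
      = (t / (4 * m) * (h * (m\<^sup>2 + 1))) * (real NA * real NB / (h * h))"
    unfolding mA by simp
  also have "\<dots> \<le> (h * (h * real_of_int q)) * (real NA * real NB / (h * h))"
    using key h by (intro mult_right_mono) auto
  also have "\<dots> = real NB * (real NA * real_of_int q)" using h by simp
  also have "\<dots> \<le> card {x \<in> reps (Suc j). x \<in> ?S}" by (rule count)
  also have "\<dots> = measure seq_measure ?S * (h * (m\<^sup>2 + 1))"
    unfolding measure_determined[OF dS] hS
    using nonzero_eq_divide_eq[THEN iffD1, OF less_imp_neq[OF pos, symmetric] refl] by (rule sym)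
  finally have "t / (4 * m) * (measure seq_measure A * measure seq_measure B) \<le> measure seq_measure ?S"
    using pos by (rule mult_right_le_imp_le)
  then show ?thesis by (simp add: m_def)
qed

lemma flow_whirly:
  assumes A: "A \<in> sets seq_completion" "measure seq_completion A > 0" and B: "B \<in> sets seq_completion" "measure seq_completion B > 0" and d: "d > 0"
  obtains c where "c \<in> Seqs" "l1_finite c" "l1_norm c < d" "measure seq_completion (A \<inter> flow c ` B) > 0"
proof -
  let ?a = "measure seq_completion A" and ?b = "measure seq_completion B"
  \<comment> \<open>The intended value of \<open>t / block j\<close>. It depends on \<open>d\<close>
    alone, so that \<open>e\<close> can be fixed before the level \<open>j\<close>; the norm of the
    spike will be at most \<open>2 * \<rho> + 3 * (1/2) ^ j\<close>.\<close>
  define \<rho> where "\<rho> = min d 1 / 8"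
  have \<rho>: "0 < \<rho>" "\<rho> \<le> 1/8" "8 * \<rho> \<le> d" using d by (auto simp: \<rho>_def)
  \<comment> \<open>Passing to finite-level sets at most halves the two measures, so
    \<open>measure_flow_spike\<close> gives at least
    \<open>\<rho> / 4 * (?a / 2) * (?b / 2)\<close>, which is \<open>4 * e\<close>; returning to
    \<open>A\<close> and \<open>B\<close> costs less than \<open>2 * e\<close>.\<close>
  define e where "e = \<rho> / 4 * ?a * ?b / 16"
  have e: "e > 0" using A B \<rho> by (simp add: e_def)
  have ab: "?a \<le> 1" "?b \<le> 1" by (rule seq_completion.prob_le_1)+
  obtain K A' where A': "determined K A'" "measure seq_completion (sym_diff A A') < e" using fin_flow_seq_completion[OF A(1) e] by blast
  obtain K' B' where B': "determined K' B'" "measure seq_completion (sym_diff B B') < e" using fin_flow_seq_completion[OF B(1) e] by blast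
  \<comment> \<open>Then \<open>3 * (1/2) ^ j\<close> is below \<open>d/2\<close>, which the norm
    estimate needs, and below 1/2, which gives \<open>t \<le> block j\<close>.\<close>
  have "\<forall>\<^sub>F j in sequentially. (1/2::real) ^ j < min (d/6) (1/6)"
    using d by (intro order_tendstoD(2)[OF LIMSEQ_power_zero]) auto
  then obtain J where J: "\<And>j. j \<ge> J \<Longrightarrow> (1/2::real) ^ j < min (d/6) (1/6)"
    by (auto simp: eventually_sequentially)
  define j where "j = Max {J, K, K', 1}"
  have j: "j \<ge> J" "j \<ge> K" "j \<ge> K'" "j \<ge> 1" by (auto simp: j_def)
  define m where "m = real_of_int (block j)"
  have m: "m > 0" "1 / m \<le> (1/2) ^ j"
  proof -
    show "m > 0" by (simp add: m_def block_pos)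
    have "(1::int) \<le> height j" using height_pos[of j] by simp
    then have "2 ^ j * 1 \<le> m" unfolding m_def block_def of_int_mult by (intro mult_mono) auto
    then show "1 / m \<le> (1/2) ^ j" using \<open>m > 0\<close> by (simp add: field_simps power_one_over)
  qed
  \<comment> \<open>Rounding up preserves the lower bound \<open>\<rho>\<close> for
    \<open>t / m\<close> and exceeds it by at most \<open>1 / m\<close>.\<close>
  define t where "t = \<lceil>\<rho> * m\<rceil>"
  have "0 < \<rho> * m" using \<rho>(1) m(1) by (rule mult_pos_pos)
  then have t: "0 \<le> t" "\<rho> * m \<le> t" "t \<le> \<rho> * m + 1"
    unfolding t_def by linarith+
  have tm: "t / m \<le> \<rho> + (1/2) ^ j"
  proof -
    have "t / m \<le> (\<rho> * m + 1) / m" using t(3) m(1) by (intro divide_right_mono) auto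
    also have "\<dots> = \<rho> + 1 / m" using m(1) by (simp add: field_simps)
    finally show ?thesis using m(2) by simp
  qed
  have Jj: "3 * (1/2::real) ^ j < d/2" "3 * (1/2::real) ^ j < 1/2" using J[OF j(1)] by linarith+
  have "t / m \<le> 1" using tm Jj \<rho> by linarith
  then have tblk: "t \<le> block j" using m(1) by (simp add: m_def field_simps)
  let ?c = "spike j t"
  have nc: "l1_norm ?c < d"
  proof -
    have "l1_norm ?c \<le> 2 * t / m + (1/2) ^ j" unfolding l1_norm_spike m_def using coord_norm_le[OF t(1)] by simp
    also have "\<dots> = 2 * (t / m) + (1/2) ^ j" by simp
    finally show ?thesis using tm Jj \<rho> by linarith
  qed
  have mp: "flow ?c \<in> mp_transf seq_completion" using l1_finite_spike by (rule flow_mp_transf)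
  have fm: "flow ?c \<in> measurable seq_completion seq_completion" and fd: "distr seq_completion seq_completion (flow ?c) = seq_completion"
    using mp by (auto simp: mp_transf_def)
  have sets': "A' \<in> sets seq_measure" "B' \<in> sets seq_measure" using determined_sets A' B' by auto
  then have sNC: "A' \<in> sets seq_completion" "B' \<in> sets seq_completion" by auto
  have le: "measure seq_completion X \<le> measure seq_completion Y + measure seq_completion (sym_diff X Y)"
    if "X \<in> sets seq_completion" "Y \<in> sets seq_completion" for X Y
  proof -
    have "measure seq_completion X \<le> measure seq_completion (Y \<union> sym_diff X Y)"
      using that by (intro seq_completion.finite_measure_mono) auto
    also have "\<dots> \<le> measure seq_completion Y + measure seq_completion (sym_diff X Y)"
      using that by (intro measure_Un_le) auto
    finally show ?thesis .
  qed
  have small: "e \<le> ?a / 2" "e \<le> ?b / 2"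
  proof -
    have "\<rho> / 4 * ?a * ?b \<le> 1 * ?a * 1" "\<rho> / 4 * ?a * ?b \<le> 1 * 1 * ?b"
      using \<rho> ab A(2) B(2) by (intro mult_mono; simp add: mult_le_one)+
    then show "e \<le> ?a / 2" "e \<le> ?b / 2" using A(2) B(2) by (simp_all add: e_def)
  qed
  have "?a / 2 \<le> measure seq_completion A'" "?b / 2 \<le> measure seq_completion B'"
    using le[OF A(1) sNC(1)] le[OF B(1) sNC(2)] A'(2) B'(2) small by linarith+
  then have prod: "(?a / 2) * (?b / 2) \<le> measure seq_measure A' * measure seq_measure B'"
    using sets' A(2) B(2) by (intro mult_mono) auto
  have "\<rho> / 4 * (?a * ?b / 4) \<le> t / (4 * m) * (measure seq_measure A' * measure seq_measure B')"
  proof (rule mult_mono)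
    show "\<rho> / 4 \<le> t / (4 * m)" using t(2) m(1) by (simp add: field_simps)
    show "?a * ?b / 4 \<le> measure seq_measure A' * measure seq_measure B'" using prod by simp
  qed (use t m in auto)
  also have "\<dots> \<le> measure seq_measure (B' \<inter> (flow ?c -` A' \<inter> Seqs))"
    unfolding m_def
    using measure_flow_spike[OF determined_mono[OF A'(1) j(2)] determined_mono[OF B'(1) j(3)] t(1) tblk j(4)]
    by simp
  also have "\<dots> = measure seq_completion (B' \<inter> (flow ?c -` A' \<inter> Seqs))"
    using sets' measurable_sets[OF measurable_flow, of A' ?c] by (intro measure_completion[symmetric]) auto
  finally have lower: "4 * e \<le> measure seq_completion (B' \<inter> (flow ?c -` A' \<inter> Seqs))" by (simp add: e_def)
  \<comment> \<open>The counting lemma bounds a preimage, whereas whirliness concerns images; the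
    flow carries \<open>R\<close> into the desired intersection and preserves its measure.\<close>
  define R where "R = B \<inter> (flow ?c -` A \<inter> Seqs)"
  have vim: "flow ?c -` X \<inter> Seqs \<in> sets seq_completion" if "X \<in> sets seq_completion" for X
    using measurable_sets[OF fm that] by simp
  have R: "R \<in> sets seq_completion" unfolding R_def using B(1) vim[OF A(1)] by auto
  have "measure seq_completion (B' \<inter> (flow ?c -` A' \<inter> Seqs))
      \<le> measure seq_completion (R \<union> (sym_diff B B' \<union> (flow ?c -` sym_diff A A' \<inter> Seqs)))"
    using R A(1) B(1) sNC vim[of "sym_diff A A'"] by (intro seq_completion.finite_measure_mono) (auto simp: R_def)
  also have "\<dots> \<le> measure seq_completion R + measure seq_completion (sym_diff B B' \<union> (flow ?c -` sym_diff A A' \<inter> Seqs))"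
    using R A(1) B(1) sNC vim[of "sym_diff A A'"] by (intro measure_Un_le) auto
  also have "measure seq_completion (sym_diff B B' \<union> (flow ?c -` sym_diff A A' \<inter> Seqs))
      \<le> measure seq_completion (sym_diff B B') + measure seq_completion (flow ?c -` sym_diff A A' \<inter> Seqs)"
    using A(1) B(1) sNC vim[of "sym_diff A A'"] by (intro measure_Un_le) auto
  also have "measure seq_completion (flow ?c -` sym_diff A A' \<inter> Seqs) = measure seq_completion (sym_diff A A')"
    using measure_distr[OF fm, of "sym_diff A A'"] A(1) sNC by (simp add: fd)
  finally have "0 < measure seq_completion R" using lower e A'(2) B'(2) by linarith
  moreover have "flow ?c ` R \<subseteq> A \<inter> flow ?c ` B" by (auto simp: R_def)
  then have "measure seq_completion (flow ?c ` R) \<le> measure seq_completion (A \<inter> flow ?c ` B)"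
    using mp_transf_image_sets[OF mp] R A(1) B(1) by (intro seq_completion.finite_measure_mono) auto
  moreover have "measure seq_completion (flow ?c ` R) = measure seq_completion R" using mp R by (rule mp_transf_image_measure)
  ultimately have pos: "0 < measure seq_completion (A \<inter> flow ?c ` B)" by linarith
  have "t < modulus j"
  proof -
    have "block j * 1 \<le> block j * block j" using block_pos[of j] by (intro mult_left_mono) auto
    then show ?thesis using tblk by (simp add: modulus_def power2_eq_square)
  qed
  then have "?c \<in> Seqs" using t(1) by (simp add: spike_def Seqs_def)
  then show ?thesis using l1_finite_spike nc pos by (rule that)
qed

section \<open>Isomorphism with the unit interval\<close>

lemma complete_measure_unit_lebesgue: "complete_measure unit_lebesgue"
proof
  fix A B :: "real set" assume "A \<subseteq> B" "B \<in> null_sets unit_lebesgue"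
  then show "A \<in> sets unit_lebesgue"
    by (auto simp: null_sets_restrict_space sets_restrict_space_iff intro: completion.complete)
qed

lemma digits_completion: "digits \<in> measurable unit_lebesgue seq_completion" "distr unit_lebesgue seq_completion digits = seq_completion"
proof -
  interpret complete_measure unit_lebesgue by (rule complete_measure_unit_lebesgue)
  have m: "digits \<in> measurable unit_lebesgue seq_measure" using measurable_digits by (simp cong: measurable_cong_sets)
  have d: "distr unit_lebesgue seq_measure digits = seq_measure" unfolding seq_measure_def by (rule distr_cong) auto
  show "digits \<in> measurable unit_lebesgue seq_completion" using m by (rule measurable_completion2) (simp add: d)
  show "distr unit_lebesgue seq_completion digits = seq_completion" using completion_distr_eq[OF m] d by simp
qed

text \<open>A left inverse of \<open>digits\<close> on \<open>{0..<1}\<close>. The clipping keeps the junk values of \<open>lim\<close> in the unit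
  interval.\<close>

definition seq_value :: "(nat \<Rightarrow> int) \<Rightarrow> real" where
  "seq_value x = max 0 (min 1 (lim (\<lambda>K. prefix_code K x / height K)))"

lemma seq_value_digits:
  assumes "0 \<le> t" "t < 1"
  shows "seq_value (digits t) = t"
proof -
  have k: "prefix_code K (digits t) = \<lfloor>t * height K\<rfloor>" for K
    using agree_digits_iff[OF digits_Seqs assms, of K t] by (simp add: agree_def)
  have "(\<lambda>K. prefix_code K (digits t) / height K) \<longlonglongrightarrow> t"
  proof (rule tendsto_sandwich)
    have h: "real_of_int (height K) \<ge> 2 ^ K" for K
    proof (induction K)
      case (Suc K)
      have "2 ^ K * 2 \<le> real_of_int (height K) * real_of_int (modulus K)"
        using Suc modulus_ge2[of K] height_pos[of K] by (intro mult_mono) auto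
      then show ?case by (simp add: height_Suc mult.commute)
    qed simp
    show "\<forall>\<^sub>F K in sequentially. t - (1/2) ^ K \<le> prefix_code K (digits t) / height K"
    proof (intro always_eventually allI)
      fix K
      have hp: "real_of_int (height K) > 0" by (simp add: height_pos)
      have "1 / height K \<le> 1 / (2::real) ^ K" using h[of K] by (intro divide_left_mono mult_pos_pos hp) auto
      moreover have "(t * height K - 1) / height K \<le> \<lfloor>t * height K\<rfloor> / height K"
        using hp by (intro divide_right_mono) linarith+
      moreover have "(t * height K - 1) / height K = t - 1 / height K" using hp by (simp add: field_simps)
      ultimately show "t - (1/2) ^ K \<le> prefix_code K (digits t) / height K"
        by (simp add: k power_one_over)
    qed
    show "\<forall>\<^sub>F K in sequentially. prefix_code K (digits t) / height K \<le> t"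
    proof (intro always_eventually allI)
      fix K
      have hp: "real_of_int (height K) > 0" by (simp add: height_pos)
      have "\<lfloor>t * height K\<rfloor> / height K \<le> (t * height K) / height K"
        using hp by (intro divide_right_mono) auto
      then show "prefix_code K (digits t) / height K \<le> t" using hp by (simp add: k)
    qed
    have "(\<lambda>K. t - (1/2) ^ K) \<longlonglongrightarrow> t - 0"
      by (intro tendsto_diff tendsto_const LIMSEQ_power_zero) auto
    then show "(\<lambda>K. t - (1/2) ^ K) \<longlonglongrightarrow> t" by simp
  qed auto
  then have "lim (\<lambda>K. prefix_code K (digits t) / height K) = t" by (rule limI)
  then show ?thesis using assms by (simp add: seq_value_def)
qed

lemma AE_seq_value_digits: "AE t in unit_lebesgue. seq_value (digits t) = t"
proof -
  have "{1} \<in> null_sets unit_lebesgue" by (simp add: null_sets_restrict_space)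
  then have "AE t in unit_lebesgue. t \<notin> {1}" by (rule AE_not_in)
  then show ?thesis
    by (rule AE_mp, intro AE_I2) (auto simp: seq_value_digits)
qed

lemma measurable_seq_value_borel: "seq_value \<in> borel_measurable seq_measure"
proof -
  have coord: "(\<lambda>x. x i) \<in> measurable seq_measure (count_space UNIV)" for i
  proof -
    have "(\<lambda>x. x i) -` {v} \<inter> Seqs \<in> sets cyl_algebra" for v :: int
      by (rule determined_sets[of "Suc i"]) (auto simp: determined_def agree_def)
    then show ?thesis by (subst measurable_count_space_eq_countable) auto
  qed
  have k: "(\<lambda>x. real_of_int (prefix_code K x)) \<in> borel_measurable seq_measure" for K
  proof (induction K)
    case (Suc K)
    have "(\<lambda>x. real_of_int (x K)) \<in> borel_measurable seq_measure"
      using coord by (rule measurable_compose) simp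
    with Suc show ?case by simp
  qed simp
  show ?thesis unfolding seq_value_def using k by measurable
qed

lemma seq_value_completion: "seq_value \<in> measurable seq_completion unit_lebesgue" "distr seq_completion unit_lebesgue seq_value = unit_lebesgue"
proof -
  have m: "seq_value \<in> measurable seq_completion lborel"
    using measurable_seq_value_borel by (simp add: measurable_completion)
  have vv: "AE t in unit_lebesgue. seq_value (digits t) = t" by (rule AE_seq_value_digits)
  \<comment> \<open>Borel measurability extends to Lebesgue sets once preimages of null sets are
    null. This is computed on the interval, since \<open>seq_value\<close> after
    \<open>digits\<close> is the identity almost everywhere.\<close>
  have null: "Z \<in> null_sets (distr seq_completion lborel seq_value)" if Z: "Z \<in> null_sets lborel" for Z
  proof -
    have "emeasure (distr seq_completion lborel seq_value) Z = emeasure seq_completion (seq_value -` Z \<inter> Seqs)"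
      using Z m by (subst emeasure_distr) auto
    also have "\<dots> = emeasure (distr unit_lebesgue seq_completion digits) (seq_value -` Z \<inter> Seqs)"
      by (simp only: digits_completion(2))
    also have "\<dots> = emeasure unit_lebesgue (digits -` (seq_value -` Z \<inter> Seqs) \<inter> space unit_lebesgue)"
      using measurable_sets[OF m, of Z] Z by (intro emeasure_distr digits_completion(1)) auto
    also have "\<dots> = emeasure unit_lebesgue (Z \<inter> space unit_lebesgue)"
    proof (rule emeasure_eq_AE)
      show "AE t in unit_lebesgue. t \<in> digits -` (seq_value -` Z \<inter> Seqs) \<inter> space unit_lebesgue \<longleftrightarrow> t \<in> Z \<inter> space unit_lebesgue"
        using vv by eventually_elim auto
      show "digits -` (seq_value -` Z \<inter> Seqs) \<inter> space unit_lebesgue \<in> sets unit_lebesgue"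
        using measurable_sets[OF m, of Z] Z by (intro measurable_sets[OF digits_completion(1)]) auto
      show "Z \<inter> space unit_lebesgue \<in> sets unit_lebesgue" using Z by (auto simp: sets_restrict_space)
    qed
    also have "\<dots> = emeasure lebesgue (Z \<inter> {0..1})"
      by (subst emeasure_restrict_space) auto
    also have "\<dots> = 0"
      using Z null_sets_completionI[OF Z] null_set_Int2[of "Z" lebesgue "{0..1}"] by (simp add: null_setsD1 Int_commute)
    finally show ?thesis using Z by (intro null_setsI) auto
  qed
  have "seq_value \<in> measurable seq_completion lebesgue"
    using m null by (intro completion.measurable_completion2) auto
  then show meas: "seq_value \<in> measurable seq_completion unit_lebesgue"
    by (rule measurable_restrict_space2[rotated]) (auto simp: seq_value_def)
  have "distr seq_completion unit_lebesgue seq_value = distr (distr unit_lebesgue seq_completion digits) unit_lebesgue seq_value"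
    by (simp only: digits_completion(2))
  also have "\<dots> = distr unit_lebesgue unit_lebesgue (seq_value \<circ> digits)"
    using meas digits_completion(1) by (rule distr_distr)
  also have "\<dots> = distr unit_lebesgue unit_lebesgue (\<lambda>t. t)"
    using vv measurable_comp[OF digits_completion(1) meas] by (intro distr_cong_AE) auto
  also have "\<dots> = unit_lebesgue" by (rule distr_id)
  finally show "distr seq_completion unit_lebesgue seq_value = unit_lebesgue" .
qed

lemma AE_digits_seq_value: "AE x in seq_completion. digits (seq_value x) = x"
proof -
  let ?P = "{x \<in> Seqs. digits (seq_value x) = x}"
  \<comment> \<open>Transferring the statement along \<open>digits\<close> requires a measurable set
    of good points; equality of two sequences is expressed by countably many conditions on an index
    \<open>i\<close> and a value \<open>v\<close>.\<close>
  let ?D = "\<lambda>i v. {x \<in> Seqs. digits (seq_value x) i = v} \<inter> {x \<in> Seqs. x i = v}"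
  have "?D i v \<in> sets seq_measure" for i v
  proof (rule sets.Int)
    have "(\<lambda>x. digits (seq_value x) i) \<in> measurable seq_measure (count_space UNIV)"
      using measurable_seq_value_borel measurable_digit_borel by (rule measurable_compose)
    from measurable_sets[OF this, of "{v}"]
    show "{x \<in> Seqs. digits (seq_value x) i = v} \<in> sets seq_measure" by (simp add: vimage_def Int_def conj_commute)
    show "{x \<in> Seqs. x i = v} \<in> sets seq_measure"
      unfolding sets_seq_measure by (rule determined_sets[of "Suc i"]) (auto simp: determined_def agree_def)
  qed
  then have "Seqs \<inter> (\<Inter>i. \<Union>v. ?D i v) \<in> sets seq_measure"
    using sets.top[of seq_measure] by (intro sets.Int sets.countable_INT sets.countable_UN'') auto
  moreover have "?P = Seqs \<inter> (\<Inter>i. \<Union>v. ?D i v)" by (auto simp: fun_eq_iff)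
  ultimately have P: "{x \<in> space seq_completion. digits (seq_value x) = x} \<in> sets seq_completion" by simp
  have "AE t in unit_lebesgue. digits (seq_value (digits t)) = digits t"
    using AE_seq_value_digits by eventually_elim simp
  then have "AE x in distr unit_lebesgue seq_completion digits. digits (seq_value x) = x"
    using AE_distr_iff[OF digits_completion(1) P] by simp
  then show ?thesis by (simp only: digits_completion(2))
qed

text \<open>The measure space has to live on \<open>real\<close>. Any injection will do, measurable
  or not, because \<open>embed_measure\<close> transports both the sigma-algebra and the
  measure.\<close>

lemma ex_inj_seq_real: "\<exists>\<kappa> :: (nat \<Rightarrow> int) \<Rightarrow> real. inj \<kappa>"
proof -
  obtain f :: "nat set \<Rightarrow> real" where f: "inj f"
    using nat_sets_eqpoll_reals unfolding eqpoll_def bij_betw_def by blast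
  define g where "g = (\<lambda>x :: nat \<Rightarrow> int. range (\<lambda>i. prod_encode (i, int_encode (x i))))"
  have "inj g"
  proof (rule injI, rule ext)
    fix x y i assume "g x = g y"
    then have "prod_encode (i, int_encode (x i)) \<in> g y" by (auto simp: g_def)
    then show "x i = y i" by (auto simp: g_def prod_encode_eq int_encode_eq)
  qed
  with f have "inj (f \<circ> g)" by (simp add: inj_compose)
  then show ?thesis by blast
qed

lemma mp_transf_embed_measure:
  assumes \<kappa>: "inj \<kappa>" and f: "f \<in> mp_transf N"
  shows "\<kappa> \<circ> f \<circ> the_inv \<kappa> \<in> mp_transf (embed_measure N \<kappa>)"
proof -
  let ?E = "embed_measure N \<kappa>"
  obtain g where g: "f \<in> measurable N N" "g \<in> measurable N N" "distr N N f = N"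
    "\<And>x. x \<in> space N \<Longrightarrow> g (f x) = x" "\<And>x. x \<in> space N \<Longrightarrow> f (g x) = x"
    using f by (rule mp_transfE) blast
  have k: "\<kappa> \<in> measurable N ?E" using \<kappa> by (rule measurable_embed_measure2)
  have m: "\<kappa> \<circ> h \<circ> the_inv \<kappa> \<in> measurable ?E ?E" if "h \<in> measurable N N" for h
    using \<kappa> measurable_comp[OF that k] by (intro measurable_embed_measure1) (simp add: o_def the_inv_f_f)
  show ?thesis
  proof (rule mp_transfI[where g = "\<kappa> \<circ> g \<circ> the_inv \<kappa>"])
    have "distr ?E ?E (\<kappa> \<circ> f \<circ> the_inv \<kappa>) = distr (distr N ?E \<kappa>) ?E (\<kappa> \<circ> f \<circ> the_inv \<kappa>)"
      using embed_measure_eq_distr[OF \<kappa>, of N] by simp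
    also have "\<dots> = distr N ?E (\<kappa> \<circ> f \<circ> the_inv \<kappa> \<circ> \<kappa>)" using m[OF g(1)] k by (rule distr_distr)
    also have "\<kappa> \<circ> f \<circ> the_inv \<kappa> \<circ> \<kappa> = \<kappa> \<circ> f" using \<kappa> by (simp add: o_def fun_eq_iff the_inv_f_f)
    also have "distr N ?E (\<kappa> \<circ> f) = distr (distr N N f) ?E \<kappa>" using k g(1) by (rule distr_distr[symmetric])
    also have "\<dots> = ?E" using g(3) embed_measure_eq_distr[OF \<kappa>, of N] by simp
    finally show "distr ?E ?E (\<kappa> \<circ> f \<circ> the_inv \<kappa>) = ?E" .
  qed (use m g \<kappa> in \<open>auto simp: space_embed_measure the_inv_f_f\<close>)
qed

lemma standard_lebesgue_space_embed:
  assumes \<kappa>: "inj \<kappa>"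
  shows "standard_lebesgue_space (embed_measure seq_completion \<kappa>)"
proof -
  let ?E = "embed_measure seq_completion \<kappa>"
  have k: "\<kappa> \<in> measurable seq_completion ?E" using \<kappa> by (rule measurable_embed_measure2)
  have E: "distr seq_completion ?E \<kappa> = ?E" using embed_measure_eq_distr[OF \<kappa>, of seq_completion] by simp
  let ?f = "seq_value \<circ> the_inv \<kappa>" and ?g = "\<kappa> \<circ> digits"
  have f: "?f \<in> measurable ?E unit_lebesgue"
    using \<kappa> seq_value_completion(1) by (intro measurable_embed_measure1) (simp add: the_inv_f_f)
  have g: "?g \<in> measurable unit_lebesgue ?E" using digits_completion(1) k by (rule measurable_comp)
  have dg: "distr unit_lebesgue ?E ?g = ?E"
    using distr_distr[OF k digits_completion(1)] digits_completion(2) E by simp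
  have "distr ?E unit_lebesgue ?f = distr (distr seq_completion ?E \<kappa>) unit_lebesgue ?f" by (simp only: E)
  also have "\<dots> = distr seq_completion unit_lebesgue (?f \<circ> \<kappa>)" using f k by (rule distr_distr)
  also have "?f \<circ> \<kappa> = seq_value" using \<kappa> by (simp add: o_def fun_eq_iff the_inv_f_f)
  finally have df: "distr ?E unit_lebesgue ?f = unit_lebesgue" by (simp only: seq_value_completion(2))
  have fg: "AE y in unit_lebesgue. ?f (?g y) = y"
    using AE_seq_value_digits \<kappa> by (simp add: the_inv_f_f)
  have "AE x in ?E. ?g (?f x) = x"
    unfolding AE_embed_measure[OF \<kappa>] using AE_digits_seq_value
    by eventually_elim (simp add: the_inv_f_f \<kappa>)
  moreover have "prob_space ?E"
    using seq_completion.prob_space_distr[OF k] by (simp only: E)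
  ultimately show ?thesis
    unfolding standard_lebesgue_space_def Let_def using f g df dg fg by blast
qed

theorem mainTheorem6:
  shows "\<exists>(G :: (nat \<Rightarrow> real) monoid) (T :: (nat \<Rightarrow> real) topology).
           polish_group G T \<and> monothetic G T \<and> \<not> levy_group G T \<and>
           (\<exists>(M :: real measure) \<phi>.
              standard_lebesgue_space M \<and> boolean_action G T M \<phi> \<and> whirly G T M \<phi>)"
proof -
  obtain \<kappa> :: "(nat \<Rightarrow> int) \<Rightarrow> real" where \<kappa>: "inj \<kappa>" using ex_inj_seq_real by blast
  define M where "M = embed_measure seq_completion \<kappa>"
  define F where "F = (\<lambda>g. \<kappa> \<circ> flow (floor_seq g) \<circ> the_inv \<kappa>)"
  have std: "standard_lebesgue_space M" unfolding M_def using \<kappa> by (rule standard_lebesgue_space_embed)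
  then interpret M: prob_space M by (simp add: standard_lebesgue_space_def)
  have sM: "\<exists>A'. A' \<in> sets seq_completion \<and> A = \<kappa> ` A'" if "A \<in> sets M" for A
    using that sets_embed_measure[OF \<kappa>, of seq_completion] by (auto simp: M_def)
  have mM: "measure M (\<kappa> ` A') = measure seq_completion A'" if "A' \<in> sets seq_completion" for A'
    using that \<kappa> by (simp add: M_def measure_def emeasure_embed_measure_image)
  have Fim: "F g ` \<kappa> ` A' = \<kappa> ` flow (floor_seq g) ` A'" for g A'
    using \<kappa> by (simp add: F_def image_image the_inv_f_f)
  have fn: "l1_finite (floor_seq g)" if "g \<in> l1_carrier" for g using that by (rule l1_carrier_E) simp
  have F: "F g \<in> mp_transf M" if "g \<in> carrier l1_group" for g
    unfolding F_def M_def using that fn by (intro mp_transf_embed_measure[OF \<kappa>] flow_mp_transf) simp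
  have flow_sets: "flow (floor_seq g) ` A' \<in> sets seq_completion" if "g \<in> l1_carrier" "A' \<in> sets seq_completion" for g A'
    using flow_mp_transf[OF fn[OF that(1)]] that(2) by (rule mp_transf_image_sets)
  have l1_dist_one: "l1_dist \<one>\<^bsub>l1_group\<^esub> g = l1_norm (floor_seq g)" if gL: "g \<in> l1_carrier" for g
  proof -
    have "l1_dist \<one>\<^bsub>l1_group\<^esub> g = l1_dist g \<one>\<^bsub>l1_group\<^esub>" by (rule l1_metric.commute)
    moreover obtain c where "g = real_seq c" "l1_finite c" using gL by (auto elim: l1_carrier_E)
    then have "l1_dist g \<one>\<^bsub>l1_group\<^esub> = l1_norm (floor_seq g)" by (simp add: l1_dist_real_seq)
    ultimately show ?thesis by (rule trans)
  qed
  have one: "\<one>\<^bsub>l1_group\<^esub> \<in> l1_carrier" using l1_group.one_closed by simp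
  have act: "boolean_action l1_group l1_topology M (\<lambda>g. aut_class M (F g))"
  proof (rule boolean_actionI)
    show "topological_group l1_group l1_topology" by (rule topological_group_l1_group)
    show "finite_measure M" by (rule M.finite_measure_axioms)
    show "F g \<in> mp_transf M" if "g \<in> carrier l1_group" for g using that by (rule F)
    show "AE x in M. F (g \<otimes>\<^bsub>l1_group\<^esub> h) x = F g (F h x)" if gh: "g \<in> carrier l1_group" "h \<in> carrier l1_group" for g h
    proof -
      \<comment> \<open>In a product the right factor acts first, as does the first summand in
        \<open>AE_flow_flow\<close>; hence \<open>h\<close> is put first. The reduction modulo each
        \<open>modulus i\<close> made by the group law is invisible to the flow.\<close>
      have "flow (floor_seq (g \<otimes>\<^bsub>l1_group\<^esub> h)) = flow (\<lambda>i. floor_seq h i + floor_seq g i)"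
        by (rule flow_cong) (simp add: translate_def add.commute)
      then have "AE x in seq_measure. flow (floor_seq (g \<otimes>\<^bsub>l1_group\<^esub> h)) x = flow (floor_seq g) (flow (floor_seq h) x)"
        using AE_flow_flow[OF fn fn, of h g] gh by (simp del: l1_group_simps(2))
      then have "AE x in seq_completion. flow (floor_seq (g \<otimes>\<^bsub>l1_group\<^esub> h)) x = flow (floor_seq g) (flow (floor_seq h) x)"
        by (rule AE_completion)
      then show ?thesis
        unfolding M_def AE_embed_measure[OF \<kappa>] by eventually_elim (use \<kappa> in \<open>simp add: F_def the_inv_f_f\<close>)
    qed
    fix A \<epsilon> assume A: "A \<in> sets M" and \<epsilon>: "(\<epsilon>::real) > 0"
    obtain A' where A': "A' \<in> sets seq_completion" "A = \<kappa> ` A'" using sM[OF A] by blast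
    obtain r where r: "r > 0" "\<And>c. l1_finite c \<Longrightarrow> l1_norm c < r \<Longrightarrow> measure seq_completion (sym_diff A' (flow c ` A')) < \<epsilon>"
      using flow_continuous[OF A'(1) \<epsilon>] by blast
    have "measure M (sym_diff A (F g ` A)) < \<epsilon>" if g: "g \<in> l1_metric.mball \<one>\<^bsub>l1_group\<^esub> r" for g
    proof -
      have gL: "g \<in> l1_carrier" "l1_norm (floor_seq g) < r" using g l1_dist_one by auto
      have "sym_diff A (F g ` A) = \<kappa> ` sym_diff A' (flow (floor_seq g) ` A')"
        unfolding A'(2) Fim using \<kappa> by (simp add: image_Un image_set_diff)
      then have "measure M (sym_diff A (F g ` A)) = measure seq_completion (sym_diff A' (flow (floor_seq g) ` A'))"
        using A'(1) flow_sets[OF gL(1) A'(1)] by (simp only:) (intro mM, auto)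
      then show ?thesis using r(2)[OF fn[OF gL(1)] gL(2)] by simp
    qed
    moreover have "openin l1_topology (l1_metric.mball \<one>\<^bsub>l1_group\<^esub> r)" unfolding l1_topology_def by (rule l1_metric.openin_mball)
    moreover have "\<one>\<^bsub>l1_group\<^esub> \<in> l1_metric.mball \<one>\<^bsub>l1_group\<^esub> r" using one r(1) l1_metric.centre_in_mball_iff by blast
    ultimately show "\<exists>U. openin l1_topology U \<and> \<one>\<^bsub>l1_group\<^esub> \<in> U \<and> (\<forall>g\<in>U. measure M (sym_diff A (F g ` A)) < \<epsilon>)"
      by blast
  qed
  have "whirly l1_group l1_topology M (\<lambda>g. aut_class M (F g))"
    unfolding whirly_def
  proof (intro ballI impI allI)
    fix A B U assume A: "A \<in> sets M" "measure M A > 0" and B: "B \<in> sets M" "measure M B > 0"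
      and U: "openin l1_topology U" "\<one>\<^bsub>l1_group\<^esub> \<in> U"
    obtain r where r: "r > 0" "l1_metric.mball \<one>\<^bsub>l1_group\<^esub> r \<subseteq> U"
      using U unfolding l1_topology_def l1_metric.openin_mtopology by blast
    obtain A' B' where A': "A' \<in> sets seq_completion" "A = \<kappa> ` A'" and B': "B' \<in> sets seq_completion" "B = \<kappa> ` B'"
      using sM A(1) B(1) by meson
    obtain c where c: "c \<in> Seqs" "l1_finite c" "l1_norm c < r" "measure seq_completion (A' \<inter> flow c ` B') > 0"
      using flow_whirly[of A' B' r] A' B' A(2) B(2) r(1) mM by metis
    have g: "real_seq c \<in> l1_carrier" using c by simp
    have "real_seq c \<in> l1_metric.mball \<one>\<^bsub>l1_group\<^esub> r" using l1_dist_one[OF g] one g c(3) unfolding l1_metric.in_mball by simp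
    then have "real_seq c \<in> U" using r(2) by blast
    moreover have "A \<inter> F (real_seq c) ` B = \<kappa> ` (A' \<inter> flow c ` B')"
      unfolding A'(2) B'(2) Fim using \<kappa> by (simp add: image_Int)
    then have "measure M (A \<inter> F (real_seq c) ` B) > 0"
      using c(4) mM[of "A' \<inter> flow c ` B'"] A'(1) flow_sets[OF g B'(1)] by simp
    moreover have "F (real_seq c) \<in> aut_class M (F (real_seq c))" using F[of "real_seq c"] g by (simp add: aut_class_self)
    ultimately show "\<exists>g\<in>U. \<exists>f\<in>aut_class M (F g). measure M (A \<inter> f ` B) > 0" by blast
  qed
  with std act show ?thesis
    using polish_group_l1_group monothetic_l1_group not_levy_group_l1_group by blast
qed

end
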